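(* Let $r, s \ge 1$ and let $f \in \mathbb{Z}[T_1, \dots, T_s, Y_1, \dots, Y_r]$ be a polynomial irreducible over $\mathbb{Q}$ of total degree $d$. Let $1 \le B_1 \leq B_2 \leq \dots \leq B_s$. Then \[ S(f, B_1, \dots, B_s) \ll_{d, r, s} B_1 \Big(\prod_{i=2}^s B_i^2\Big) (\log\|f\| + \log B_s)^5 . \]
   Context: The height of a rational number $t = x/y$ in lowest terms is $H(t)=\max(|x|,|y|)$. For a nonzero integer polynomial $f$, $\|f\|$ is the maximum of $2$ and the absolute values of its coefficients. $S(f,B_1,\dots,B_s)$ is the number of $(t_1,\dots,t_s)\in\mathbb{Q}^s$ with $H(t_i)\le B_i$ for $i=1,\dots,s$ such that $f(t_1,\dots,t_s,Y_1,\dots,Y_r)$ is reducible in $\mathbb{Q}[Y_1,\dots,Y_r]$. $U \ll_\rho V$ means $|U|\le cV$ for a positive constant $c$ depending only on $\rho$. *)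

theory Defs
  imports Complex_Main "HOL-Library.Poly_Mapping" "HOL-Computational_Algebra.Factorial_Ring"
begin

text \<open>Multivariate polynomials are finitely supported maps from monomials (exponent
  vectors, themselves finitely supported) to coefficients.  The polynomial f in
  Z[T_1..T_s, Y_1..Y_r] uses variable index Inl i for T_(i+1) and Inr j for Y_(j+1).\<close>

type_synonym 'a mpoly = "(nat \<Rightarrow>\<^sub>0 nat) \<Rightarrow>\<^sub>0 'a"
type_synonym 'a tymp = "(nat + nat \<Rightarrow>\<^sub>0 nat) \<Rightarrow>\<^sub>0 'a"

definition vars_within :: "nat \<Rightarrow> nat \<Rightarrow> int tymp \<Rightarrow> bool" where
  "vars_within s r f \<longleftrightarrow>
     (\<forall>m \<in> Poly_Mapping.keys f. Poly_Mapping.keys m \<subseteq> Inl ` {..<s} \<union> Inr ` {..<r})"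

definition total_degree :: "('b::zero) tymp \<Rightarrow> nat" where
  "total_degree f = Max (insert 0 ((\<lambda>m. sum (Poly_Mapping.lookup m) (Poly_Mapping.keys m)) ` Poly_Mapping.keys f))"

definition poly_norm :: "int tymp \<Rightarrow> int" where
  "poly_norm f = Max (insert 2 ((\<lambda>m. \<bar>Poly_Mapping.lookup f m\<bar>) ` Poly_Mapping.keys f))"

definition height :: "rat \<Rightarrow> int" where
  "height t = max \<bar>fst (quotient_of t)\<bar> \<bar>snd (quotient_of t)\<bar>"

definition specialize :: "int tymp \<Rightarrow> (nat \<Rightarrow> rat) \<Rightarrow> rat mpoly" where
  "specialize f t =
     (\<Sum>m \<in> Poly_Mapping.keys f. Poly_Mapping.single (Poly_Mapping.map_key Inr m)
        (of_int (Poly_Mapping.lookup f m) * (\<Prod>i \<in> Inl -` Poly_Mapping.keys m. t i ^ Poly_Mapping.lookup m (Inl i))))"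

definition reducible_mp :: "rat mpoly \<Rightarrow> bool" where
  "reducible_mp p \<longleftrightarrow> \<not> Poly_Mapping.keys p \<subseteq> {0} \<and> \<not> irreducible p"

text \<open>S(f,B_1..B_s); tuples are encoded as t :: nat \<Rightarrow> rat with t i = 0 for i \<ge> s\<close>
definition S_count :: "int tymp \<Rightarrow> nat \<Rightarrow> (nat \<Rightarrow> real) \<Rightarrow> nat" where
  "S_count f s B = card {t :: nat \<Rightarrow> rat. (\<forall>i \<ge> s. t i = 0) \<and>
      (\<forall>i < s. real_of_int (height (t i)) \<le> B i) \<and> reducible_mp (specialize f t)}"

end

theory Submission
  imports "Berlekamp_Zassenhaus.Factor_Bound"
    "Subresultants.Subresultant_Gcd" "HOL-Real_Asymp.Real_Asymp" Defs
begin

text \<open>Specialise \<open>T\<^sub>s, ..., T\<^sub>1\<close> one after the other. If \<open>f\<close> is irreducible and becomes reducible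
  in the end, then some step, say that of \<open>T\<^sub>j\<close>, turns a polynomial \<open>F\<close> that does not split into one that
  does. Given the other \<open>t\<^sub>i\<close>, at most \<open>O(B\<^sub>j L ^ 4)\<close> values of \<open>t\<^sub>j\<close> do this, where \<open>L\<close> is
  the sum of the logarithms; the other coordinates contribute \<open>O(B\<^sub>i ^ 2)\<close> each, and the smallest \<open>B\<^sub>i\<close>
  gives the worst case for \<open>j\<close>.

  For one variable \<open>T\<close>, Kronecker substitution makes the two factors of \<open>F(t, Y)\<close> univariate. Let
  \<open>p > 4 B\<close> be a prime of good reduction for \<open>t\<close>. By Newton iteration the reductions of the irreducible
  factors modulo \<open>p\<close>, together with the residue of \<open>t\<close>, determine polynomials \<open>\<phi>(T)\<close> to which the
  (normalised) coefficients of the factors are congruent modulo \<open>p ^ (2 A)\<close>. The pigeonhole principle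
  yields \<open>P\<^sub>0, P\<^sub>1\<close> of degree less than \<open>A = O(L)\<close> with small coefficients such that
  \<open>P\<^sub>0 + \<phi> P\<^sub>1\<close> vanishes modulo \<open>p ^ (2 A)\<close> on the residue class, and size considerations turn this
  congruence into an equation for the true coefficients. Hence in each of the \<open>O(B L ^ 3)\<close> classes the
  coefficients of the factors are rational functions of \<open>t\<close> of degree \<open>O(L)\<close>; a class with more than
  \<open>O(L)\<close> points would, by the lemma of Gauss, give a factorisation of \<open>F\<close>.\<close>

hide_const (open) UnivPoly.coeff UnivPoly.monom Group.monoid.mult module.smult Coset.order
  Divisibility.irreducible Divisibility.prime Module.smult

section \<open>Lifting factors modulo prime powers and interpolating them on residue classes\<close>

section \<open>Congruences of integer polynomials\<close>

text \<open>Two obstacles shape the proof. A fibre may have repeated factors, so no discriminant can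
  select the good primes: each irreducible factor \<open>q\<close> is lifted in a derivative of the
  fibre that it divides exactly once, and the resultant of \<open>q\<close> with its cofactor there
  decides which primes are good. Moreover the Kronecker image of a polynomial that does not split
  may well factor, so the interpolated factors are compared with the multivariate polynomial and not
  with its image.

  The exponents come from sizes. The resultants have logarithm \<open>O(L)\<close>, so among
  \<open>O(L)\<close> primes one is good for the given point; as these have size
  \<open>O(B L^2)\<close>, there are \<open>O(B L^3)\<close> pairs of a prime and a residue, each
  with boundedly many lists of factors. The condition \<open>p > 4 B\<close> lets
  \<open>p ^ (A - 1)\<close> outgrow the values of forms of degree \<open>A - 1\<close> at points of
  height \<open>B\<close>, together with the remaining constants. Each class then holds
  \<open>O(L)\<close> points, which gives \<open>O(B L^4)\<close>, and \<open>L \<ge> ln 2\<close>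
  turns this into the stated fifth power.\<close>

definition pcong :: "int \<Rightarrow> int poly \<Rightarrow> int poly \<Rightarrow> bool" where
  "pcong m A B \<longleftrightarrow> [:m:] dvd A - B"

lemma pcong_iff: "pcong m A B \<longleftrightarrow> (\<forall>i. m dvd coeff A i - coeff B i)"
  by (simp add: pcong_def const_poly_dvd_iff)

lemma pcong_refl [simp]: "pcong m A A"
  by (simp add: pcong_def)

lemma pcong_sym: "pcong m A B \<Longrightarrow> pcong m B A"
  by (metis pcong_iff dvd_diff_commute)

lemma pcong_trans [trans]: "pcong m A B \<Longrightarrow> pcong m B C \<Longrightarrow> pcong m A C"
  using dvd_add[of "[:m:]" "A - B" "B - C"] by (simp add: pcong_def)

lemma pcong_add: "pcong m A B \<Longrightarrow> pcong m C D \<Longrightarrow> pcong m (A + C) (B + D)"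
  using dvd_add[of "[:m:]" "A - B" "C - D"] by (simp add: pcong_def algebra_simps)

lemma pcong_diff: "pcong m A B \<Longrightarrow> pcong m C D \<Longrightarrow> pcong m (A - C) (B - D)"
  using dvd_diff[of "[:m:]" "A - B" "C - D"] by (simp add: pcong_def algebra_simps)

lemma pcong_mult: assumes "pcong m A B" "pcong m C D" shows "pcong m (A * C) (B * D)"
proof -
  have "A * C - B * D = (A - B) * C + B * (C - D)" by (simp add: algebra_simps)
  thus ?thesis using assms by (simp add: pcong_def)
qed

lemma pcong_smult: "pcong m A B \<Longrightarrow> pcong m (smult c A) (smult c B)"
  by (simp add: pcong_iff flip: right_diff_distrib)

lemma pcong_smult_cong: "[c = d] (mod m) \<Longrightarrow> pcong m (smult c A) (smult d A)"
  by (simp add: pcong_iff cong_iff_dvd_diff flip: left_diff_distrib)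

lemma pcong_dvd_mono: "pcong m A B \<Longrightarrow> k dvd m \<Longrightarrow> pcong k A B"
  unfolding pcong_iff by (meson dvd_trans)

lemma pcong_pderiv: "pcong m A B \<Longrightarrow> pcong m (pderiv A) (pderiv B)"
  unfolding pcong_iff coeff_pderiv by (metis dvd_mult right_diff_distrib)

text \<open>The last coefficient of \<open>X\<close> not divisible by \<open>m\<close>, at index
  \<open>i\<close>, would reappear modulo \<open>m\<close> at index \<open>degree q + i\<close>,
  which \<open>R\<close> does not reach. Thus division by a monic polynomial stays unique modulo any
  \<open>m\<close>.\<close>

lemma monic_division_dvd:
  fixes q X R :: "int poly"
  assumes "monic q" "[:m:] dvd q * X + R" "R = 0 \<or> degree R < degree q"
  shows "[:m:] dvd X" "[:m:] dvd R"
proof -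
  show *: "[:m:] dvd X"
  proof (rule ccontr)
    assume "\<not> [:m:] dvd X"
    then obtain i0 where "\<not> m dvd coeff X i0" by (auto simp: const_poly_dvd_iff)
    have bnd: "\<forall>i. \<not> m dvd coeff X i \<longrightarrow> i \<le> degree X"
      by (metis dvd_0_right le_degree)
    define i where "i = (GREATEST i. \<not> m dvd coeff X i)"
    have i: "\<not> m dvd coeff X i" "\<And>j. \<not> m dvd coeff X j \<Longrightarrow> j \<le> i"
      using GreatestI_nat[of "\<lambda>i. \<not> m dvd coeff X i" i0 "degree X"]
        Greatest_le_nat[of "\<lambda>i. \<not> m dvd coeff X i" _ "degree X"] \<open>\<not> m dvd coeff X i0\<close> bnd
      unfolding i_def by blast+
    have R0: "coeff R (degree q + i) = 0" using assms(3) by (auto intro: coeff_eq_0)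
    have "m dvd coeff (q * X + R) (degree q + i)" using assms(2) by (auto simp: const_poly_dvd_iff)
    hence "m dvd (\<Sum>k\<le>degree q + i. coeff q k * coeff X (degree q + i - k))"
      by (simp add: R0 coeff_mult)
    also have "(\<Sum>k\<le>degree q + i. coeff q k * coeff X (degree q + i - k)) =
        coeff q (degree q) * coeff X i + (\<Sum>k\<in>{..degree q + i} - {degree q}. coeff q k * coeff X (degree q + i - k))"
      by (subst sum.remove[of _ "degree q"]) auto
    finally have "m dvd coeff X i + (\<Sum>k\<in>{..degree q + i} - {degree q}. coeff q k * coeff X (degree q + i - k))"
      using assms(1) by simp
    moreover have "m dvd (\<Sum>k\<in>{..degree q + i} - {degree q}. coeff q k * coeff X (degree q + i - k))"
    proof (rule dvd_sum)
      fix k assume k: "k \<in> {..degree q + i} - {degree q}"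
      show "m dvd coeff q k * coeff X (degree q + i - k)"
      proof (cases "k > degree q")
        case True thus ?thesis by (simp add: coeff_eq_0)
      next
        case False
        hence "degree q + i - k > i" using k by auto
        thus ?thesis using i(2) by (meson dvd_mult leD)
      qed
    qed
    ultimately show False using i(1) by (simp add: dvd_add_left_iff)
  qed
  show "[:m:] dvd R" using assms(2) * by (simp add: dvd_add_right_iff)
qed

lemma degree_diff_monic:
  fixes A B :: "'a :: comm_ring_1 poly"
  assumes "monic A" "monic B" "degree A = degree B"
  shows "A - B = 0 \<or> degree (A - B) < degree B"
proof (cases "A - B = 0")
  case False
  have "coeff (A - B) (degree B) = 0" using assms by simp
  moreover have "lead_coeff (A - B) \<noteq> 0" using False unfolding leading_coeff_0_iff .
  ultimately have "degree (A - B) \<noteq> degree B" by auto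
  moreover have "degree (A - B) \<le> degree B" using assms by (intro degree_diff_le) auto
  ultimately show ?thesis by simp
qed simp

lemma monic_pcong_cancel:
  assumes "monic q" "pcong m (q * X) (q * Y)" shows "pcong m X Y"
  using monic_division_dvd(1)[of q m "X - Y" 0] assms
  by (simp add: pcong_def right_diff_distrib)

lemma monic_division_exists:
  fixes q N :: "'a :: comm_ring_1 poly"
  assumes "monic q"
  obtains S R where "N = q * S + R" "R = 0 \<or> degree R < degree q"
proof -
  have q0: "q \<noteq> 0" using assms by auto
  obtain S R where *: "pseudo_divmod N q = (S, R)" by fastforce
  from pseudo_divmod[OF q0 *] assms have "N = q * S + R" "R = 0 \<or> degree R < degree q" by auto
  thus ?thesis by (rule that)
qed

section \<open>Newton iteration for a simple factor in a family of polynomials\<close>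

definition evT :: "'a::comm_ring_1 \<Rightarrow> 'a poly poly \<Rightarrow> 'a poly" where
  "evT z Q = map_poly (\<lambda>c. poly c z) Q"

lemma coeff_evT [simp]: "coeff (evT z Q) i = poly (coeff Q i) z"
  by (simp add: evT_def coeff_map_poly)

lemma evT_add: "evT z (P + Q) = evT z P + evT z Q"
  by (rule poly_eqI) simp

lemma evT_mult: "evT z (P * Q) = evT z P * evT z Q"
  by (rule poly_eqI) (simp add: coeff_mult poly_sum)

lemma evT_1 [simp]: "evT z 1 = 1"
  by (rule poly_eqI) (simp add: coeff_1)

lemma evT_const [simp]: "evT z (map_poly (\<lambda>c. [:c:]) q) = q"
  by (rule poly_eqI) (simp add: coeff_map_poly)

lemma pderiv_evT: "pderiv (evT z Q) = evT z (pderiv Q)"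
  by (rule poly_eqI) (simp add: coeff_pderiv)

lemma degree_evT_le: "degree (evT z Q) \<le> degree Q"
  by (simp add: evT_def degree_map_poly_le)

lemma degree_evT_monic: "monic Q \<Longrightarrow> degree (evT z Q) = degree Q"
  by (intro antisym degree_evT_le le_degree) simp

lemma monic_evT: "monic Q \<Longrightarrow> monic (evT z Q)"
  by (simp add: degree_evT_monic)

lemma poly_int_dvd_diff: "z - w dvd poly P z - poly (P :: int poly) w"
proof (induction P)
  case (pCons a P)
  have "poly (pCons a P) z - poly (pCons a P) w = (z - w) * poly P z + w * (poly P z - poly P w)"
    by (simp add: algebra_simps)
  thus ?case using pCons.IH by simp
qed simp

lemma pcong_evT: "[z = w] (mod m) \<Longrightarrow> pcong m (evT z Q) (evT w Q)"
  unfolding pcong_iff coeff_evT cong_iff_dvd_diff by (meson dvd_trans poly_int_dvd_diff)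

text \<open>Meant for \<open>P\<close> and \<open>M\<close> the powers \<open>p ^ Suc n\<close> and
  \<open>p ^ Suc (Suc n)\<close>. The term \<open>ch * (q * v + M * W) - Q * S\<close> is the
  remainder added to \<open>Q\<close>, and \<open>P * \<delta>\<close> is the correction it should
  be. Their difference is a multiple of \<open>Q\<close>, plus a multiple of \<open>P\<close> times
  the defect of the Bezout relation, plus a multiple of \<open>M\<close>.\<close>

lemma newton_identity:
  fixes q :: "'a :: comm_ring_1"
  assumes "q = Q + P * \<delta>"
  shows "ch * (q * v + M * W) - Q * S - P * \<delta> =
    Q * (ch * v - S - P * \<delta> * uh) + P * \<delta> * (ch * v + uh * Q - 1) + M * (ch * W)"
  by (simp add: assms algebra_simps)

text \<open>The Newton step adds to \<open>Q\<close> the remainder of \<open>c N\<close> modulo \<open>Q\<close>, which is a polynomial in the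
  parameter: one \<open>Q\<close> approximates the factors at all points of a residue class simultaneously.\<close>

lemma newton_family:
  fixes qh ch uh vh :: "int poly" and NN :: "int poly poly" and p \<tau> :: int
  assumes qh: "monic qh" and bez: "pcong p (ch * vh + uh * qh) 1"
    and tau: "pcong p (evT \<tau> NN) (qh * vh)"
  shows "\<exists>Q. monic Q \<and> degree Q = degree qh \<and>
    (\<forall>z q v. [z = \<tau>] (mod p) \<longrightarrow> monic q \<longrightarrow> degree q = degree qh \<longrightarrow> pcong p q qh \<longrightarrow>
       pcong (p ^ Suc n) (evT z NN) (q * v) \<longrightarrow> pcong (p ^ Suc n) (evT z Q) q)"
proof (induction n)
  case 0
  have "degree (map_poly (\<lambda>c. [:c:]) qh) = degree qh" by (rule degree_map_poly) auto
  moreover have "monic (map_poly (\<lambda>c. [:c:]) qh)" using calculation qh by (simp add: coeff_map_poly)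
  ultimately show ?case by (intro exI[of _ "map_poly (\<lambda>c. [:c:]) qh"]) (auto intro: pcong_sym)
next
  case (Suc n)
  then obtain Q where Q: "monic Q" "degree Q = degree qh"
    "\<And>z q v. [z = \<tau>] (mod p) \<Longrightarrow> monic q \<Longrightarrow> degree q = degree qh \<Longrightarrow> pcong p q qh \<Longrightarrow>
       pcong (p ^ Suc n) (evT z NN) (q * v) \<Longrightarrow> pcong (p ^ Suc n) (evT z Q) q" by blast
  obtain S R where SR: "map_poly (\<lambda>c. [:c:]) ch * NN = Q * S + R" "R = 0 \<or> degree R < degree Q"
    using monic_division_exists[OF Q(1)] by metis
  have degQR: "degree (Q + R) = degree Q" using SR(2) by (auto simp: degree_add_eq_left)
  have "monic (Q + R)" using SR(2) Q(1) unfolding degQR by (auto simp: coeff_eq_0)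
  moreover have "pcong (p ^ Suc (Suc n)) (evT z (Q + R)) q"
    if z: "[z = \<tau>] (mod p)" and q: "monic q" "degree q = degree qh" "pcong p q qh"
      and N: "pcong (p ^ Suc (Suc n)) (evT z NN) (q * v)" for z q v
  proof -
    let ?M = "p ^ Suc (Suc n)"
    have "pcong (p ^ Suc n) (evT z NN) (q * v)" using N by (rule pcong_dvd_mono) simp
    hence IH: "pcong (p ^ Suc n) (evT z Q) q" by (rule Q(3)[OF z q])
    then obtain \<delta> where \<delta>: "q = evT z Q + [:p ^ Suc n:] * \<delta>"
      by (metis pcong_sym pcong_def dvd_def diff_eq_eq add.commute)
    have IHp: "pcong p (evT z Q) qh"
      using pcong_dvd_mono[OF IH, of p] q(3) pcong_trans by auto
    \<comment> \<open>Only \<open>q\<close> is lifted, but modulo \<open>p\<close> its cofactor is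
      forced: \<open>NN\<close> has the same reduction at \<open>z\<close> as at
      \<open>\<tau>\<close>, and the monic \<open>qh\<close> cancels. So one Bezout relation serves
      all \<open>z\<close>.\<close>
    have "pcong p (qh * v) (qh * vh)"
    proof -
      have "pcong p (qh * v) (q * v)" using q(3) by (intro pcong_mult) (auto intro: pcong_sym)
      also have "pcong p (q * v) (evT z NN)" using pcong_dvd_mono[OF N, of p] by (simp add: pcong_sym)
      also have "pcong p (evT z NN) (evT \<tau> NN)" by (rule pcong_evT[OF z])
      also note tau
      finally show ?thesis .
    qed
    hence v: "pcong p v vh" by (rule monic_pcong_cancel[OF qh])
    have "pcong p (ch * v + uh * evT z Q) (ch * vh + uh * qh)"
      by (intro pcong_add pcong_mult pcong_refl v IHp)
    with bez have "pcong p (ch * v + uh * evT z Q) 1" by (blast intro: pcong_trans)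
    then obtain Y where Y: "ch * v + uh * evT z Q = 1 + [:p:] * Y"
      by (metis pcong_def dvd_def diff_eq_eq add.commute)
    obtain W where W: "evT z NN = q * v + [:?M:] * W"
      using N by (metis pcong_def dvd_def diff_eq_eq add.commute)
    have R: "evT z R = ch * evT z NN - evT z Q * evT z S"
      using arg_cong[OF SR(1), of "evT z"] by (simp add: evT_mult evT_add)
    define X where "X = ch * v - evT z S - [:p ^ Suc n:] * \<delta> * uh"
    have "evT z R - [:p ^ Suc n:] * \<delta> = evT z Q * X + [:p ^ Suc n:] * \<delta> * (ch * v + uh * evT z Q - 1) + [:?M:] * (ch * W)"
      unfolding R W X_def by (rule newton_identity[OF \<delta>])
    also have "[:p ^ Suc n:] * \<delta> * (ch * v + uh * evT z Q - 1) = [:?M:] * (\<delta> * Y)"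
    proof -
      have M: "[:?M:] = [:p ^ Suc n:] * [:p:]" by simp
      show ?thesis unfolding Y add_diff_cancel_left' M by (simp only: ac_simps)
    qed
    finally have D: "evT z R - [:p ^ Suc n:] * \<delta> = evT z Q * X + [:?M:] * (\<delta> * Y + ch * W)"
      by (simp only: distrib_left add.assoc)
    define D where "D = evT z R - [:p ^ Suc n:] * \<delta>"
    have eD: "evT z (Q + R) - q = D" using \<delta> by (simp add: D_def evT_add)
    have mz: "monic (evT z (Q + R))" "degree (evT z (Q + R)) = degree q"
      using monic_evT[OF \<open>monic (Q + R)\<close>] degree_evT_monic[OF \<open>monic (Q + R)\<close>] degQR Q(2) q(2) by auto
    \<comment> \<open>As \<open>D\<close> has smaller degree than the monic \<open>evT z Q\<close>,
      uniqueness of division disposes of the unknown multiple \<open>X\<close> and leaves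
      \<open>D\<close> divisible by the new modulus.\<close>
    have degD: "D = 0 \<or> degree D < degree (evT z Q)"
      using degree_diff_monic[OF mz(1) q(1) mz(2)] degree_evT_monic[OF Q(1), of z] Q(2) q(2) by (simp add: eD)
    have "evT z Q * (- X) + D = [:?M:] * (\<delta> * Y + ch * W)"
      by (simp only: D_def D mult_minus_right minus_add_cancel)
    hence "[:?M:] dvd evT z Q * (- X) + D" by (rule dvdI)
    from monic_division_dvd(2)[OF monic_evT[OF Q(1)] this degD]
    show ?thesis by (simp add: pcong_def eD)
  qed
  ultimately show ?case using degQR Q(2) by (intro exI[of _ "Q + R"]) auto
qed

section \<open>Auxiliary polynomials by the pigeonhole principle\<close>

text \<open>At \<open>z = \<tau> + p * s\<close> the Taylor term of order \<open>l\<close> already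
  carries \<open>p ^ l\<close>, so its coefficient only has to supply \<open>p ^ (n - l)\<close>.
  This saves about half of the conditions in the pigeonhole argument.\<close>

lemma dvd_poly_expansion:
  fixes W :: "int poly"
  assumes "\<And>l. l < n \<Longrightarrow> p ^ (n - l) dvd coeff (pcompose W [:\<tau>, 1:]) l"
    and z: "[z = \<tau>] (mod p)"
  shows "p ^ n dvd poly W z"
proof -
  obtain s where s: "z = \<tau> + p * s" using z by (metis cong_iff_lin cong_sym)
  have "poly W z = poly (pcompose W [:\<tau>, 1:]) (p * s)" by (simp add: poly_pcompose s add.commute)
  also have "\<dots> = (\<Sum>l\<le>degree (pcompose W [:\<tau>, 1:]). coeff (pcompose W [:\<tau>, 1:]) l * (p * s) ^ l)"
    by (rule poly_altdef)
  also have "p ^ n dvd \<dots>"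
  proof (rule dvd_sum)
    fix l
    show "p ^ n dvd coeff (pcompose W [:\<tau>, 1:]) l * (p * s) ^ l"
    proof (cases "l < n")
      case True
      hence "p ^ n = p ^ (n - l) * p ^ l" by (simp flip: power_add)
      moreover have "p ^ l dvd (p * s) ^ l" by (simp add: power_mult_distrib)
      ultimately show ?thesis using assms(1)[OF True] by (simp add: mult_dvd_mono)
    next
      case False
      hence "p ^ n dvd p ^ l" by (simp add: le_imp_power_dvd)
      thus ?thesis by (simp add: power_mult_distrib)
    qed
  qed
  finally show ?thesis .
qed

text \<open>Prescribing the Taylor coefficient of order \<open>l\<close> modulo
  \<open>p ^ (2 * A - l)\<close> for all \<open>l < 2 * A\<close> leaves
  \<open>p ^ (A * (2 * A + 1))\<close> patterns, fewer than the choices of \<open>2 * A\<close>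
  coefficients in \<open>{0..p ^ (A + 1)}\<close>. The difference of two colliding choices works.
  Its coefficients are close to the square root of the modulus, which leaves a factor
  \<open>p ^ (A - 1)\<close> to spare.\<close>

lemma auxiliary_polynomials:
  fixes p \<tau> :: int and \<phi> :: "int poly"
  assumes p: "p > 1" and A: "A \<ge> 1"
  obtains P0 P1 :: "int poly" where "P0 \<noteq> 0 \<or> P1 \<noteq> 0"
    "\<And>i. \<bar>coeff P0 i\<bar> \<le> p ^ (A + 1)" "\<And>i. \<bar>coeff P1 i\<bar> \<le> p ^ (A + 1)"
    "degree P0 < A" "degree P1 < A"
    "\<And>z. [z = \<tau>] (mod p) \<Longrightarrow> p ^ (2 * A) dvd poly P0 z + poly P1 z * poly \<phi> z"
proof -
  define D where "D = ({..<2 * A} \<rightarrow>\<^sub>E {0..p ^ (A + 1)} :: (nat \<Rightarrow> int) set)"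
  define E where "E = (\<Pi>\<^sub>E l\<in>{..<2 * A}. {0..<p ^ (2 * A - l)})"
  define Q0 where "Q0 c = (\<Sum>i<A. monom (c i) i)" for c :: "nat \<Rightarrow> int"
  define Q1 where "Q1 c = (\<Sum>i<A. monom (c (A + i)) i)" for c :: "nat \<Rightarrow> int"
  have coeffQ0: "coeff (Q0 c) i = (if i < A then c i else 0)" for c i
    by (simp add: Q0_def coeff_sum)
  have coeffQ1: "coeff (Q1 c) i = (if i < A then c (A + i) else 0)" for c i
    by (simp add: Q1_def coeff_sum)
  define \<omega> where "\<omega> c = pcompose (Q0 c + Q1 c * \<phi>) [:\<tau>, 1:]" for c
  define key where "key c = (\<lambda>l\<in>{..<2 * A}. coeff (\<omega> c) l mod p ^ (2 * A - l))" for c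
  have "int (card E) = (\<Prod>l<2 * A. p ^ (2 * A - l))"
    using p by (simp add: E_def card_PiE)
  also have "\<dots> = p ^ (\<Sum>l<2 * A. 2 * A - l)" by (simp add: power_sum)
  also have "(\<Sum>l<2 * A. 2 * A - l) = (\<Sum>l=1..2 * A. l)"
    by (rule sum.reindex_bij_witness[of _ "\<lambda>l. 2 * A - l" "\<lambda>l. 2 * A - l"]) auto
  also have "(\<Sum>l=1..2 * A. l) \<le> (A + 1) * (2 * A)"
    using Sum_Icc_nat[of 1 "2 * A"] A by (simp add: algebra_simps)
  hence "p ^ (\<Sum>l=1..2 * A. l) \<le> p ^ ((A + 1) * (2 * A))" using p by (intro power_increasing) auto
  also have "\<dots> < (p ^ (A + 1) + 1) ^ (2 * A)"
    unfolding power_mult using p A by (intro power_strict_mono) auto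
  also have "\<dots> = int (card D)"
  proof -
    have "card {0..p ^ (A + 1)} = nat (p ^ (A + 1) + 1)" by simp
    thus ?thesis using p by (simp add: D_def card_PiE)
  qed
  finally have card: "card E < card D" by simp
  have "key ` D \<subseteq> E"
    unfolding key_def E_def using p by (intro image_subsetI) (simp only: restrict_PiE_iff, simp)
  moreover have "finite E" by (simp add: E_def finite_PiE)
  ultimately have "\<not> inj_on key D" using card card_inj_on_le[of key D E] by linarith
  then obtain c c' where cc: "c \<in> D" "c' \<in> D" "c \<noteq> c'" "key c = key c'" by (auto simp: inj_on_def)
  have bnd: "\<bar>c i - c' i\<bar> \<le> p ^ (A + 1)" if "i < 2 * A" for i
  proof -
    have "c i \<in> {0..p ^ (A + 1)}" "c' i \<in> {0..p ^ (A + 1)}" using cc that by (auto simp: D_def PiE_def Pi_def)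
    thus ?thesis by auto
  qed
  have nz: "Q0 c - Q0 c' \<noteq> 0 \<or> Q1 c - Q1 c' \<noteq> 0"
  proof (rule ccontr)
    assume "\<not> ?thesis"
    hence eq: "Q0 c = Q0 c'" "Q1 c = Q1 c'" by auto
    have "c i = c' i" if "i < 2 * A" for i
    proof (cases "i < A")
      case True thus ?thesis using arg_cong[OF eq(1), of "\<lambda>P. coeff P i"] by (simp add: coeffQ0)
    next
      case False
      hence "i - A < A" "A + (i - A) = i" using that by auto
      thus ?thesis using arg_cong[OF eq(2), of "\<lambda>P. coeff P (i - A)"] by (simp add: coeffQ1)
    qed
    hence "c = c'" using cc(1,2) unfolding D_def by (intro PiE_ext) auto
    with cc(3) show False ..
  qed
  have dvd: "p ^ (2 * A) dvd poly (Q0 c - Q0 c') z + poly (Q1 c - Q1 c') z * poly \<phi> z"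
    if "[z = \<tau>] (mod p)" for z
  proof -
    have "p ^ (2 * A) dvd poly ((Q0 c - Q0 c') + (Q1 c - Q1 c') * \<phi>) z"
    proof (rule dvd_poly_expansion[OF _ that])
      fix l assume l: "l < 2 * A"
      have "pcompose ((Q0 c - Q0 c') + (Q1 c - Q1 c') * \<phi>) [:\<tau>, 1:] = \<omega> c - \<omega> c'"
        by (simp add: \<omega>_def pcompose_diff[symmetric] algebra_simps)
      moreover have "coeff (\<omega> c) l mod p ^ (2 * A - l) = coeff (\<omega> c') l mod p ^ (2 * A - l)"
        using fun_cong[OF cc(4), of l] l by (simp add: key_def)
      ultimately show "p ^ (2 * A - l) dvd coeff (pcompose ((Q0 c - Q0 c') + (Q1 c - Q1 c') * \<phi>) [:\<tau>, 1:]) l"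
        by (simp add: mod_eq_dvd_iff)
    qed
    thus ?thesis by simp
  qed
  show ?thesis
  proof (rule that[OF nz _ _ _ _ dvd])
    show "\<bar>coeff (Q0 c - Q0 c') i\<bar> \<le> p ^ (A + 1)" for i using bnd[of i] p by (simp add: coeffQ0)
    show "\<bar>coeff (Q1 c - Q1 c') i\<bar> \<le> p ^ (A + 1)" for i using bnd[of "A + i"] p by (simp add: coeffQ1)
    show "degree (Q0 c - Q0 c') < A" "degree (Q1 c - Q1 c') < A"
      using A by (auto intro!: degree_lessI simp: coeffQ0 coeffQ1)
  qed
qed

section \<open>Supply of primes, divisors modulo a prime, and explicit size bounds\<close>

section \<open>A lower bound for the number of primes\<close>

text \<open>The numbers \<open>1 / (m * binomial n m)\<close> form the Leibniz harmonic triangle.\<close>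

lemma Leibniz_triangle_dvd:
  fixes L :: nat
  assumes "m \<ge> 1" "\<And>j. m \<le> j \<Longrightarrow> j \<le> m + k \<Longrightarrow> j dvd L"
  shows "m * ((m + k) choose m) dvd L"
  using assms
proof (induction k arbitrary: m)
  case 0
  thus ?case by simp
next
  case (Suc k)
  define n where "n = m + k"
  have "m * (n choose m) dvd L" using Suc.IH[of m] Suc.prems by (auto simp: n_def)
  moreover have "Suc m * (Suc n choose Suc m) dvd L"
    using Suc.IH[of "Suc m"] Suc.prems by (auto simp: n_def)
  ultimately obtain u w where "L = m * (n choose m) * u" and "L = Suc m * (Suc n choose Suc m) * w"
    by (elim dvdE) (rule that)
  hence u: "L = m * (n choose m) * u" and w: "L = Suc n * (n choose m) * w"
    by (simp_all only: Suc_times_binomial)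
  have "(Suc n - m) * (Suc n choose m) = Suc n * (n choose m)"
    using binomial_absorb_comp[of "Suc n" m] by simp
  hence c1: "Suc k * (Suc n choose m) = Suc n * (n choose m)" by (simp add: n_def)
  define b c where "b = int (n choose m)" and "c = int (Suc n choose m)"
  have c: "int (Suc k) * c = int (Suc n) * b" unfolding b_def c_def by (metis c1 of_nat_mult)
  have u': "int L = int m * b * int u" unfolding b_def by (metis u of_nat_mult)
  have w': "int L = int (Suc n) * b * int w" unfolding b_def by (metis w of_nat_mult)
  \<comment> \<open>The rule that an entry of the triangle is the difference of two neighbours here
    reads: \<open>u - w\<close> is the cofactor of \<open>m * c\<close> in \<open>L\<close>. Because
    of this subtraction the computation takes place in the integers.\<close>
  have "int (Suc k) * (int m * c * (int u - int w)) = int m * (int (Suc k) * c) * (int u - int w)"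
    by (simp only: ac_simps)
  also have "\<dots> = int (Suc n) * (int m * b * int u) - int m * (int (Suc n) * b * int w)"
    unfolding c by (simp add: algebra_simps)
  also have "\<dots> = int (Suc k) * int L"
    unfolding u'[symmetric] w'[symmetric] by (simp add: n_def algebra_simps)
  finally have "int L = int m * c * (int u - int w)" by simp
  hence "int m * c dvd int L" by (rule dvdI)
  hence "m * (Suc n choose m) dvd L" unfolding c_def of_nat_mult[symmetric] int_dvd_int_iff .
  thus ?case by (simp add: n_def)
qed

text \<open>\<open>L\<close> below is the least common multiple of the numbers up to
  \<open>2 * n\<close>. Each prime power in it is at most \<open>2 * n\<close>, which bounds it by
  the right side; and it is divisible by \<open>n * (2 * n choose n)\<close>, which is at least
  \<open>4 ^ n / 2\<close>.\<close>

lemma prime_counting_lower_bound: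
  fixes n :: nat
  assumes "n \<ge> 1"
  shows "2 ^ n \<le> (2 * n) ^ card {p::nat. prime p \<and> p \<le> 2 * n}"
proof -
  define N where "N = 2 * n"
  define P where "P = {p::nat. prime p \<and> p \<le> N}"
  define e where "e p = (GREATEST k. p ^ k \<le> N)" for p :: nat
  define L where "L = (\<Prod>p\<in>P. p ^ e p)"
  have finP: "finite P" by (rule finite_subset[of _ "{..N}"]) (auto simp: P_def)
  have bnd: "k \<le> N" if "p ^ k \<le> N" "p \<ge> 2" for p k :: nat
  proof -
    have "k < 2 ^ k" by simp
    also have "(2::nat) ^ k \<le> p ^ k" using that by (intro power_mono) auto
    finally show ?thesis using that by simp
  qed
  have e1: "p ^ e p \<le> N" if "p \<in> P" for p
    unfolding e_def
    by (rule GreatestI_nat[of _ 0 N]) (use bnd prime_ge_2_nat that assms in \<open>auto simp: P_def N_def\<close>)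
  have e2: "k \<le> e p" if "p \<in> P" "p ^ k \<le> N" for p k
    unfolding e_def
    by (rule Greatest_le_nat[of _ k N]) (use bnd prime_ge_2_nat that in \<open>auto simp: P_def\<close>)
  have "j dvd L" if j: "1 \<le> j" "j \<le> N" for j
  proof -
    have "j = (\<Prod>p\<in>prime_factors j. p ^ multiplicity p j)"
      using j by (simp add: prod_prime_factors)
    also have "\<dots> dvd L" unfolding L_def
    proof (rule prod_dvd_prod_subset2[OF finP])
      show "prime_factors j \<subseteq> P"
        using j by (auto simp: P_def in_prime_factors_iff dest!: dvd_imp_le)
      fix p assume p: "p \<in> prime_factors j"
      have "p ^ multiplicity p j dvd j" by (rule multiplicity_dvd)
      hence "p ^ multiplicity p j \<le> N" using j by (auto dest!: dvd_imp_le)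
      thus "p ^ multiplicity p j dvd p ^ e p"
        using e2 p \<open>prime_factors j \<subseteq> P\<close> by (intro le_imp_power_dvd) auto
    qed
    finally show ?thesis .
  qed
  hence dvd: "n * (2 * n choose n) dvd L"
    using Leibniz_triangle_dvd[of n n L] assms by (simp add: N_def mult_2)
  have "L \<noteq> 0" using finP by (auto simp: L_def P_def)
  with dvd have "n * (2 * n choose n) \<le> L" by (intro dvd_imp_le) auto
  also have "L \<le> (\<Prod>p\<in>P. N)" unfolding L_def by (intro prod_mono) (use e1 in auto)
  also have "\<dots> = N ^ card P" by simp
  finally have le: "n * (2 * n choose n) \<le> N ^ card P" .
  have "4 ^ n / (2 * real n) \<le> real (2 * n choose n)"
    using central_binomial_lower_bound[of n] assms by simp
  hence "4 ^ n \<le> 2 * (real n * real (2 * n choose n))" using assms by (simp add: field_simps)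
  moreover have "(2::real) * 2 ^ n \<le> 2 ^ n * 2 ^ n"
    using assms self_le_power[of "2::real" n] by (intro mult_right_mono) auto
  moreover have "(4::real) ^ n = 2 ^ n * 2 ^ n" by (simp flip: power_mult_distrib)
  ultimately have "(2::real) ^ n \<le> real n * real (2 * n choose n)" by linarith
  hence "real (2 ^ n) \<le> real (n * (2 * n choose n))" by simp
  hence "2 ^ n \<le> n * (2 * n choose n)" by (simp only: of_nat_le_iff)
  with le show ?thesis by (simp add: N_def P_def)
qed

text \<open>With \<open>X = s * B * L^2\<close> the logarithm of \<open>2 * n\<close> is at most
  \<open>W * L\<close>, so at least \<open>K' * B * L\<close> primes lie below, provided that
  \<open>s\<close> is large against its own logarithm. This leaves enough of them after the primes
  up to \<open>4 * B\<close> are discarded.\<close>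

lemma primes_in_range:
  fixes K :: real
  assumes K: "K > 0"
  obtains C where "C > 0" "\<And>B L. B \<ge> 1 \<Longrightarrow> L \<ge> ln 2 \<Longrightarrow> ln B \<le> L \<Longrightarrow>
    \<exists>P :: nat set. finite P \<and> card P = nat \<lceil>K * L\<rceil> \<and> (\<forall>p\<in>P. prime p \<and> 4 * B < real p \<and> real p \<le> C * B * L\<^sup>2)"
proof -
  \<comment> \<open>As \<open>L \<ge> ln 2\<close>, the summand \<open>5 / ln 2\<close> yields at
    least \<open>5 * B\<close>: four parts replace the primes up to \<open>4 * B\<close>, the fifth
    absorbs the rounding up of \<open>K * L\<close>.\<close>
  define K' where "K' = 5 / ln 2 + K"
  have "eventually (\<lambda>s::real. K' * (ln (4 * s) / ln 2 + 3) \<le> s * ln 2) at_top" by real_asymp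
  moreover have "eventually (\<lambda>s::real. s \<ge> 1 / (ln 2)\<^sup>2) at_top" by (rule eventually_ge_at_top)
  moreover have "eventually (\<lambda>s::real. ln (4 * s) \<ge> 0) at_top" by real_asymp
  ultimately have "eventually (\<lambda>s::real. K' * (ln (4 * s) / ln 2 + 3) \<le> s * ln 2 \<and> s \<ge> 1 / (ln 2)\<^sup>2 \<and> ln (4 * s) \<ge> 0) at_top"
    by eventually_elim auto
  then obtain s :: real where s: "K' * (ln (4 * s) / ln 2 + 3) \<le> s * ln 2" "s \<ge> 1 / (ln 2)\<^sup>2" "ln (4 * s) \<ge> 0"
    by (metis (mono_tags, lifting) eventually_happens' trivial_limit_at_top_linorder)
  show ?thesis
  proof (rule that[of "4 * s"])
    fix B L :: real assume B: "B \<ge> 1" and L: "L \<ge> ln 2" "ln B \<le> L"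
    define X where "X = s * B * L\<^sup>2"
    define W where "W = ln (4 * s) / ln 2 + 3"
    define n where "n = nat \<lceil>X\<rceil>"
    have ln2: "ln (2::real) > 0" by simp
    have L0: "L > 0" using L ln2 by linarith
    have s0: "s > 0" using s(2) ln2 by (meson less_le_trans zero_less_divide_1_iff zero_less_power)
    have "1 \<le> s * (ln 2)\<^sup>2" using s(2) ln2 by (simp add: field_simps)
    also have "\<dots> \<le> s * L\<^sup>2" using s0 L ln2 by (intro mult_left_mono power_mono) auto
    also have "\<dots> \<le> X" using B s0 mult_right_mono[of 1 B "s * L\<^sup>2"] by (simp add: X_def mult_ac)
    finally have X: "X \<ge> 1" .
    have n: "X \<le> real n" "real n \<le> 2 * X" "n \<ge> 1" using X unfolding n_def by linarith+
    define P0 where "P0 = {p::nat. prime p \<and> p \<le> 2 * n}"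
    have fin: "finite P0" by (rule finite_subset[of _ "{..2 * n}"]) (auto simp: P0_def)
    have "(2::real) ^ n \<le> real (2 * n) ^ card P0"
    proof -
      have "real (2 ^ n) \<le> real ((2 * n) ^ card P0)"
        using prime_counting_lower_bound[OF n(3)] by (simp only: P0_def of_nat_le_iff)
      thus ?thesis by simp
    qed
    hence "ln ((2::real) ^ n) \<le> ln (real (2 * n) ^ card P0)" using n(3) by (subst ln_le_cancel_iff) auto
    hence le: "real n * ln 2 \<le> real (card P0) * ln (real (2 * n))"
      using n(3) by (subst (asm) (1 2) ln_realpow) simp_all
    have "ln (real (2 * n)) \<le> ln (4 * X)" using n X by (subst ln_le_cancel_iff) auto
    also have "ln (4 * X) = ln (4 * s) + ln B + 2 * ln L"
      using s0 B L0 by (simp add: X_def ln_mult ln_realpow)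
    also have "\<dots> \<le> ln (4 * s) / ln 2 * L + L + 2 * L"
    proof -
      have "ln (4 * s) * ln 2 \<le> ln (4 * s) * L" using s(3) L by (intro mult_left_mono) auto
      hence "ln (4 * s) \<le> ln (4 * s) / ln 2 * L" using ln2 by (simp add: field_simps)
      moreover have "ln L \<le> L" using ln_le_minus_one[OF L0] by simp
      ultimately show ?thesis using L by simp
    qed
    also have "\<dots> = W * L" by (simp add: W_def algebra_simps)
    finally have lnN: "ln (real (2 * n)) \<le> W * L" .
    have W0: "W > 0" using s(3) by (simp add: W_def add_nonneg_pos)
    have "K' * W * (B * L\<^sup>2) \<le> s * ln 2 * (B * L\<^sup>2)"
      using s(1) B by (intro mult_right_mono) (auto simp: W_def)
    also have "\<dots> = X * ln 2" by (simp add: X_def)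
    also have "\<dots> \<le> real n * ln 2" using n by simp
    also have "\<dots> \<le> real (card P0) * (W * L)" 
      by (rule order_trans[OF le mult_left_mono[OF lnN]]) simp
    finally have "(K' * B * L) * (W * L) \<le> real (card P0) * (W * L)" by (simp add: power2_eq_square mult_ac)
    hence card: "K' * B * L \<le> real (card P0)" using W0 L0 by simp
    define P1 where "P1 = P0 \<inter> {p. real p \<le> 4 * B}"
    have "card P1 \<le> card {1..nat \<lfloor>4 * B\<rfloor>}"
      by (rule card_mono) (auto simp: P1_def P0_def prime_gt_0_nat Suc_le_eq le_nat_floor)
    hence "real (card P1) \<le> 4 * B" using B by simp linarith
    moreover have "card (P0 - P1) = card P0 - card P1" "card P1 \<le> card P0"
      using fin by (auto simp: P1_def intro!: card_Diff_subset card_mono)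
    ultimately have "real (card (P0 - P1)) \<ge> K' * B * L - 4 * B" using card by simp
    moreover have "K' * B * L = 5 * B * (L / ln 2) + K * L * B" by (simp add: K'_def distrib_left distrib_right mult_ac)
    moreover have "5 * B * 1 \<le> 5 * B * (L / ln 2)" using B L ln2 by (intro mult_left_mono) auto
    moreover have "K * L * 1 \<le> K * L * B" using B K L0 by (intro mult_left_mono) auto
    ultimately have "real (card (P0 - P1)) \<ge> K * L + 1" using B by linarith
    hence "nat \<lceil>K * L\<rceil> \<le> card (P0 - P1)" by linarith
    then obtain P where P: "P \<subseteq> P0 - P1" "card P = nat \<lceil>K * L\<rceil>" "finite P"
      by (rule obtain_subset_with_card_n)
    have "prime p \<and> 4 * B < real p \<and> real p \<le> 4 * s * B * L\<^sup>2" if "p \<in> P" for p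
    proof -
      have p: "p \<in> P0" "p \<notin> P1" using that P by auto
      hence "real p \<le> 2 * real n" by (simp add: P0_def)
      also have "\<dots> \<le> 4 * X" using n by simp
      finally show ?thesis using p by (auto simp: P0_def P1_def X_def mult_ac)
    qed
    with P show "\<exists>P :: nat set. finite P \<and> card P = nat \<lceil>K * L\<rceil> \<and>
        (\<forall>p\<in>P. prime p \<and> 4 * B < real p \<and> real p \<le> 4 * s * B * L\<^sup>2)" by blast
  next
    show "4 * s > 0" using s(2) by (metis less_le_trans zero_less_divide_1_iff zero_less_power ln_gt_zero one_less_numeral_iff semiring_norm(76) zero_less_mult_iff zero_less_numeral)
  qed
qed

section \<open>Monic divisors modulo a prime\<close>

definition red :: "int \<Rightarrow> int poly \<Rightarrow> int poly" where
  "red p A = map_poly (\<lambda>c. c mod p) A"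

lemma coeff_red [simp]: "coeff (red p A) i = coeff A i mod p"
  by (simp add: red_def coeff_map_poly)

lemma pcong_red: "pcong p A (red p A)"
  by (simp add: pcong_iff)

lemma degree_red_le: "degree (red p A) \<le> degree A"
  by (simp add: red_def degree_map_poly_le)

lemma red_cong: "pcong p A B \<Longrightarrow> red p A = red p B"
  by (rule poly_eqI) (simp add: pcong_iff mod_eq_dvd_iff)

lemma red_idem: "(\<And>i. coeff A i \<in> {0..<p}) \<Longrightarrow> red p A = A"
  by (rule poly_eqI) (use atLeastLessThan_iff in force)

lemma monic_red:
  assumes "monic A" "p > 1" shows "monic (red p A)" "degree (red p A) = degree A"
proof -
  show d: "degree (red p A) = degree A"
    by (rule antisym[OF degree_red_le le_degree]) (use assms in simp)
  show "monic (red p A)" unfolding d using assms by simp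
qed

text \<open>The coefficients in \<open>{0..<p}\<close> single out one representative of every monic
  divisor modulo \<open>p\<close>, so that divisors can be counted and serve as keys.\<close>

definition monic_dvs :: "int \<Rightarrow> int poly \<Rightarrow> int poly set" where
  "monic_dvs p M = {q. monic q \<and> (\<forall>i. coeff q i \<in> {0..<p}) \<and> (\<exists>v. pcong p M (q * v))}"

lemma red_in_monic_dvs:
  assumes "p > 1" "monic q" "pcong p M (q * v)" shows "red p q \<in> monic_dvs p M"
proof -
  have "pcong p M (red p q * v)"
    using pcong_trans[OF assms(3) pcong_mult[OF pcong_red pcong_refl]] .
  thus ?thesis using monic_red[OF assms(2,1)] assms(1) by (auto simp: monic_dvs_def)
qed

text \<open>\<open>g\<close> is a monic element of least degree in the ideal generated by
  \<open>P\<close> and \<open>q\<close> modulo \<open>p\<close>. A remainder of smaller degree in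
  this ideal vanishes modulo \<open>p\<close>, since scaling by the inverse of its leading residue
  would give a smaller monic element.\<close>

lemma gcd_mod_prime:
  fixes P q :: "int poly"
  assumes p: "prime p" and P: "monic P"
  obtains g u w s1 s2 where "monic g" "degree g \<le> degree P" "pcong p g (u * P + w * q)"
    "pcong p P (g * s1)" "pcong p q (g * s2)"
proof -
  have p1: "p > 1" using p prime_gt_1_int by auto
  define I where "I A \<longleftrightarrow> (\<exists>u w. pcong p A (u * P + w * q))" for A
  have I_comb: "I (A - g * B)" if I: "I A" "I g" for A B g
  proof -
    obtain u w u' w' where "pcong p A (u * P + w * q)" "pcong p g (u' * P + w' * q)"
      using I unfolding I_def by blast
    hence "pcong p (A - g * B) ((u * P + w * q) - (u' * P + w' * q) * B)"
      by (intro pcong_diff pcong_mult pcong_refl)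
    hence "pcong p (A - g * B) ((u - u' * B) * P + (w - w' * B) * q)" by (simp add: algebra_simps)
    thus ?thesis unfolding I_def by blast
  qed
  have IP: "I P" unfolding I_def by (rule exI[of _ 1], rule exI[of _ 0]) simp
  have Iq: "I q" unfolding I_def by (rule exI[of _ 0], rule exI[of _ 1]) simp
  have "\<exists>g. (monic g \<and> I g) \<and> (\<forall>h. monic h \<and> I h \<longrightarrow> degree g \<le> degree h)"
    by (rule ex_has_least_nat[of _ P]) (use P IP in auto)
  then obtain g where g: "monic g" "I g" "\<And>h. monic h \<Longrightarrow> I h \<Longrightarrow> degree g \<le> degree h" by blast
  have zero: "red p r = 0" if r: "I r" "r = 0 \<or> degree r < degree g" for r
  proof (rule ccontr)
    assume nz: "red p r \<noteq> 0"
    define c where "c = lead_coeff (red p r)"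
    have "c mod p = c" by (simp add: c_def)
    moreover have "c \<noteq> 0" using nz unfolding c_def leading_coeff_0_iff .
    ultimately have "\<not> p dvd c" by auto
    hence "algebraic_semidom_class.coprime c p" using p by (metis prime_imp_coprime algebraic_semidom_class.coprime_commute)
    then obtain c' where c': "[c * c' = 1] (mod p)" using cong_solve_coprime_int by blast
    define h where "h = red p (smult c' (red p r))"
    have one: "coeff h (degree (red p r)) = 1"
      using c' p1 by (simp add: h_def c_def unique_euclidean_semiring_class.cong_def mult.commute)
    have "degree h \<le> degree (red p r)"
      unfolding h_def using degree_red_le[of p "smult c' (red p r)"] degree_smult_le[of c' "red p r"] by linarith
    moreover have "degree (red p r) \<le> degree h" using one by (intro le_degree) simp
    ultimately have dh: "degree h = degree (red p r)" by (rule antisym)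
    hence mh: "monic h" using one by simp
    obtain u w where "pcong p r (u * P + w * q)" using r(1) unfolding I_def by blast
    hence "pcong p (red p r) (u * P + w * q)" by (rule pcong_trans[OF pcong_sym[OF pcong_red]])
    hence "pcong p (smult c' (red p r)) (smult c' (u * P + w * q))" by (rule pcong_smult)
    hence "pcong p h (smult c' (u * P + w * q))"
      unfolding h_def by (rule pcong_trans[OF pcong_sym[OF pcong_red]])
    hence "pcong p h (smult c' u * P + smult c' w * q)" by (simp add: smult_add_right)
    hence "I h" unfolding I_def by blast
    from g(3)[OF mh this] dh degree_red_le[of p r] r(2) nz show False by (auto simp: red_def)
  qed
  have dvd: "\<exists>s. pcong p A (g * s)" if "I A" for A
  proof -
    obtain S R where SR: "A = g * S + R" "R = 0 \<or> degree R < degree g"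
      using monic_division_exists[OF g(1)] by metis
    have "I R" using I_comb[OF that g(2), of S] SR(1) by simp
    hence "red p R = 0" using zero SR(2) by blast
    hence "pcong p R 0" using pcong_red[of p R] by simp
    hence "pcong p (g * S + R) (g * S + 0)" by (intro pcong_add pcong_refl)
    thus ?thesis using SR(1) by auto
  qed
  show ?thesis using that g(1) g(3)[OF P IP] g(2) dvd[OF IP] dvd[OF Iq] unfolding I_def by metis
qed

text \<open>Let \<open>P\<close> be a monic divisor other than 1 of least degree and
  \<open>M = P * M1\<close> modulo \<open>p\<close>. A divisor \<open>q\<close> is either coprime to
  \<open>P\<close>, and then it divides \<open>M1\<close>, or it shares with \<open>P\<close> a
  factor that by minimality is \<open>P\<close>, and then it is \<open>P\<close> times a divisor of
  \<open>M1\<close>. So splitting off \<open>P\<close> costs a factor of at most 2.\<close>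

lemma monic_dvs_card:
  assumes p: "prime p" and M: "\<not> p dvd lead_coeff M"
  shows "finite (monic_dvs p M) \<and> card (monic_dvs p M) \<le> 2 ^ degree M"
  using M
proof (induction "degree M" arbitrary: M rule: less_induct)
  case less
  have p1: "p > 1" using p prime_gt_1_int by auto
  show ?case
  proof (cases "monic_dvs p M \<subseteq> {1}")
    case True
    hence "finite (monic_dvs p M)" "card (monic_dvs p M) \<le> card {1 :: int poly}"
      using finite_subset card_mono by (blast, metis finite.emptyI finite.insertI)
    moreover have "card {1 :: int poly} \<le> 2 ^ degree M" by simp
    ultimately show ?thesis using order_trans by blast
  next
    case False
    have "\<exists>P. (P \<in> monic_dvs p M \<and> P \<noteq> 1) \<and> (\<forall>q. q \<in> monic_dvs p M \<and> q \<noteq> 1 \<longrightarrow> degree P \<le> degree q)"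
    proof -
      obtain P where "P \<in> monic_dvs p M \<and> P \<noteq> 1" using False by auto
      from ex_has_least_nat[of "\<lambda>P. P \<in> monic_dvs p M \<and> P \<noteq> 1", OF this] show ?thesis .
    qed
    then obtain P where P: "P \<in> monic_dvs p M" "P \<noteq> 1"
      and Pmin: "\<And>q. q \<in> monic_dvs p M \<Longrightarrow> q \<noteq> 1 \<Longrightarrow> degree P \<le> degree q" by blast
    have mP: "monic P" using P(1) by (simp add: monic_dvs_def)
    have dP: "degree P > 0" using mP P(2) by (meson gr0I monic_degree_0)
    obtain M0 where M0: "pcong p M (P * M0)" using P(1) by (auto simp: monic_dvs_def)
    define M1 where "M1 = red p M0"
    have M1: "pcong p M (P * M1)"
      unfolding M1_def by (rule pcong_trans[OF M0 pcong_mult[OF pcong_refl pcong_red]])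
    have M1nz: "M1 \<noteq> 0"
    proof
      assume "M1 = 0"
      hence "p dvd lead_coeff M" using M1 by (auto simp: pcong_iff)
      thus False using less.prems by simp
    qed
    have lM1: "\<not> p dvd lead_coeff M1"
    proof
      assume d: "p dvd lead_coeff M1"
      have "lead_coeff M1 = lead_coeff M1 mod p" by (simp add: M1_def)
      with d have "lead_coeff M1 = 0" by (simp only: dvd_eq_mod_eq_0)
      thus False using M1nz unfolding leading_coeff_0_iff by simp
    qed
    have degPM: "degree (P * M1) = degree P + degree M1" using mP M1nz by (subst degree_mult_eq) auto
    have "p dvd coeff M (degree P + degree M1) - lead_coeff M1"
      using M1[unfolded pcong_iff, rule_format, of "degree P + degree M1"] mP
      by (simp add: coeff_mult_degree_sum)
    hence "coeff M (degree P + degree M1) \<noteq> 0" using lM1 by auto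
    hence degM: "degree P + degree M1 \<le> degree M" by (rule le_degree)
    have IH: "finite (monic_dvs p M1)" "card (monic_dvs p M1) \<le> 2 ^ degree M1"
      using less.hyps[of M1] lM1 degM dP by auto
    have "q \<in> monic_dvs p M1 \<union> (\<lambda>q. red p (P * q)) ` monic_dvs p M1" if q: "q \<in> monic_dvs p M" for q
    proof -
      have mq: "monic q" and cq: "\<And>i. coeff q i \<in> {0..<p}" using q by (auto simp: monic_dvs_def)
      obtain v where v: "pcong p M (q * v)" using q by (auto simp: monic_dvs_def)
      obtain g u w s1 s2 where g: "monic g" "degree g \<le> degree P" "pcong p g (u * P + w * q)"
        "pcong p P (g * s1)" "pcong p q (g * s2)" by (rule gcd_mod_prime[OF p mP])
      show ?thesis
      proof (cases "degree g = 0")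
        case True
        hence "g = 1" using g(1) monic_degree_0 by blast
        hence "pcong p (1 * M1) ((u * P + w * q) * M1)" using g(3) by (intro pcong_mult) auto
        hence "pcong p M1 (u * (P * M1) + w * q * M1)" by (simp add: algebra_simps)
        also have "pcong p (u * (P * M1) + w * q * M1) (u * (q * v) + w * q * M1)"
          by (rule pcong_add[OF pcong_mult[OF pcong_refl pcong_trans[OF pcong_sym[OF M1] v]] pcong_refl])
        also have "u * (q * v) + w * q * M1 = q * (u * v + w * M1)" by (simp add: algebra_simps)
        finally have "q \<in> monic_dvs p M1" using mq cq by (auto simp: monic_dvs_def)
        thus ?thesis by blast
      next
        case False
        have "pcong p (q * v) (g * s2 * v)" using g(5) by (intro pcong_mult) auto
        hence "pcong p M (g * s2 * v)" by (rule pcong_trans[OF v])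
        hence "pcong p M (g * (s2 * v))" by (simp only: mult.assoc)
        hence "red p g \<in> monic_dvs p M" by (rule red_in_monic_dvs[OF p1 g(1)])
        moreover have "red p g \<noteq> 1" using False monic_red(2)[OF g(1) p1] by auto
        ultimately have "degree P \<le> degree g" using Pmin monic_red(2)[OF g(1) p1] by metis
        hence dg: "degree g = degree P" using g(2) by simp
        have "[:p:] dvd g * (- (s1 - 1)) + (P - g)"
          using g(4) by (simp add: pcong_def algebra_simps)
        moreover have "P - g = 0 \<or> degree (P - g) < degree g"
          using degree_diff_monic[OF mP g(1)] dg by simp
        ultimately have "[:p:] dvd P - g" by (rule monic_division_dvd(2)[OF g(1)])
        hence "pcong p P g" by (simp add: pcong_def)
        hence gP: "pcong p g P" by (rule pcong_sym)
        have qP: "pcong p q (P * red p s2)"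
          using pcong_trans[OF g(5) pcong_mult[OF gP pcong_red]] .
        define q1 where "q1 = red p s2"
        have rq: "q = red p (P * q1)" using red_cong[OF qP] red_idem[of q p] cq by (simp add: q1_def)
        have q1nz: "q1 \<noteq> 0" using rq mq by (auto simp: red_def)
        have lq1: "lead_coeff q1 mod p = lead_coeff q1" by (simp add: q1_def)
        have lq1': "lead_coeff q1 \<noteq> 0" using q1nz unfolding leading_coeff_0_iff .
        have dq: "degree (P * q1) = degree P + degree q1" using mP q1nz by (subst degree_mult_eq) auto
        have cq1: "coeff q (degree (P * q1)) = lead_coeff q1"
          by (subst rq) (simp add: lead_coeff_mult mP lq1 del: coeff_mult_degree_sum)
        have "degree q = degree (P * q1)"
        proof (rule antisym)
          show "degree q \<le> degree (P * q1)" by (subst rq) (rule degree_red_le)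
          show "degree (P * q1) \<le> degree q" using cq1 lq1' by (intro le_degree) simp
        qed
        hence mq1: "monic q1" using cq1 mq by simp
        have "pcong p (P * M1) (q * v)" using pcong_trans[OF pcong_sym[OF M1] v] .
        also have "pcong p (q * v) (P * q1 * v)" using qP by (intro pcong_mult) (auto simp: q1_def)
        finally have "pcong p (P * M1) (P * (q1 * v))" by (simp add: mult.assoc)
        hence "pcong p M1 (q1 * v)" by (rule monic_pcong_cancel[OF mP])
        hence "q1 \<in> monic_dvs p M1" using mq1 p1 by (auto simp: monic_dvs_def q1_def)
        thus ?thesis using rq by blast
      qed
    qed
    hence sub: "monic_dvs p M \<subseteq> monic_dvs p M1 \<union> (\<lambda>q. red p (P * q)) ` monic_dvs p M1" by blast
    have fin: "finite (monic_dvs p M1 \<union> (\<lambda>q. red p (P * q)) ` monic_dvs p M1)" using IH by simp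
    have "card (monic_dvs p M) \<le> card (monic_dvs p M1 \<union> (\<lambda>q. red p (P * q)) ` monic_dvs p M1)"
      by (rule card_mono[OF fin sub])
    also have "\<dots> \<le> card (monic_dvs p M1) + card ((\<lambda>q. red p (P * q)) ` monic_dvs p M1)" by (rule card_Un_le)
    also have "\<dots> \<le> 2 ^ degree M1 + 2 ^ degree M1" using IH card_image_le[OF IH(1)] by (meson add_mono order_trans)
    also have "\<dots> = 2 ^ Suc (degree M1)" by simp
    also have "\<dots> \<le> 2 ^ degree M" using dP degM by (intro power_increasing) auto
    finally show ?thesis using finite_subset[OF sub fin] by simp
  qed
qed

section \<open>Resultants and coefficient bounds\<close>

text \<open>The rows of the Sylvester matrix are the coefficients of \<open>p\<close> and
  \<open>q\<close> times powers of the variable. The last row of the adjugate matrix combines them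
  into a vector with the determinant in the column of the constant term and zeros elsewhere.\<close>

lemma resultant_bezout:
  fixes p q :: "int poly"
  assumes "degree p + degree q > 0"
  shows "\<exists>u w. u * p + w * q = [:resultant p q:]"
proof -
  define m n d where "m = degree p" and "n = degree q" and "d = m + n"
  define S where "S = sylvester_mat p q"
  have S: "S \<in> carrier_mat d d" unfolding S_def d_def m_def n_def by (rule sylvester_carrier_mat)
  have d: "d > 0" using assms by (simp add: d_def m_def n_def)
  define a where "a i = adj_mat S $$ (d - 1, i)" for i
  have "adj_mat S * S = det S \<cdot>\<^sub>m 1\<^sub>m d" "adj_mat S \<in> carrier_mat d d" using adj_mat[OF S] by auto
  hence row: "(\<Sum>i<d. a i * S $$ (i, j)) = (if j = d - 1 then resultant p q else 0)" if "j < d" for j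
  proof -
    have "(adj_mat S * S) $$ (d - 1, j) = (\<Sum>i<d. a i * S $$ (i, j))"
      using S d that \<open>adj_mat S \<in> carrier_mat d d\<close>
      by (simp add: scalar_prod_def a_def atLeast0LessThan)
    moreover have "(adj_mat S * S) $$ (d - 1, j) = (if j = d - 1 then resultant p q else 0)"
      using \<open>adj_mat S * S = _\<close> d that by (simp add: resultant_def S_def)
    ultimately show ?thesis by simp
  qed
  define r where "r i = (if i < n then monom 1 (n - Suc i) * p else monom 1 (d - Suc i) * q)" for i
  have Sr: "S $$ (i, j) = coeff (r i) (d - Suc j)" if "i < d" "j < d" for i j
  proof -
    have 1: "coeff (monom 1 (Suc b) * h) (Suc k) = coeff (monom 1 b * h) k" for b k and h :: "int poly"
      by (simp add: coeff_monom_mult)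
    have "S $$ (i, j) = (if i < n then coeff (monom 1 (n - i) * p) (d - j) else coeff (monom 1 (d - i) * q) (d - j))"
      unfolding S_def d_def m_def n_def by (rule sylvester_index_mat2) (use that in \<open>auto simp: d_def m_def n_def\<close>)
    moreover have "d - j = Suc (d - Suc j)" "d - i = Suc (d - Suc i)" "i < n \<Longrightarrow> n - i = Suc (n - Suc i)"
      using that by auto
    ultimately show ?thesis using 1 by (simp add: r_def)
  qed
  have r0: "coeff (r i) k = 0" if "k \<ge> d" "i < d" for i k
    using that by (auto simp: r_def coeff_monom_mult d_def m_def n_def intro!: coeff_eq_0)
  have res: "(\<Sum>i<d. smult (a i) (r i)) = [:resultant p q:]"
  proof (rule poly_eqI)
    fix k
    show "coeff (\<Sum>i<d. smult (a i) (r i)) k = coeff [:resultant p q:] k"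
    proof (cases "k < d")
      case True
      define j where "j = d - Suc k"
      have j: "j < d" "d - Suc j = k" using True by (auto simp: j_def)
      have "coeff (\<Sum>i<d. smult (a i) (r i)) k = (\<Sum>i<d. a i * S $$ (i, j))"
        unfolding coeff_sum coeff_smult by (rule sum.cong) (use Sr j in auto)
      also have "\<dots> = (if j = d - 1 then resultant p q else 0)" by (rule row[OF j(1)])
      also have "\<dots> = coeff [:resultant p q:] k" using True by (auto simp: j_def coeff_pCons split: nat.splits)
      finally show ?thesis .
    next
      case False
      hence "coeff (\<Sum>i<d. smult (a i) (r i)) k = 0" by (simp add: coeff_sum r0)
      thus ?thesis using False d by (auto simp: coeff_pCons split: nat.splits)
    qed
  qed
  have "(\<Sum>i<d. smult (a i) (r i)) =
     (\<Sum>i<d. if i < n then smult (a i) (monom 1 (n - Suc i)) else 0) * p +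
     (\<Sum>i<d. if i < n then 0 else smult (a i) (monom 1 (d - Suc i))) * q"
    unfolding sum_distrib_right sum.distrib[symmetric] by (rule sum.cong) (auto simp: r_def)
  from trans[OF sym[OF this] res] show ?thesis by blast
qed

lemma resultant_bound:
  fixes p q :: "int poly" and X :: real
  assumes X: "X \<ge> 1" "\<And>i. \<bar>coeff p i\<bar> \<le> X" "\<And>i. \<bar>coeff q i\<bar> \<le> X"
    and N: "degree p + degree q \<le> N"
  shows "\<bar>resultant p q\<bar> \<le> fact N * X ^ N"
proof -
  define d where "d = degree p + degree q"
  define S where "S = sylvester_mat p q"
  have S: "S \<in> carrier_mat d d" unfolding S_def d_def by (rule sylvester_carrier_mat)
  have entry: "\<bar>real_of_int (S $$ (i, j))\<bar> \<le> X" if "i < d" "j < d" for i j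
    unfolding S_def using that X by (subst sylvester_index_mat) (auto simp: d_def)
  have "\<bar>resultant p q\<bar> = \<bar>\<Sum>\<pi> \<in> {\<pi>. \<pi> permutes {0..<d}}. signof \<pi> * (\<Prod>i = 0..<d. S $$ (i, \<pi> i))\<bar>"
    by (simp add: resultant_def S_def[symmetric] det_def'[OF S])
  also have "real_of_int \<dots> \<le> (\<Sum>\<pi> \<in> {\<pi>. \<pi> permutes {0..<d}}. \<bar>real_of_int (signof \<pi> * (\<Prod>i = 0..<d. S $$ (i, \<pi> i)))\<bar>)"
    unfolding of_int_abs of_int_sum by (rule sum_abs)
  also have "\<dots> \<le> (\<Sum>\<pi> \<in> {\<pi>. \<pi> permutes {0..<d}}. X ^ d)"
  proof (rule sum_mono)
    fix \<pi> assume "\<pi> \<in> {\<pi>. \<pi> permutes {0..<d}}"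
    hence \<pi>: "\<pi> i < d" if "i < d" for i using that permutes_in_image[of \<pi> "{0..<d}" i] by auto
    have "\<bar>real_of_int (signof \<pi> * (\<Prod>i = 0..<d. S $$ (i, \<pi> i)))\<bar> = (\<Prod>i = 0..<d. \<bar>real_of_int (S $$ (i, \<pi> i))\<bar>)"
      by (simp add: abs_mult abs_prod sign_def)
    also have "\<dots> \<le> (\<Prod>i = 0..<d. X)" by (rule prod_mono) (use entry \<pi> in auto)
    finally show "\<bar>real_of_int (signof \<pi> * (\<Prod>i = 0..<d. S $$ (i, \<pi> i)))\<bar> \<le> X ^ d" by simp
  qed
  also have "\<dots> = fact d * X ^ d"
    using card_permutations[of "{0..<d}" d] by simp
  also have "\<dots> \<le> fact N * X ^ N"
    using N X(1) by (intro mult_mono power_increasing fact_mono) (auto simp: d_def)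
  finally show ?thesis by simp
qed

text \<open>The Mahler measure of an integer polynomial does not grow when passing to a factor,
  since the cofactor has measure at least 1. Landau's inequality bounds it by the coefficients of
  \<open>f\<close>, and Mignotte's bound leads back to those of \<open>g\<close>.\<close>

lemma factor_coeff_bound:
  fixes f g :: "int poly" and X :: real
  assumes f: "f \<noteq> 0" "g dvd f" "degree f \<le> N" "\<And>i. \<bar>coeff f i\<bar> \<le> X"
  shows "\<bar>coeff g i\<bar> \<le> 2 ^ N * (real N + 1) * X"
proof -
  have X: "X \<ge> 0" using f(4)[of 0] by linarith
  have dg: "degree g \<le> N" using dvd_imp_degree_le[OF f(2,1)] f(3) by simp
  have "mahler_measure g \<le> mahler_measure f" by (rule mahler_measure_dvd[OF f(1,2)])
  also have "\<dots> \<le> sqrt (real_of_int (\<Sum>a\<leftarrow>coeffs f. a * a))" by (rule Landau_inequality_mahler_measure)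
  also have "(\<Sum>a\<leftarrow>coeffs f. a * a) = (\<Sum>i\<le>degree f. coeff f i * coeff f i)"
    using f(1) by (simp add: coeffs_def o_def interv_sum_list_conv_sum_set_nat atLeast0LessThan lessThan_Suc_atMost del: upt_Suc)
  also have "sqrt (real_of_int (\<Sum>i\<le>degree f. coeff f i * coeff f i)) \<le> sqrt (((real N + 1) * X)\<^sup>2)"
  proof (rule real_sqrt_le_mono)
    have "real_of_int (\<Sum>i\<le>degree f. coeff f i * coeff f i) = (\<Sum>i\<le>degree f. \<bar>real_of_int (coeff f i)\<bar> * \<bar>real_of_int (coeff f i)\<bar>)"
      by simp
    also have "\<dots> \<le> (\<Sum>i\<le>degree f. X * X)"
      using f(4) X by (intro sum_mono mult_mono) auto
    also have "\<dots> = (real (degree f) + 1) * X\<^sup>2" by (simp add: power2_eq_square)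
    also have "\<dots> \<le> (real N + 1)\<^sup>2 * X\<^sup>2"
    proof (rule mult_right_mono)
      have "(real (degree f) + 1) * 1 \<le> (real N + 1) * (real N + 1)" using f(3) by (intro mult_mono) auto
      thus "real (degree f) + 1 \<le> (real N + 1)\<^sup>2" by (simp add: power2_eq_square)
    qed simp
    finally show "real_of_int (\<Sum>i\<le>degree f. coeff f i * coeff f i) \<le> ((real N + 1) * X)\<^sup>2"
      by (simp add: power_mult_distrib)
  qed
  also have "\<dots> = (real N + 1) * X" using X by simp
  finally have mm: "mahler_measure g \<le> (real N + 1) * X" .
  have "\<bar>coeff g i\<bar> \<le> real (degree g choose i) * mahler_measure g" using Mignotte_bound[of g i] by simp
  also have "\<dots> \<le> 2 ^ N * ((real N + 1) * X)"
  proof (rule mult_mono[OF _ mm])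
    have "degree g choose i \<le> 2 ^ degree g" by (rule binomial_le_pow2)
    also have "\<dots> \<le> 2 ^ N" using dg by simp
    finally have "real (degree g choose i) \<le> real (2 ^ N)" by (simp only: of_nat_le_iff)
    thus "real (degree g choose i) \<le> 2 ^ N" by simp
    show "0 \<le> mahler_measure g" by (rule mahler_measure_ge_0)
  qed simp
  finally show ?thesis by (simp add: mult_ac)
qed

section \<open>A derivative in which a factor is simple\<close>

lemma degree_pderiv_iter: "degree ((pderiv ^^ e) (P :: int poly)) = degree P - e"
  by (induction e) (simp_all add: degree_pderiv)

lemma pderiv_iter_coeff_bound:
  fixes P :: "int poly" and X :: real
  assumes "degree P \<le> N" "\<And>i. \<bar>coeff P i\<bar> \<le> X"
  shows "\<bar>coeff ((pderiv ^^ e) P) i\<bar> \<le> real N ^ e * X"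
proof (induction e arbitrary: i)
  case 0
  thus ?case using assms by simp
next
  case (Suc e)
  have X: "X \<ge> 0" using assms(2)[of 0] by linarith
  show ?case
  proof (cases "Suc i \<le> N")
    case True
    have "\<bar>coeff ((pderiv ^^ Suc e) P) i\<bar> = real (Suc i) * \<bar>coeff ((pderiv ^^ e) P) (Suc i)\<bar>"
      by (simp add: coeff_pderiv abs_mult)
    also have "\<dots> \<le> real N * (real N ^ e * X)"
      using True Suc X by (intro mult_mono) auto
    finally show ?thesis by simp
  next
    case False
    have "degree ((pderiv ^^ e) P) < Suc i" using False assms(1) by (simp add: degree_pderiv_iter)
    thus ?thesis using X by (simp add: coeff_pderiv coeff_eq_0)
  qed
qed

text \<open>\<open>e\<close> is one less than the least order of a derivative not divisible by
  \<open>q\<close>; there is one because the derivative of order \<open>degree P\<close> is a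
  nonzero constant. Were \<open>q\<close> to divide its own cofactor at order \<open>e\<close>, it
  would divide the next derivative too.\<close>

lemma simple_factor_of_derivative:
  fixes P q :: "int poly"
  assumes P: "P \<noteq> 0" and q: "irreducible q" "q dvd P" "degree q > 0"
  obtains e v where "e < degree P" "(pderiv ^^ e) P = q * v" "\<not> q dvd v"
proof -
  have top: "\<not> q dvd (pderiv ^^ degree P) P"
  proof
    assume d: "q dvd (pderiv ^^ degree P) P"
    have nz: "(pderiv ^^ e) P \<noteq> 0" if "e \<le> degree P" for e
      using that
    proof (induction e)
      case (Suc e)
      hence "degree ((pderiv ^^ e) P) > 0" by (simp add: degree_pderiv_iter)
      thus ?case by (auto simp: pderiv_eq_0_iff)
    qed (use P in simp)
    from dvd_imp_degree_le[OF d nz] show False using q(3) by (simp add: degree_pderiv_iter)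
  qed
  define e' where "e' = (LEAST e. \<not> q dvd (pderiv ^^ e) P)"
  have e': "\<not> q dvd (pderiv ^^ e') P" unfolding e'_def using top by (rule LeastI)
  have "e' \<le> degree P" unfolding e'_def using top by (rule Least_le)
  moreover have "e' \<noteq> 0" using e' q(2) by (metis funpow_0)
  ultimately obtain e where e: "e' = Suc e" "e < degree P" by (metis Suc_le_lessD not0_implies_Suc)
  have "q dvd (pderiv ^^ e) P" using not_less_Least[of e "\<lambda>e. \<not> q dvd (pderiv ^^ e) P"] e by (auto simp: e'_def)
  then obtain v where v: "(pderiv ^^ e) P = q * v" by (elim dvdE)
  have "\<not> q dvd v"
  proof
    assume "q dvd v"
    hence "q dvd pderiv (q * v)" by (simp add: pderiv_mult)
    thus False using e' e v by simp
  qed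
  with e v that show ?thesis by blast
qed

text \<open>\<open>\<rho>\<close> is the resultant of \<open>v\<close> and \<open>q\<close>, nonzero
  because the irreducible \<open>q\<close> does not divide \<open>v\<close>. A prime not dividing it
  keeps the two coprime after reduction, as Newton iteration requires. The logarithm of the bound is
  linear in that of \<open>X\<close>.\<close>

lemma bezout_simple_factor:
  fixes P q :: "int poly" and X :: real
  assumes P: "P \<noteq> 0" "degree P \<le> N" "\<And>i. \<bar>coeff P i\<bar> \<le> X" "X \<ge> 1"
    and q: "irreducible q" "q dvd P" "degree q > 0"
  obtains e v c u \<rho> where "e < N" "(pderiv ^^ e) P = q * v" "c * v + u * q = [:\<rho>:]" "\<rho> \<noteq> 0"
    "\<bar>real_of_int \<rho>\<bar> \<le> fact (2 * N) * (2 ^ N * (real N + 1) * (real N ^ N * X)) ^ (2 * N)"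
proof -
  obtain e v where e: "e < degree P" "(pderiv ^^ e) P = q * v" "\<not> q dvd v"
    by (rule simple_factor_of_derivative[OF P(1) q])
  have N1: "N \<ge> 1" using e P(2) by simp
  define D where "D = (pderiv ^^ e) P"
  have D0: "D \<noteq> 0"
  proof -
    have "degree D > 0" using e(1) unfolding D_def degree_pderiv_iter by simp
    thus ?thesis by auto
  qed
  have dD: "degree D \<le> N" using P(2) unfolding D_def degree_pderiv_iter by simp
  have "real N ^ e * X \<le> real N ^ N * X"
    using N1 e P by (intro mult_right_mono power_increasing) auto
  hence cD: "\<bar>coeff D i\<bar> \<le> real N ^ N * X" for i
    unfolding D_def using pderiv_iter_coeff_bound[OF P(2,3), of e i] by linarith
  have qv: "D = q * v" using e by (simp add: D_def)
  define Y where "Y = 2 ^ N * (real N + 1) * (real N ^ N * X)"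
  have cq: "\<bar>coeff q i\<bar> \<le> Y" and cv: "\<bar>coeff v i\<bar> \<le> Y" for i
    unfolding Y_def using factor_coeff_bound[OF D0 _ dD cD] qv by auto
  have Y: "Y \<ge> 1"
  proof -
    have "1 * (1 * (1 * 1)) \<le> 2 ^ N * ((real N + 1) * (real N ^ N * X))"
      using N1 P(4) by (intro mult_mono mult_nonneg_nonneg one_le_power) auto
    thus ?thesis by (simp add: Y_def mult_ac)
  qed
  have "degree (gcd v q) = 0"
  proof (rule ccontr)
    assume d: "degree (gcd v q) \<noteq> 0"
    have "gcd v q dvd q" by simp
    then obtain h where h: "q = gcd v q * h" by (elim dvdE)
    have "\<not> is_unit (gcd v q)" using d by (auto simp: is_unit_poly_iff)
    hence "is_unit h" using h q(1) by (metis irreducibleD)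
    hence "q dvd gcd v q" using h by (metis dvd_refl dvd_mult_unit_iff)
    hence "q dvd v" by simp
    thus False using e by simp
  qed
  hence \<rho>0: "resultant v q \<noteq> 0" by (simp add: resultant_0_gcd)
  have "v \<noteq> 0" "q \<noteq> 0" using D0 qv by auto
  hence deg: "degree v + degree q \<le> 2 * N" "degree v + degree q > 0"
    using dD q(3) by (auto simp: qv degree_mult_eq)
  obtain c u where "c * v + u * q = [:resultant v q:]" using resultant_bezout[OF deg(2)] by blast
  moreover have "\<bar>real_of_int (resultant v q)\<bar> \<le> fact (2 * N) * Y ^ (2 * N)"
    using resultant_bound[OF Y cv cq deg(1)] by simp
  ultimately show ?thesis using that[of e v c u "resultant v q"] e P(2) \<rho>0 by (simp add: Y_def)
qed

section \<open>Rational points sorted by the reductions of their factors\<close>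

section \<open>Factors of a family of polynomials at rational points\<close>

text \<open>For \<open>degree c \<le> d\<close> and nonzero \<open>y\<close> this is
  \<open>y ^ d\<close> times the value of \<open>c\<close> at \<open>x / y\<close>: an integer that
  vanishes exactly when the value does.\<close>

definition homog :: "nat \<Rightarrow> int poly \<Rightarrow> int \<Rightarrow> int \<Rightarrow> int" where
  "homog d c x y = (\<Sum>k\<le>d. coeff c k * x ^ k * y ^ (d - k))"

lemma poly_eq_sum_upto:
  "degree (p :: 'a :: comm_ring_1 poly) \<le> d \<Longrightarrow> poly p x = (\<Sum>k\<le>d. coeff p k * x ^ k)"
  unfolding poly_altdef by (rule sum.mono_neutral_left) (auto simp: coeff_eq_0)

lemma homog_rat:
  assumes "degree c \<le> d" "y \<noteq> 0"
  shows "of_int (homog d c x y) = of_int y ^ d * poly (of_int_poly c) (of_int x / of_int y :: rat)"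
proof -
  have "poly (of_int_poly c) (of_int x / of_int y :: rat) = (\<Sum>k\<le>d. of_int (coeff c k) * (of_int x / of_int y) ^ k)"
    using assms(1) by (subst poly_eq_sum_upto[of _ d]) auto
  also have "of_int y ^ d * \<dots> = (\<Sum>k\<le>d. of_int (coeff c k * x ^ k * y ^ (d - k)))"
    unfolding sum_distrib_left
  proof (rule sum.cong)
    fix k assume "k \<in> {..d}"
    hence "of_int y ^ d = of_int y ^ (d - k) * (of_int y ^ k :: rat)" by (simp flip: power_add)
    thus "of_int y ^ d * (of_int (coeff c k) * (of_int x / of_int y) ^ k :: rat) =
        of_int (coeff c k * x ^ k * y ^ (d - k))"
      using assms(2) by (simp add: power_divide)
  qed simp
  finally show ?thesis by (simp add: homog_def)
qed

lemma homog_cong: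
  assumes "degree c \<le> d" "[y * z = x] (mod m)"
  shows "[homog d c x y = y ^ d * poly c z] (mod m)"
proof -
  have "[homog d c x y = (\<Sum>k\<le>d. coeff c k * (y * z) ^ k * y ^ (d - k))] (mod m)"
    unfolding homog_def using assms(2) by (intro cong_sum cong_mult cong_pow cong_refl) (rule cong_sym)
  also have "(\<Sum>k\<le>d. coeff c k * (y * z) ^ k * y ^ (d - k)) = y ^ d * (\<Sum>k\<le>d. coeff c k * z ^ k)"
    unfolding sum_distrib_left
    by (rule sum.cong) (auto simp: power_mult_distrib mult_ac simp flip: power_add)
  also have "(\<Sum>k\<le>d. coeff c k * z ^ k) = poly c z"
    using assms(1) by (simp add: poly_eq_sum_upto)
  finally show ?thesis .
qed

lemma homog_bound:
  fixes B K :: real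
  assumes "\<bar>x\<bar> \<le> B" "\<bar>y\<bar> \<le> B" "\<And>k. \<bar>coeff c k\<bar> \<le> K"
  shows "\<bar>homog d c x y\<bar> \<le> (real d + 1) * K * B ^ d"
proof -
  have K: "K \<ge> 0" using assms(3)[of 0] by linarith
  have B: "B \<ge> 0" using assms(1) by linarith
  have "\<bar>real_of_int (homog d c x y)\<bar> \<le> (\<Sum>k\<le>d. \<bar>real_of_int (coeff c k * x ^ k * y ^ (d - k))\<bar>)"
    unfolding homog_def of_int_sum by (rule sum_abs)
  also have "\<dots> \<le> (\<Sum>k\<le>d. K * B ^ d)"
  proof (rule sum_mono)
    fix k assume k: "k \<in> {..d}"
    have "\<bar>real_of_int (coeff c k * x ^ k * y ^ (d - k))\<bar> = \<bar>real_of_int (coeff c k)\<bar> * (\<bar>real_of_int x\<bar> ^ k * \<bar>real_of_int y\<bar> ^ (d - k))"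
      by (simp add: abs_mult power_abs)
    also have "\<dots> \<le> K * (B ^ k * B ^ (d - k))"
      using assms K B by (intro mult_mono power_mono mult_nonneg_nonneg) auto
    also have "\<dots> = K * B ^ d" using k by (simp flip: power_add)
    finally show "\<bar>real_of_int (coeff c k * x ^ k * y ^ (d - k))\<bar> \<le> K * B ^ d" .
  qed
  also have "\<dots> = (real d + 1) * K * B ^ d" by simp
  finally show ?thesis by simp
qed

text \<open>The fibre at \<open>T = x / y\<close>, with denominators cleared by the same power
  \<open>y ^ d\<close> in every coefficient.\<close>

definition specP :: "nat \<Rightarrow> int poly poly \<Rightarrow> int \<Rightarrow> int \<Rightarrow> int poly" where
  "specP d F x y = map_poly (\<lambda>c. homog d c x y) F"

lemma homog_0 [simp]: "homog d 0 x y = 0"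
  by (simp add: homog_def)

lemma coeff_specP [simp]: "coeff (specP d F x y) i = homog d (coeff F i) x y"
  by (simp add: specP_def coeff_map_poly)

lemma specP_cong:
  assumes "\<And>i. degree (coeff F i) \<le> d" "[y * z = x] (mod m)"
  shows "pcong m (specP d F x y) (smult (y ^ d) (evT z F))"
  using homog_cong[OF assms(1) assms(2)] by (simp add: pcong_iff cong_iff_dvd_diff)

lemma pderiv_iter_evT: "(pderiv ^^ e) (evT z F) = evT z ((pderiv ^^ e) F)"
  by (induction e) (simp_all add: pderiv_evT)

lemma pderiv_iter_smult: "(pderiv ^^ e) (smult c (P :: int poly)) = smult c ((pderiv ^^ e) P)"
  by (induction e) (simp_all add: pderiv_smult)

lemma pcong_pderiv_iter: "pcong m A B \<Longrightarrow> pcong m ((pderiv ^^ e) A) ((pderiv ^^ e) B)"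
  by (induction e) (auto intro: pcong_pderiv)

text \<open>A factor \<open>q\<close> of the fibre at \<open>z\<close> is recorded by the residue of its monic normalisation and
  by the order \<open>e\<close> of a derivative in which it is simple.\<close>

definition factor_key ::
  "int \<Rightarrow> int \<Rightarrow> int poly poly \<Rightarrow> int \<Rightarrow> int poly \<Rightarrow> int poly \<times> nat \<Rightarrow> bool" where
  "factor_key p m F z q k \<longleftrightarrow> (\<exists>qt vt c u. monic qt \<and> degree qt = degree q \<and>
     pcong m (smult (lead_coeff q) qt) q \<and> pcong m (evT z ((pderiv ^^ snd k) F)) (qt * vt) \<and>
     pcong p (c * vt + u * qt) 1 \<and> fst k = red p qt)"

text \<open>\<open>y\<close>, \<open>lead_coeff q\<close> and \<open>\<rho>\<close> are units modulo
  \<open>m\<close>. Dividing by them turns the factorisation and the Bezout relation over the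
  integers into those that \<open>factor_key\<close> asks of the monic normalisation of
  \<open>q\<close>, with \<open>z\<close> in the place of \<open>x / y\<close>.\<close>

lemma factor_key_exists:
  fixes p m x y z :: int
  assumes p: "prime p" and m: "m = p ^ Suc n" and y: "\<not> p dvd y" and z: "[y * z = x] (mod m)"
    and F: "\<And>i. degree (coeff F i) \<le> d"
    and q: "q dvd specP d F x y" "\<not> p dvd lead_coeff q"
    and e: "(pderiv ^^ e) (specP d F x y) = q * v" "c * v + u * q = [:\<rho>:]" "\<not> p dvd \<rho>"
  shows "\<exists>k. factor_key p m F z q k \<and> snd k = e \<and> fst k \<in> monic_dvs p (evT (z mod p) F)"
proof -
  have p1: "p > 1" using p prime_gt_1_int by auto
  have pm: "p dvd m" by (simp add: m)
  have inv: "\<exists>a'. [a * a' = 1] (mod m)" if "\<not> p dvd a" for a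
  proof -
    have "algebraic_semidom_class.coprime a p"
      using that p by (metis prime_imp_coprime algebraic_semidom_class.coprime_commute)
    hence "algebraic_semidom_class.coprime a m" by (simp add: m)
    thus ?thesis by (rule cong_solve_coprime_int)
  qed
  define l where "l = lead_coeff q"
  obtain l' where l': "[l * l' = 1] (mod m)" using inv q(2) l_def by blast
  obtain y' where y': "[y * y' = 1] (mod m)" using inv y by blast
  obtain r' where r': "[\<rho> * r' = 1] (mod m)" using inv e(3) by blast
  \<comment> \<open>The added monomial, zero modulo \<open>m\<close>, makes the leading coefficient
    equal to 1 and not merely congruent to 1.\<close>
  define qt where "qt = smult l' q + monom (1 - l' * l) (degree q)"
  have top: "coeff qt (degree q) = 1" by (simp add: qt_def l_def)
  have "degree qt \<le> degree q"
    unfolding qt_def by (intro degree_add_le degree_smult_le degree_monom_le)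
  moreover have "degree q \<le> degree qt" using top by (intro le_degree) simp
  ultimately have dqt: "degree qt = degree q" by (rule antisym)
  have mqt: "monic qt" unfolding dqt by (rule top)
  have lqt: "pcong m (smult l qt) q"
  proof -
    have "m dvd 1 - l' * l" using l' by (metis cong_iff_dvd_diff cong_sym mult.commute)
    moreover have "coeff (smult l qt) i - coeff q i =
        (if i = degree q then 0 else (1 - l' * l) * (- coeff q i))" for i
      by (auto simp: qt_def l_def algebra_simps)
    ultimately show ?thesis unfolding pcong_iff by simp
  qed
  have yinv: "[y' ^ d * y ^ d = 1] (mod m)"
    using cong_pow[OF y', of d] by (simp add: power_mult_distrib mult.commute)
  have key: "pcong m (evT z G) (qt * smult (y' ^ d * l) w)"
    if G: "pcong m (q * w) (smult (y ^ d) (evT z G))" for G w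
  proof -
    have "pcong m (evT z G) (smult (y' ^ d * y ^ d) (evT z G))"
      using pcong_smult_cong[OF cong_sym[OF yinv], of "evT z G"] by simp
    also have "smult (y' ^ d * y ^ d) (evT z G) = smult (y' ^ d) (smult (y ^ d) (evT z G))" by simp
    also have "pcong m \<dots> (smult (y' ^ d) (q * w))" by (intro pcong_smult pcong_sym[OF G])
    also have "pcong m \<dots> (smult (y' ^ d) (smult l qt * w))"
      by (intro pcong_smult pcong_mult pcong_sym[OF lqt] pcong_refl)
    also have "smult (y' ^ d) (smult l qt * w) = qt * smult (y' ^ d * l) w" by simp
    finally show ?thesis .
  qed
  have spec: "pcong m (specP d F x y) (smult (y ^ d) (evT z F))" by (rule specP_cong[OF F z])
  define vt where "vt = smult (y' ^ d * l) v"
  have "pcong m ((pderiv ^^ e) (specP d F x y)) ((pderiv ^^ e) (smult (y ^ d) (evT z F)))"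
    by (rule pcong_pderiv_iter[OF spec])
  hence N: "pcong m (evT z ((pderiv ^^ e) F)) (qt * vt)"
    unfolding vt_def by (intro key) (simp add: e(1) pderiv_iter_smult pderiv_iter_evT)
  have bez: "pcong m (smult (r' * y ^ d * l') c * vt + smult (r' * l) u * qt) 1"
  proof -
    have "[y ^ d * l' * (y' ^ d * l) = (y' ^ d * y ^ d) * (l * l')] (mod m)" by (simp add: mult_ac)
    also have "[(y' ^ d * y ^ d) * (l * l') = 1 * 1] (mod m)" by (rule cong_mult[OF yinv l'])
    finally have "[r' * (y ^ d * l' * (y' ^ d * l)) = r' * 1] (mod m)" by (intro cong_mult cong_refl) simp
    hence 1: "[r' * y ^ d * l' * (y' ^ d * l) = r'] (mod m)" by (simp add: mult_ac)
    have "smult (r' * y ^ d * l') c * vt = smult (r' * y ^ d * l' * (y' ^ d * l)) (c * v)"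
      by (simp add: vt_def mult_ac)
    moreover have "smult (r' * l) u * qt = smult r' (u * smult l qt)" by (simp add: mult_ac)
    ultimately have "pcong m (smult (r' * y ^ d * l') c * vt + smult (r' * l) u * qt) (smult r' (c * v) + smult r' (u * q))"
      using 1 lqt by (simp only:) (intro pcong_add pcong_smult_cong pcong_smult pcong_mult pcong_refl)
    also have "smult r' (c * v) + smult r' (u * q) = smult r' [:\<rho>:]"
      by (simp only: e(2) flip: smult_add_right)
    also have "pcong m \<dots> 1" using r' by (auto simp: pcong_iff coeff_pCons cong_iff_dvd_diff mult.commute split: nat.splits)
    finally show ?thesis .
  qed
  hence bez: "pcong p (smult (r' * y ^ d * l') c * vt + smult (r' * l) u * qt) 1"
    using pm by (rule pcong_dvd_mono)
  have 1: "factor_key p m F z q (red p qt, e)"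
    unfolding factor_key_def fst_conv snd_conv using mqt dqt lqt[unfolded l_def] N bez by blast
  obtain w where w: "specP d F x y = q * w" using q(1) by (elim dvdE)
  have "pcong m (evT z F) (qt * smult (y' ^ d * l) w)" by (rule key) (use spec w in simp)
  hence "pcong p (evT z F) (qt * smult (y' ^ d * l) w)" using pm by (rule pcong_dvd_mono)
  moreover have "pcong p (evT (z mod p) F) (evT z F)" by (rule pcong_evT) simp
  ultimately have "pcong p (evT (z mod p) F) (qt * smult (y' ^ d * l) w)" by (rule pcong_trans[rotated])
  hence "red p qt \<in> monic_dvs p (evT (z mod p) F)" by (rule red_in_monic_dvs[OF p1 mqt])
  with 1 show ?thesis by (intro exI[of _ "(red p qt, e)"]) simp
qed

text \<open>Newton iteration starts from data modulo \<open>p\<close>, and these depend on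
  \<open>\<tau>\<close> and the key alone: a Bezout relation found at any one point of the class
  serves for all of them. On an empty class there is nothing to interpolate.\<close>

lemma factor_key_interpolation:
  fixes p m :: int
  assumes p: "prime p" and m: "m = p ^ Suc n"
  shows "\<exists>Q. \<forall>z q. [z = \<tau>] (mod p) \<longrightarrow> factor_key p m F z q k \<longrightarrow>
     pcong m (smult (lead_coeff q) (evT z Q)) q"
proof (cases "\<exists>z0 q0. [z0 = \<tau>] (mod p) \<and> factor_key p m F z0 q0 k")
  case False
  thus ?thesis by blast
next
  case True
  have p1: "p > 1" using p prime_gt_1_int by auto
  have pm: "p dvd m" by (simp add: m)
  define NN where "NN = (pderiv ^^ snd k) F"
  obtain z0 q0 where z0: "[z0 = \<tau>] (mod p)" and q0: "factor_key p m F z0 q0 k" using True by blast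
  obtain qt vt c u where qt: "monic qt" "pcong m (evT z0 NN) (qt * vt)"
    "pcong p (c * vt + u * qt) 1" "fst k = red p qt"
    using q0 unfolding factor_key_def NN_def by blast
  have mk: "monic (fst k)" using monic_red[OF qt(1) p1] qt(4) by simp
  have qk: "pcong p qt (fst k)" using pcong_red qt(4) by simp
  have "pcong p (c * vt + u * fst k) (c * vt + u * qt)"
    by (intro pcong_add pcong_mult pcong_refl pcong_sym[OF qk])
  hence bez: "pcong p (c * vt + u * fst k) 1" by (rule pcong_trans[OF _ qt(3)])
  have "pcong p (evT \<tau> NN) (evT z0 NN)" by (rule pcong_evT[OF cong_sym[OF z0]])
  also have "pcong p (evT z0 NN) (qt * vt)" by (rule pcong_dvd_mono[OF qt(2) pm])
  also have "pcong p (qt * vt) (fst k * vt)" by (intro pcong_mult qk pcong_refl)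
  finally have tau: "pcong p (evT \<tau> NN) (fst k * vt)" .
  obtain Q where Q: "\<And>z q v. [z = \<tau>] (mod p) \<Longrightarrow> monic q \<Longrightarrow> degree q = degree (fst k) \<Longrightarrow>
      pcong p q (fst k) \<Longrightarrow> pcong (p ^ Suc n) (evT z NN) (q * v) \<Longrightarrow> pcong (p ^ Suc n) (evT z Q) q"
    using newton_family[OF mk bez tau, of n] by blast
  have "pcong m (smult (lead_coeff q) (evT z Q)) q"
    if z: "[z = \<tau>] (mod p)" and q: "factor_key p m F z q k" for z q
  proof -
    obtain qt vt c u where qt: "monic qt" "pcong m (smult (lead_coeff q) qt) q" "pcong m (evT z NN) (qt * vt)"
      "fst k = red p qt" using q unfolding factor_key_def NN_def by blast
    have "pcong (p ^ Suc n) (evT z Q) qt"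
      by (rule Q[OF z qt(1)]) (use qt monic_red[OF qt(1) p1] pcong_red in \<open>auto simp: m\<close>)
    hence "pcong m (smult (lead_coeff q) (evT z Q)) (smult (lead_coeff q) qt)"
      unfolding m by (rule pcong_smult)
    thus ?thesis using qt(2) by (rule pcong_trans)
  qed
  thus ?thesis by blast
qed

lemma factor_keys_interpolation:
  fixes p m :: int
  assumes p: "prime p" and m: "m = p ^ Suc n"
  shows "\<exists>Q. \<forall>z qs. [z = \<tau>] (mod p) \<longrightarrow> list_all2 (factor_key p m F z) qs ks \<longrightarrow>
     pcong m (smult (lead_coeff (prod_list qs)) (evT z Q)) (prod_list qs)"
proof (induction ks)
  case Nil
  show ?case by (rule exI[of _ 1]) auto
next
  case (Cons k ks)
  then obtain Q1 where Q1: "\<And>z qs. [z = \<tau>] (mod p) \<Longrightarrow> list_all2 (factor_key p m F z) qs ks \<Longrightarrow>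
     pcong m (smult (lead_coeff (prod_list qs)) (evT z Q1)) (prod_list qs)" by blast
  obtain Q2 where Q2: "\<And>z q. [z = \<tau>] (mod p) \<Longrightarrow> factor_key p m F z q k \<Longrightarrow>
     pcong m (smult (lead_coeff q) (evT z Q2)) q" using factor_key_interpolation[OF p m] by metis
  have "pcong m (smult (lead_coeff (prod_list qs)) (evT z (Q2 * Q1))) (prod_list qs)"
    if z: "[z = \<tau>] (mod p)" and qs: "list_all2 (factor_key p m F z) qs (k # ks)" for z qs
  proof -
    obtain q qs' where q: "qs = q # qs'" "factor_key p m F z q k" "list_all2 (factor_key p m F z) qs' ks"
      using qs by (auto simp: list_all2_Cons2)
    have "smult (lead_coeff (prod_list qs)) (evT z (Q2 * Q1)) =
      smult (lead_coeff q) (evT z Q2) * smult (lead_coeff (prod_list qs')) (evT z Q1)"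
      by (simp add: q(1) evT_mult lead_coeff_mult mult_ac)
    also have "pcong m \<dots> (q * prod_list qs')" by (intro pcong_mult Q1 Q2 z q)
    finally show ?thesis by (simp add: q(1))
  qed
  thus ?case by blast
qed

section \<open>Good primes and residue keys\<close>

lemma irreducible_factor_list:
  fixes G :: "int poly"
  assumes "degree G > 0" "content G = 1"
  shows "\<exists>qs. G = prod_list qs \<and> (\<forall>q\<in>set qs. irreducible q \<and> degree q > 0 \<and> q dvd G) \<and> length qs \<le> degree G"
  using assms
proof (induction "degree G" arbitrary: G rule: less_induct)
  case less
  show ?case
  proof (cases "irreducible G")
    case True
    thus ?thesis using less.prems by (intro exI[of _ "[G]"]) auto
  next
    case False
    have "G \<noteq> 0" "\<not> is_unit G" using less.prems by (auto simp: is_unit_poly_iff)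
    then obtain a b where ab: "G = a * b" "\<not> is_unit a" "\<not> is_unit b"
      using False by (auto simp: irreducible_def)
    have *: "degree c > 0 \<and> content c = 1" if "c dvd G" "\<not> is_unit c" for c
    proof -
      have c: "content c = 1" using content_dvd_1[OF less.prems(2) that(1)] .
      have "degree c \<noteq> 0"
      proof
        assume "degree c = 0"
        then obtain c0 where "c = [:c0:]" by (elim degree_eq_zeroE)
        thus False using that(2) c by (simp add: is_unit_const_poly_iff)
      qed
      thus ?thesis using c by simp
    qed
    have ca: "degree a > 0" "content a = 1" and cb: "degree b > 0" "content b = 1"
      using *[of a] *[of b] ab by auto
    have deg: "degree G = degree a + degree b"
      unfolding ab(1) by (rule degree_mult_eq) (use ca cb in auto)
    obtain qs where qs: "a = prod_list qs" "\<forall>q\<in>set qs. irreducible q \<and> degree q > 0 \<and> q dvd a" "length qs \<le> degree a"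
      using less.hyps[of a] ca cb deg by auto
    obtain qs' where qs': "b = prod_list qs'" "\<forall>q\<in>set qs'. irreducible q \<and> degree q > 0 \<and> q dvd b" "length qs' \<le> degree b"
      using less.hyps[of b] ca cb deg by auto
    show ?thesis
      by (rule exI[of _ "qs @ qs'"]) (use qs qs' deg ab(1) in auto)
  qed
qed

lemma prime_not_dividing:
  fixes D :: int and P :: "nat set"
  assumes P: "finite P" "\<And>p. p \<in> P \<Longrightarrow> prime p" and D: "D \<noteq> 0" "real_of_int \<bar>D\<bar> < 2 ^ card P"
  obtains p where "p \<in> P" "\<not> int p dvd D"
proof (rule ccontr)
  assume "\<not> thesis"
  hence dvd: "\<And>p. p \<in> P \<Longrightarrow> p dvd nat \<bar>D\<bar>" using that
    by (metis int_dvd_int_iff dvd_abs_iff int_nat_eq abs_ge_zero)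
  have "\<Prod>P dvd nat \<bar>D\<bar>"
    using P(1) P(2) dvd
  proof (induction P rule: finite_induct)
    case (insert p P)
    have "algebraic_semidom_class.coprime p (\<Prod>P)"
      using insert by (intro prod_coprime_right) (metis insertCI primes_coprime)
    moreover have "p dvd nat \<bar>D\<bar>" "\<Prod>P dvd nat \<bar>D\<bar>" using insert by auto
    ultimately have "p * \<Prod>P dvd nat \<bar>D\<bar>" by (intro divides_mult)
    thus ?case unfolding prod.insert[OF insert.hyps] .
  qed simp
  hence "\<Prod>P \<le> nat \<bar>D\<bar>" using D(1) by (intro dvd_imp_le) auto
  moreover have "(\<Prod>p\<in>P. 2) \<le> \<Prod>P" by (intro prod_mono) (use P(2) prime_ge_2_nat in auto)
  hence "2 ^ card P \<le> \<Prod>P" by simp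
  ultimately have "2 ^ card P \<le> nat \<bar>D\<bar>" by (rule order_trans[rotated])
  hence "real (2 ^ card P) \<le> real (nat \<bar>D\<bar>)" by (simp only: of_nat_le_iff)
  thus False using D(2) by simp
qed

text \<open>One integer \<open>D\<close>, the leading coefficient of \<open>Ps\<close> times the
  numbers \<open>\<rho>\<close> of all irreducible factors of \<open>G0\<close> and
  \<open>G1\<close>, collects everything that the prime has to avoid. There are at most
  \<open>2 * N\<close> such factors, whence the power of \<open>\<Phi>\<close>; and \<open>D\<close>
  is too small to be divisible by all primes in \<open>P\<close>.\<close>

lemma good_prime:
  fixes Ps G0 G1 :: "int poly" and X :: real and P :: "nat set" and N :: nat
  defines "\<Phi> \<equiv> fact (2 * N) * (2 ^ N * (real N + 1) * (real N ^ N * X)) ^ (2 * N)"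
  assumes Ps: "Ps \<noteq> 0" "degree Ps \<le> N" "\<And>i. \<bar>coeff Ps i\<bar> \<le> X" and X: "X \<ge> 1"
    and G: "\<And>G. G \<in> {G0, G1} \<Longrightarrow> G dvd Ps \<and> degree G > 0 \<and> content G = 1"
    and P: "finite P" "\<And>p. p \<in> P \<Longrightarrow> prime p" "X * \<Phi> ^ (2 * N) < 2 ^ card P"
  obtains p where "p \<in> P" "\<not> int p dvd lead_coeff Ps"
    "\<And>G. G \<in> {G0, G1} \<Longrightarrow> \<exists>qs. G = prod_list qs \<and> length qs \<le> N \<and> (\<forall>q\<in>set qs. q dvd Ps \<and>
       (\<exists>e<N. \<exists>v c u \<rho>. (pderiv ^^ e) Ps = q * v \<and> c * v + u * q = [:\<rho>:] \<and> \<not> int p dvd \<rho>))"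
proof -
  have "\<exists>qs. G = prod_list qs \<and> length qs \<le> N \<and> (\<forall>q\<in>set qs. irreducible q \<and> degree q > 0 \<and> q dvd Ps)"
    if "G \<in> {G0, G1}" for G
  proof -
    have G': "G dvd Ps" "degree G > 0" "content G = 1" using G[OF that] by auto
    obtain qs where qs: "G = prod_list qs" "\<And>q. q \<in> set qs \<Longrightarrow> irreducible q \<and> degree q > 0 \<and> q dvd G"
      "length qs \<le> degree G" using irreducible_factor_list[OF G'(2,3)] by blast
    have "degree G \<le> N" using dvd_imp_degree_le[OF G'(1) Ps(1)] Ps(2) by simp
    thus ?thesis using qs G'(1) by (intro exI[of _ qs]) (auto intro: dvd_trans)
  qed
  then obtain qs where qs: "\<And>G. G \<in> {G0, G1} \<Longrightarrow> G = prod_list (qs G) \<and> length (qs G) \<le> N \<and>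
      (\<forall>q\<in>set (qs G). irreducible q \<and> degree q > 0 \<and> q dvd Ps)" by metis
  define Q where "Q = qs G0 @ qs G1"
  have Q: "irreducible q" "degree q > 0" "q dvd Ps" if "q \<in> set Q" for q
    using that qs[of G0] qs[of G1] by (auto simp: Q_def)
  have "\<exists>\<rho>. \<rho> \<noteq> 0 \<and> \<bar>real_of_int \<rho>\<bar> \<le> \<Phi> \<and> (\<exists>e<N. \<exists>v c u. (pderiv ^^ e) Ps = q * v \<and> c * v + u * q = [:\<rho>:])"
    if "q \<in> set Q" for q
    using bezout_simple_factor[OF Ps X Q(1)[OF that] Q(3)[OF that] Q(2)[OF that]] unfolding \<Phi>_def by metis
  then obtain \<rho> where \<rho>: "\<And>q. q \<in> set Q \<Longrightarrow> \<rho> q \<noteq> 0 \<and> \<bar>real_of_int (\<rho> q)\<bar> \<le> \<Phi> \<and>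
      (\<exists>e<N. \<exists>v c u. (pderiv ^^ e) Ps = q * v \<and> c * v + u * q = [:\<rho> q:])" by metis
  define D where "D = lead_coeff Ps * prod_list (map \<rho> Q)"
  have D0: "D \<noteq> 0" using \<rho> Ps(1) by (auto simp: D_def prod_list_zero_iff)
  have \<Phi>1: "\<Phi> \<ge> 1"
  proof -
    have "1 \<le> real N ^ N" by (cases "N = 0") (auto intro: one_le_power)
    hence "1 * (1 * (1 * 1)) \<le> 2 ^ N * ((real N + 1) * (real N ^ N * X))"
      using X by (intro mult_mono mult_nonneg_nonneg) auto
    hence "1 \<le> (2 ^ N * (real N + 1) * (real N ^ N * X)) ^ (2 * N)" by (intro one_le_power) (simp add: mult_ac)
    hence "1 * 1 \<le> fact (2 * N) * (2 ^ N * (real N + 1) * (real N ^ N * X)) ^ (2 * N)"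
      by (intro mult_mono) (auto simp: fact_ge_1)
    thus ?thesis by (simp add: \<Phi>_def)
  qed
  have "\<bar>real_of_int (prod_list (map \<rho> xs))\<bar> \<le> \<Phi> ^ length xs" if "set xs \<subseteq> set Q" for xs
    using that
  proof (induction xs)
    case (Cons a xs)
    hence "\<bar>real_of_int (\<rho> a)\<bar> * \<bar>real_of_int (prod_list (map \<rho> xs))\<bar> \<le> \<Phi> * \<Phi> ^ length xs"
      using \<rho>[of a] \<Phi>1 by (intro mult_mono) auto
    thus ?case by (simp add: abs_mult)
  qed simp
  hence "\<bar>real_of_int (prod_list (map \<rho> Q))\<bar> \<le> \<Phi> ^ length Q" by simp
  also have "\<dots> \<le> \<Phi> ^ (2 * N)"
    using qs[of G0] qs[of G1] \<Phi>1 by (intro power_increasing) (auto simp: Q_def)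
  finally have "\<bar>real_of_int D\<bar> \<le> X * \<Phi> ^ (2 * N)"
    unfolding D_def of_int_mult abs_mult using Ps(3)[of "degree Ps"] X by (intro mult_mono) auto
  hence "real_of_int \<bar>D\<bar> < 2 ^ card P" using P(3) by simp
  then obtain p where p: "p \<in> P" "\<not> int p dvd D" using prime_not_dividing[OF P(1,2) D0] by blast
  have "\<rho> q dvd prod_list (map \<rho> Q)" if "q \<in> set Q" for q
    using that by (induction Q) auto
  hence nd: "\<not> int p dvd \<rho> q" if "q \<in> set Q" for q
    using that p(2) unfolding D_def by (meson dvd_mult dvd_trans)
  show ?thesis
  proof (rule that[OF p(1)])
    show "\<not> int p dvd lead_coeff Ps" using p(2) by (auto simp: D_def)
    fix G assume G: "G \<in> {G0, G1}"
    have "q dvd Ps \<and> (\<exists>e<N. \<exists>v c u \<rho>. (pderiv ^^ e) Ps = q * v \<and> c * v + u * q = [:\<rho>:] \<and> \<not> int p dvd \<rho>)"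
      if "q \<in> set (qs G)" for q
    proof -
      have q: "q \<in> set Q" using G that by (auto simp: Q_def)
      obtain e v c u where e: "e < N" "(pderiv ^^ e) Ps = q * v" "c * v + u * q = [:\<rho> q:]" using \<rho>[OF q] by auto
      with nd[OF q] have 1: "\<exists>v c u \<rho>. (pderiv ^^ e) Ps = q * v \<and> c * v + u * q = [:\<rho>:] \<and> \<not> int p dvd \<rho>"
        by (intro exI[of _ v] exI[of _ c] exI[of _ u] exI[of _ "\<rho> q"]) simp
      have "\<exists>e<N. \<exists>v c u \<rho>. (pderiv ^^ e) Ps = q * v \<and> c * v + u * q = [:\<rho>:] \<and> \<not> int p dvd \<rho>"
        by (rule exI[of _ e], rule conjI[OF e(1) 1])
      with Q(3)[OF q] show ?thesis by (rule conjI)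
    qed
    hence all: "\<forall>q\<in>set (qs G). q dvd Ps \<and>
       (\<exists>e<N. \<exists>v c u \<rho>. (pderiv ^^ e) Ps = q * v \<and> c * v + u * q = [:\<rho>:] \<and> \<not> int p dvd \<rho>)"
      by (rule ballI)
    have "G = prod_list (qs G)" "length (qs G) \<le> N" using qs[OF G] by simp_all
    thus "\<exists>qs. G = prod_list qs \<and> length qs \<le> N \<and> (\<forall>q\<in>set qs. q dvd Ps \<and>
       (\<exists>e<N. \<exists>v c u \<rho>. (pderiv ^^ e) Ps = q * v \<and> c * v + u * q = [:\<rho>:] \<and> \<not> int p dvd \<rho>))"
      using all by (intro exI[of _ "qs G"] conjI)
  qed
qed

lemma factor_keys_exist:
  fixes p m x y z :: int
  assumes p: "prime p" and m: "m = p ^ Suc n" and y: "\<not> p dvd y" and z: "[y * z = x] (mod m)"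
    and F: "\<And>i. degree (coeff F i) \<le> d" and lead: "\<not> p dvd lead_coeff (specP d F x y)"
    and qs: "\<And>q. q \<in> set qs \<Longrightarrow> q dvd specP d F x y \<and>
       (\<exists>e<N. \<exists>v c u \<rho>. (pderiv ^^ e) (specP d F x y) = q * v \<and> c * v + u * q = [:\<rho>:] \<and> \<not> p dvd \<rho>)"
  shows "\<exists>ks. list_all2 (factor_key p m F z) qs ks \<and> set ks \<subseteq> monic_dvs p (evT (z mod p) F) \<times> {..<N}"
  using qs
proof (induction qs)
  case (Cons q qs)
  then obtain ks where ks: "list_all2 (factor_key p m F z) qs ks" "set ks \<subseteq> monic_dvs p (evT (z mod p) F) \<times> {..<N}"
    by auto
  have q: "q dvd specP d F x y" using Cons.prems by auto
  obtain e v c u \<rho> where e: "e < N" "(pderiv ^^ e) (specP d F x y) = q * v" "c * v + u * q = [:\<rho>:]" "\<not> p dvd \<rho>"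
    using Cons.prems[of q] by auto
  have lq: "\<not> p dvd lead_coeff q"
  proof -
    obtain w where "specP d F x y = q * w" using q by (elim dvdE)
    thus ?thesis using lead by (auto simp: lead_coeff_mult)
  qed
  obtain k where k: "factor_key p m F z q k" "snd k = e" "fst k \<in> monic_dvs p (evT (z mod p) F)"
    using factor_key_exists[OF p m y z F q lq e(2-4)] by blast
  hence "k \<in> monic_dvs p (evT (z mod p) F) \<times> {..<N}" using e(1) by (cases k) auto
  with ks k(1) show ?case by (intro exI[of _ "k # ks"]) auto
qed auto

section \<open>Covering the rational points by few classes\<close>

definition key_lists :: "nat \<Rightarrow> int poly poly \<Rightarrow> int \<Rightarrow> int \<Rightarrow> (int poly \<times> nat) list set" where
  "key_lists N F p \<tau> = {ks. set ks \<subseteq> monic_dvs p (evT \<tau> F) \<times> {..<N} \<and> length ks \<le> N}"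

lemma key_lists_card:
  assumes p: "prime p" and F: "degree F \<le> N" and \<tau>: "\<not> p dvd poly (lead_coeff F) \<tau>"
  shows "finite (key_lists N F p \<tau>)" "card (key_lists N F p \<tau>) \<le> (\<Sum>i\<le>N. (2 ^ N * N) ^ i)"
proof -
  have "coeff (evT \<tau> F) (degree F) \<noteq> 0" using \<tau> by auto
  hence d: "degree (evT \<tau> F) = degree F" by (intro antisym degree_evT_le le_degree)
  have "\<not> p dvd lead_coeff (evT \<tau> F)" using \<tau> by (simp add: d)
  note * = monic_dvs_card[OF p this]
  have fin: "finite (monic_dvs p (evT \<tau> F) \<times> {..<N})" using * by simp
  have "card (monic_dvs p (evT \<tau> F) \<times> {..<N}) = card (monic_dvs p (evT \<tau> F)) * N"
    by (simp add: card_cartesian_product)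
  also have "card (monic_dvs p (evT \<tau> F)) \<le> 2 ^ degree (evT \<tau> F)" using * by simp
  also have "\<dots> \<le> (2::nat) ^ N" using F d by (intro power_increasing) auto
  finally have c: "card (monic_dvs p (evT \<tau> F) \<times> {..<N}) \<le> 2 ^ N * N" by simp
  show "finite (key_lists N F p \<tau>)" unfolding key_lists_def by (rule finite_lists_length_le[OF fin])
  have "card (key_lists N F p \<tau>) = (\<Sum>i\<le>N. card (monic_dvs p (evT \<tau> F) \<times> {..<N}) ^ i)"
    unfolding key_lists_def by (rule card_lists_length_le[OF fin])
  also have "\<dots> \<le> (\<Sum>i\<le>N. (2 ^ N * N) ^ i)" by (intro sum_mono power_mono c) simp
  finally show "card (key_lists N F p \<tau>) \<le> (\<Sum>i\<le>N. (2 ^ N * N) ^ i)" .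
qed

text \<open>The prime belongs to the key because it varies with the point. The residue
  \<open>z\<close> of \<open>x / y\<close> is taken modulo the full power of \<open>p\<close>, but
  only its reduction \<open>\<tau>\<close> is recorded, which keeps the number of keys
  small.\<close>

definition has_key ::
  "int poly poly \<Rightarrow> nat \<Rightarrow> int \<Rightarrow> int \<Rightarrow> int poly \<Rightarrow> int poly \<Rightarrow> nat \<times> int \<times> (int poly \<times> nat) list \<times> (int poly \<times> nat) list \<Rightarrow> bool" where
  "has_key F n x y G0 G1 \<kappa> \<longleftrightarrow> (case \<kappa> of (p, \<tau>, ks0, ks1) \<Rightarrow>
     \<exists>z qs0 qs1. [y * z = x] (mod int p ^ Suc n) \<and> [z = \<tau>] (mod int p) \<and>
       G0 = prod_list qs0 \<and> list_all2 (factor_key (int p) (int p ^ Suc n) F z) qs0 ks0 \<and>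
       G1 = prod_list qs1 \<and> list_all2 (factor_key (int p) (int p ^ Suc n) F z) qs1 ks1)"

text \<open>At a residue where the leading coefficient of \<open>F\<close> vanishes, the fibre could
  be zero modulo \<open>p\<close>, and the bound for its monic divisors would fail. By
  \<open>key_exists\<close> a good prime never leads to such a residue.\<close>

definition key_set :: "nat \<Rightarrow> int poly poly \<Rightarrow> nat set \<Rightarrow> (nat \<times> int \<times> (int poly \<times> nat) list \<times> (int poly \<times> nat) list) set" where
  "key_set N F P = Sigma P (\<lambda>p. Sigma {\<tau> \<in> {0..<int p}. \<not> int p dvd poly (lead_coeff F) \<tau>}
      (\<lambda>\<tau>. key_lists N F (int p) \<tau> \<times> key_lists N F (int p) \<tau>))"

lemma key_set_card:
  fixes X :: real
  assumes P: "finite P" "\<And>p. p \<in> P \<Longrightarrow> prime p \<and> real p \<le> X" and F: "degree F \<le> N"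
  shows "finite (key_set N F P)" "real (card (key_set N F P)) \<le> real (card P) * X * real ((\<Sum>i\<le>N. (2 ^ N * N) ^ i)\<^sup>2)"
proof -
  define W where "W = (\<Sum>i\<le>N. (2 ^ N * N) ^ i)"
  define R where "R p = {\<tau> \<in> {0..<int p}. \<not> int p dvd poly (lead_coeff F) \<tau>}" for p
  have pr: "prime (int p)" if "p \<in> P" for p using P(2)[OF that] by simp
  have finR: "finite (R p)" for p by (rule finite_subset[of _ "{0..<int p}"]) (auto simp: R_def)
  have cR: "card (R p) \<le> p" for p
  proof -
    have "card (R p) \<le> card {0..<int p}" unfolding R_def by (rule card_mono) auto
    thus ?thesis by simp
  qed
  have kl: "finite (key_lists N F (int p) \<tau>)" "card (key_lists N F (int p) \<tau>) \<le> W"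
    if "p \<in> P" "\<tau> \<in> R p" for p \<tau>
    unfolding W_def using key_lists_card[OF pr[OF that(1)] F, of \<tau>] that(2) by (auto simp: R_def)
  have fin1: "finite (Sigma (R p) (\<lambda>\<tau>. key_lists N F (int p) \<tau> \<times> key_lists N F (int p) \<tau>))" if "p \<in> P" for p
    by (rule finite_SigmaI) (use finR kl that in auto)
  have eq: "key_set N F P = Sigma P (\<lambda>p. Sigma (R p) (\<lambda>\<tau>. key_lists N F (int p) \<tau> \<times> key_lists N F (int p) \<tau>))"
    by (simp add: key_set_def R_def)
  show "finite (key_set N F P)" unfolding eq by (rule finite_SigmaI) (use P fin1 in auto)
  have c1: "card (Sigma (R p) (\<lambda>\<tau>. key_lists N F (int p) \<tau> \<times> key_lists N F (int p) \<tau>)) \<le> p * W\<^sup>2" if p: "p \<in> P" for p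
  proof -
    have "card (Sigma (R p) (\<lambda>\<tau>. key_lists N F (int p) \<tau> \<times> key_lists N F (int p) \<tau>))
        = (\<Sum>\<tau>\<in>R p. card (key_lists N F (int p) \<tau> \<times> key_lists N F (int p) \<tau>))"
      by (rule card_SigmaI) (use finR kl p in auto)
    also have "\<dots> \<le> (\<Sum>\<tau>\<in>R p. W * W)"
      unfolding card_cartesian_product by (intro sum_mono mult_mono kl p) auto
    also have "\<dots> = card (R p) * W\<^sup>2" by (simp add: power2_eq_square)
    also have "\<dots> \<le> p * W\<^sup>2" by (rule mult_right_mono[OF cR]) simp
    finally show ?thesis .
  qed
  have "card (key_set N F P) = (\<Sum>p\<in>P. card (Sigma (R p) (\<lambda>\<tau>. key_lists N F (int p) \<tau> \<times> key_lists N F (int p) \<tau>)))"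
    unfolding eq by (rule card_SigmaI) (use P fin1 in auto)
  also have "\<dots> \<le> (\<Sum>p\<in>P. p * W\<^sup>2)" by (rule sum_mono[OF c1])
  finally have "real (card (key_set N F P)) \<le> real (\<Sum>p\<in>P. p * W\<^sup>2)" by (simp only: of_nat_le_iff)
  also have "\<dots> = (\<Sum>p\<in>P. real p * real (W\<^sup>2))" by simp
  also have "\<dots> \<le> (\<Sum>p\<in>P. X * real (W\<^sup>2))" by (intro sum_mono mult_right_mono) (use P(2) in auto)
  also have "\<dots> = real (card P) * X * real (W\<^sup>2)" by simp
  finally show "real (card (key_set N F P)) \<le> real (card P) * X * real ((\<Sum>i\<le>N. (2 ^ N * N) ^ i)\<^sup>2)"
    unfolding W_def .
qed

lemma key_exists:
  fixes x y :: int and N :: nat and X :: real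
  defines "\<Phi> \<equiv> fact (2 * N) * (2 ^ N * (real N + 1) * (real N ^ N * X)) ^ (2 * N)"
  assumes F: "degree F \<le> N" "\<And>i. degree (coeff F i) \<le> d"
    and Ps: "homog d (lead_coeff F) x y \<noteq> 0" "\<And>i. \<bar>coeff (specP d F x y) i\<bar> \<le> X" and X: "X \<ge> 1"
    and G: "\<And>G. G \<in> {G0, G1} \<Longrightarrow> G dvd specP d F x y \<and> degree G > 0 \<and> content G = 1"
    and P: "finite P" "\<And>p. p \<in> P \<Longrightarrow> prime p \<and> \<not> int p dvd y" "X * \<Phi> ^ (2 * N) < 2 ^ card P"
  shows "\<exists>\<kappa>\<in>key_set N F P. has_key F n x y G0 G1 \<kappa>"
proof -
  define Ps where "Ps = specP d F x y"
  have top: "coeff Ps (degree F) \<noteq> 0" using Ps(1) by (simp add: Ps_def)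
  have "degree Ps \<le> degree F" by (simp add: Ps_def specP_def degree_map_poly_le)
  moreover have "degree F \<le> degree Ps" using top by (rule le_degree)
  ultimately have dPs: "degree Ps = degree F" by simp
  have Ps0: "Ps \<noteq> 0" using top by auto
  obtain p where p: "p \<in> P" "\<not> int p dvd lead_coeff Ps"
    and qs: "\<And>G. G \<in> {G0, G1} \<Longrightarrow> \<exists>qs. G = prod_list qs \<and> length qs \<le> N \<and> (\<forall>q\<in>set qs. q dvd Ps \<and>
       (\<exists>e<N. \<exists>v c u \<rho>. (pderiv ^^ e) Ps = q * v \<and> c * v + u * q = [:\<rho>:] \<and> \<not> int p dvd \<rho>))"
    by (rule good_prime[of Ps N X G0 G1 P])
       (use Ps0 dPs F Ps X G P in \<open>auto simp: Ps_def \<Phi>_def\<close>)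
  have pr: "prime (int p)" and py: "\<not> int p dvd y" using P(2)[OF p(1)] by auto
  define m where "m = int p ^ Suc n"
  have "algebraic_semidom_class.coprime y m"
    using pr py unfolding m_def by (metis prime_imp_coprime algebraic_semidom_class.coprime_commute coprime_power_right_iff)
  then obtain y' where y': "[y * y' = 1] (mod m)" using cong_solve_coprime_int by blast
  define z where "z = y' * x"
  have z: "[y * z = x] (mod m)"
    using cong_mult[OF y' cong_refl[of x]] by (simp add: z_def mult.assoc)
  define \<tau> where "\<tau> = z mod int p"
  have zt: "[z = \<tau>] (mod int p)" by (simp add: \<tau>_def)
  have p0: "int p > 0" using pr prime_gt_0_int by blast
  have "[homog d (lead_coeff F) x y = y ^ d * poly (lead_coeff F) z] (mod m)"
    by (rule homog_cong[OF F(2) z])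
  hence "[homog d (lead_coeff F) x y = y ^ d * poly (lead_coeff F) z] (mod int p)"
    by (rule cong_dvd_modulus) (simp add: m_def)
  moreover have "[y ^ d * poly (lead_coeff F) z = y ^ d * poly (lead_coeff F) \<tau>] (mod int p)"
    using zt dvd_trans[OF _ poly_int_dvd_diff[of z \<tau>]]
    by (intro cong_mult cong_refl) (auto simp: cong_iff_dvd_diff)
  ultimately have "[homog d (lead_coeff F) x y = y ^ d * poly (lead_coeff F) \<tau>] (mod int p)" by (rule cong_trans)
  moreover have "\<not> int p dvd homog d (lead_coeff F) x y" using p(2) unfolding dPs by (simp add: Ps_def)
  ultimately have "\<not> int p dvd y ^ d * poly (lead_coeff F) \<tau>" by (simp add: cong_dvd_iff)
  hence \<tau>: "\<not> int p dvd poly (lead_coeff F) \<tau>" by auto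
  have keys: "\<exists>qs ks. G = prod_list qs \<and> list_all2 (factor_key (int p) m F z) qs ks \<and> ks \<in> key_lists N F (int p) \<tau>"
    if Gin: "G \<in> {G0, G1}" for G
  proof -
    obtain qs where q: "G = prod_list qs" "length qs \<le> N"
      and q': "\<And>q. q \<in> set qs \<Longrightarrow> q dvd specP d F x y \<and>
       (\<exists>e<N. \<exists>v c u \<rho>. (pderiv ^^ e) (specP d F x y) = q * v \<and> c * v + u * q = [:\<rho>:] \<and> \<not> int p dvd \<rho>)"
      using qs[OF Gin] unfolding Ps_def by auto
    obtain ks where ks: "list_all2 (factor_key (int p) m F z) qs ks" "set ks \<subseteq> monic_dvs (int p) (evT \<tau> F) \<times> {..<N}"
      using factor_keys_exist[OF pr m_def py z F(2) p(2)[unfolded Ps_def] q'] unfolding \<tau>_def by blast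
    have "length ks \<le> N" using list_all2_lengthD[OF ks(1)] q(2) by simp
    with ks q show ?thesis by (auto simp: key_lists_def)
  qed
  obtain qs0 ks0 where k0: "G0 = prod_list qs0" "list_all2 (factor_key (int p) m F z) qs0 ks0" "ks0 \<in> key_lists N F (int p) \<tau>"
    using keys[of G0] by blast
  obtain qs1 ks1 where k1: "G1 = prod_list qs1" "list_all2 (factor_key (int p) m F z) qs1 ks1" "ks1 \<in> key_lists N F (int p) \<tau>"
    using keys[of G1] by blast
  have "\<tau> \<in> {0..<int p}" using p0 by (simp add: \<tau>_def)
  hence "(p, \<tau>, ks0, ks1) \<in> key_set N F P" using p(1) \<tau> k0(3) k1(3) by (simp add: key_set_def)
  moreover have "has_key F n x y G0 G1 (p, \<tau>, ks0, ks1)"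
    unfolding has_key_def prod.case m_def[symmetric]
    by (intro exI[of _ z] exI[of _ qs0] exI[of _ qs1] conjI z zt k0(1,2) k1(1,2))
  ultimately show ?thesis by (rule bexI[rotated])
qed

text \<open>The integer \<open>I\<close> below is divisible by \<open>p ^ (2 * A)\<close>, while its
  size is at most \<open>2 * Y * A * B ^ (A - 1) * p ^ (A + 1)\<close>. By
  \<open>2 * Y < 2 ^ (A - 1)\<close>, \<open>A \<le> 2 ^ (A - 1)\<close> and
  \<open>4 * B < p\<close> the part in front of \<open>p ^ (A + 1)\<close> is below
  \<open>p ^ (A - 1)\<close>, so \<open>I\<close> is zero.\<close>

lemma key_relation:
  fixes p :: nat and B Y :: real
  assumes p: "prime p" "4 * B < real p" and A: "A \<ge> 1" "2 * Y < 2 ^ (A - 1)" and B: "B \<ge> 1"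
    and Q: "\<And>z qs. [z = \<tau>] (mod int p) \<Longrightarrow> list_all2 (factor_key (int p) (int p ^ (2 * A)) F z) qs ks \<Longrightarrow>
       pcong (int p ^ (2 * A)) (smult (lead_coeff (prod_list qs)) (evT z Q)) (prod_list qs)"
  obtains P0 P1 :: "int poly" where "P0 \<noteq> 0 \<or> P1 \<noteq> 0" "degree P0 < A" "degree P1 < A"
    "\<And>x y z qs. [y * z = x] (mod int p ^ (2 * A)) \<Longrightarrow> [z = \<tau>] (mod int p) \<Longrightarrow>
       \<bar>real_of_int x\<bar> \<le> B \<Longrightarrow> \<bar>real_of_int y\<bar> \<le> B \<Longrightarrow>
       list_all2 (factor_key (int p) (int p ^ (2 * A)) F z) qs ks \<Longrightarrow>
       (\<And>i. \<bar>real_of_int (coeff (prod_list qs) i)\<bar> \<le> Y) \<Longrightarrow>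
       lead_coeff (prod_list qs) * homog (A - 1) P0 x y + coeff (prod_list qs) j * homog (A - 1) P1 x y = 0"
proof -
  have p1: "int p > 1" using p(1) prime_gt_1_nat by auto
  obtain P0 P1 where P: "P0 \<noteq> 0 \<or> P1 \<noteq> 0"
    "\<And>i. \<bar>coeff P0 i\<bar> \<le> int p ^ (A + 1)" "\<And>i. \<bar>coeff P1 i\<bar> \<le> int p ^ (A + 1)"
    "degree P0 < A" "degree P1 < A"
    "\<And>z. [z = \<tau>] (mod int p) \<Longrightarrow> int p ^ (2 * A) dvd poly P0 z + poly P1 z * poly (coeff Q j) z"
    using auxiliary_polynomials[OF p1 A(1), of "\<tau>" "coeff Q j"] by metis
  show ?thesis
  proof (rule that[OF P(1,4,5)])
    fix x y z :: int and qs
    assume xz: "[y * z = x] (mod int p ^ (2 * A))" and z: "[z = \<tau>] (mod int p)"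
      and x: "\<bar>real_of_int x\<bar> \<le> B" and y: "\<bar>real_of_int y\<bar> \<le> B"
      and qs: "list_all2 (factor_key (int p) (int p ^ (2 * A)) F z) qs ks"
      and Y: "\<And>i. \<bar>real_of_int (coeff (prod_list qs) i)\<bar> \<le> Y"
    define m where "m = int p ^ (2 * A)"
    define G where "G = prod_list qs"
    define I where "I = lead_coeff G * homog (A - 1) P0 x y + coeff G j * homog (A - 1) P1 x y"
    have Y0: "Y \<ge> 0" using Y[of 0] by linarith
    have "pcong m (smult (lead_coeff G) (evT z Q)) G" unfolding m_def G_def by (rule Q[OF z qs])
    hence Gj: "[lead_coeff G * poly (coeff Q j) z = coeff G j] (mod m)" by (simp add: pcong_iff cong_iff_dvd_diff)
    have "[I = lead_coeff G * (y ^ (A - 1) * poly P0 z) + (lead_coeff G * poly (coeff Q j) z) * (y ^ (A - 1) * poly P1 z)] (mod m)"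
      unfolding I_def using P(4,5) xz
      by (intro cong_add cong_mult cong_refl homog_cong cong_sym[OF Gj]) (auto simp: m_def)
    also have "lead_coeff G * (y ^ (A - 1) * poly P0 z) + (lead_coeff G * poly (coeff Q j) z) * (y ^ (A - 1) * poly P1 z)
        = lead_coeff G * y ^ (A - 1) * (poly P0 z + poly P1 z * poly (coeff Q j) z)"
      by (simp add: algebra_simps)
    finally have dvd: "m dvd I"
      using P(6)[OF z] by (simp add: cong_dvd_iff m_def)
    have h: "\<bar>real_of_int (homog (A - 1) R x y)\<bar> \<le> real A * (real p ^ (A + 1) * B ^ (A - 1))"
      if R: "\<And>i. \<bar>coeff R i\<bar> \<le> int p ^ (A + 1)" for R
    proof -
      have "real_of_int \<bar>coeff R i\<bar> \<le> real p ^ (A + 1)" for i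
      proof -
        have "real_of_int \<bar>coeff R i\<bar> \<le> real_of_int (int p ^ (A + 1))" using R by (simp only: of_int_le_iff)
        thus ?thesis by simp
      qed
      from homog_bound[OF x y this, of "A - 1"] show ?thesis using A(1) by (simp add: of_nat_diff mult_ac)
    qed
    have lY: "\<bar>real_of_int (lead_coeff G)\<bar> \<le> Y" "\<bar>real_of_int (coeff G j)\<bar> \<le> Y" using Y by (auto simp: G_def)
    define U where "U = real A * (real p ^ (A + 1) * B ^ (A - 1))"
    have U0: "U \<ge> 0" using B by (simp add: U_def)
    have "\<bar>real_of_int I\<bar> \<le> \<bar>real_of_int (lead_coeff G)\<bar> * \<bar>real_of_int (homog (A - 1) P0 x y)\<bar>
        + \<bar>real_of_int (coeff G j)\<bar> * \<bar>real_of_int (homog (A - 1) P1 x y)\<bar>"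
      unfolding I_def of_int_add of_int_mult abs_mult[symmetric] by (rule abs_triangle_ineq)
    also have "\<dots> \<le> Y * U + Y * U"
      unfolding U_def by (intro add_mono mult_mono lY h P(2,3) Y0) auto
    also have "\<dots> = (2 * Y) * (real A * B ^ (A - 1)) * real p ^ (A + 1)" by (simp add: U_def)
    also have "\<dots> < real p ^ (A - 1) * real p ^ (A + 1)"
    proof (rule mult_strict_right_mono)
      have A2: "real A \<le> 2 ^ (A - 1)"
      proof -
        have "A - 1 < 2 ^ (A - 1)" by simp
        hence "A \<le> 2 ^ (A - 1)" using A(1) by linarith
        hence "real A \<le> real (2 ^ (A - 1))" by (simp only: of_nat_le_iff)
        thus ?thesis by simp
      qed
      have "(2 * Y) * (real A * B ^ (A - 1)) < 2 ^ (A - 1) * (real A * B ^ (A - 1))"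
        using A B by (intro mult_strict_right_mono) auto
      also have "\<dots> \<le> 2 ^ (A - 1) * (2 ^ (A - 1) * B ^ (A - 1))"
        using A2 B by (intro mult_left_mono mult_right_mono) auto
      also have "\<dots> = (4 * B) ^ (A - 1)"
      proof -
        have "(4 * B) ^ (A - 1) = (2 * (2 * B)) ^ (A - 1)" by simp
        also have "\<dots> = 2 ^ (A - 1) * (2 ^ (A - 1) * B ^ (A - 1))" by (simp only: power_mult_distrib)
        finally show ?thesis by (rule sym)
      qed
      also have "\<dots> \<le> real p ^ (A - 1)" using p(2) B by (intro power_mono) auto
      finally show "(2 * Y) * (real A * B ^ (A - 1)) < real p ^ (A - 1)" .
      show "0 < real p ^ (A + 1)" using p1 by simp
    qed
    also have "\<dots> = real_of_int m"
    proof -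
      have "A - 1 + (A + 1) = 2 * A" using A(1) by simp
      hence "real p ^ (A - 1) * real p ^ (A + 1) = real p ^ (2 * A)" by (simp only: power_add[symmetric])
      thus ?thesis by (simp add: m_def)
    qed
    finally have "\<bar>I\<bar> < m" by linarith
    moreover have "I \<noteq> 0 \<Longrightarrow> \<bar>m\<bar> \<le> \<bar>I\<bar>" using dvd_imp_le_int[OF _ dvd] by blast
    ultimately have "I = 0" by linarith
    thus "lead_coeff (prod_list qs) * homog (A - 1) P0 x y + coeff (prod_list qs) j * homog (A - 1) P1 x y = 0"
      by (simp add: I_def G_def)
  qed
qed

lemma ln_scaled_power_le:
  fixes a M :: real
  assumes "a \<ge> 1" "M \<ge> 2"
  shows "ln (a * M ^ k) \<le> (ln a / ln 2 + real k) * ln M"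
proof -
  have "ln a * ln 2 \<le> ln a * ln M" using assms by (intro mult_left_mono) auto
  hence "ln a \<le> ln a / ln 2 * ln M" by (simp add: field_simps)
  moreover have "ln (a * M ^ k) = ln a + real k * ln M" using assms by (simp add: ln_mult ln_realpow)
  ultimately show ?thesis by (simp add: distrib_right)
qed

text \<open>Converts a bound polynomial in \<open>M\<close> into an exponent linear in
  \<open>ln M\<close>, with a rate \<open>K\<close> that does not depend on \<open>M\<close>. The
  summand 1 in the condition on \<open>K\<close> makes the inequality strict.\<close>

lemma less_two_power_ceiling:
  fixes a M K :: real
  assumes "a \<ge> 1" "M \<ge> 2" "K \<ge> (ln a / ln 2 + real k + 1) / ln 2"
  shows "a * M ^ k < 2 ^ nat \<lceil>K * ln M\<rceil>"
proof -
  have lM: "ln M > 0" using assms by simp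
  have ln2: "ln (2::real) > 0" by simp
  have "ln (a * M ^ k) \<le> (ln a / ln 2 + real k) * ln M" by (rule ln_scaled_power_le[OF assms(1,2)])
  also have "\<dots> < (ln a / ln 2 + real k + 1) * ln M" using lM by simp
  also have "\<dots> \<le> (K * ln 2) * ln M"
    by (rule mult_right_mono[OF assms(3)[unfolded pos_divide_le_eq[OF ln2]]]) (use lM in simp)
  also have "\<dots> = (K * ln M) * ln 2" by simp
  also have "\<dots> \<le> real (nat \<lceil>K * ln M\<rceil>) * ln 2" by (rule mult_right_mono[OF real_nat_ceiling_ge]) simp
  also have "\<dots> = ln (2 ^ nat \<lceil>K * ln M\<rceil>)" by (simp add: ln_realpow)
  finally show ?thesis using assms by (subst (asm) ln_less_cancel_iff) auto
qed

text \<open>The points \<open>t\<close> fall into \<open>O(B L ^ 3)\<close> classes; on each class every coefficient of the two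
  factors is a quotient of polynomials in \<open>t\<close> of degree \<open>O(L)\<close>.\<close>

theorem rational_point_classes:
  fixes N d :: nat
  obtains C :: real where "C > 0"
    "\<And>(F :: int poly poly) (K :: real) B (T :: rat set) (G :: bool \<Rightarrow> rat \<Rightarrow> int poly).
      K \<ge> 2 \<Longrightarrow> B \<ge> 1 \<Longrightarrow> degree F \<le> N \<Longrightarrow> (\<And>i. degree (coeff F i) \<le> d) \<Longrightarrow>
      (\<And>i k. real_of_int \<bar>coeff (coeff F i) k\<bar> \<le> K) \<Longrightarrow>
      (\<And>t. t \<in> T \<Longrightarrow> real_of_int \<bar>fst (quotient_of t)\<bar> \<le> B \<and> real_of_int \<bar>snd (quotient_of t)\<bar> \<le> B) \<Longrightarrow>
      (\<And>t. t \<in> T \<Longrightarrow> poly (of_int_poly (lead_coeff F)) t \<noteq> 0) \<Longrightarrow>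
      (\<And>t b. t \<in> T \<Longrightarrow> G b t dvd specP d F (fst (quotient_of t)) (snd (quotient_of t)) \<and>
          degree (G b t) > 0 \<and> content (G b t) = 1) \<Longrightarrow>
      \<exists>key A. finite (key ` T) \<and> real (card (key ` T)) \<le> C * B * (ln K + ln B) ^ 3 \<and>
         A \<ge> 1 \<and> real A \<le> C * (ln K + ln B) \<and>
         (\<forall>\<kappa> (b :: bool) j. \<exists>P0 P1 :: int poly. (P0 \<noteq> 0 \<or> P1 \<noteq> 0) \<and> degree P0 < A \<and> degree P1 < A \<and>
           (\<forall>t\<in>T. (key t :: nat \<times> int \<times> (int poly \<times> nat) list \<times> (int poly \<times> nat) list) = \<kappa> \<longrightarrow>
              of_int (lead_coeff (G b t)) * poly (of_int_poly P0) t +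
              of_int (coeff (G b t) j) * poly (of_int_poly P1) t = (0 :: rat)))"
proof -
  \<comment> \<open>Below, \<open>X = (d + 1) * M ^ (d + 1)\<close> with \<open>M = K * B\<close>
    bounds the coefficients of all fibres. Then \<open>a0\<close> and \<open>a1\<close> are what is
    left of \<open>\<Phi>\<close> and \<open>X * \<Phi> ^ (2 * N)\<close> without the powers of
    \<open>M\<close>, and \<open>k1\<close> is the exponent of \<open>M\<close> in the
    latter.\<close>
  define a0 :: real where "a0 = fact (2 * N) * (2 ^ N * (real N + 1) * (real N ^ N * (real d + 1))) ^ (2 * N)"
  define a1 where "a1 = (real d + 1) * a0 ^ (2 * N)"
  define k1 where "k1 = (d + 1) + (d + 1) * (2 * N) * (2 * N)"
  \<comment> \<open>The rate at which the number of primes must grow with \<open>L\<close> for 2 to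
    that power to exceed \<open>a1 * M ^ k1\<close>. In the same way \<open>a2\<close> and
    \<open>K2\<close> serve to choose \<open>A\<close> with
    \<open>2 * Y < 2 ^ (A - 1)\<close>.\<close>
  define K1 where "K1 = (ln a1 / ln 2 + real k1 + 1) / ln 2"
  define a2 where "a2 = 2 * (2 ^ N * (real N + 1) * (real d + 1))"
  define K2 where "K2 = (ln a2 / ln 2 + real (d + 1) + 1) / ln 2"
  define W where "W = real ((\<Sum>i\<le>N. (2 ^ N * N) ^ i)\<^sup>2)"
  have NN: "1 \<le> real N ^ N" by (cases "N = 0") (auto intro: one_le_power)
  have a0: "a0 \<ge> 1"
  proof -
    have "1 * (1 * (1 * 1)) \<le> 2 ^ N * ((real N + 1) * (real N ^ N * (real d + 1)))"
      using NN by (intro mult_mono mult_nonneg_nonneg) auto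
    hence "1 \<le> (2 ^ N * (real N + 1) * (real N ^ N * (real d + 1))) ^ (2 * N)" by (intro one_le_power) (simp add: mult_ac)
    hence "1 * 1 \<le> a0" unfolding a0_def by (intro mult_mono) (auto simp: fact_ge_1)
    thus ?thesis by simp
  qed
  have a1: "a1 \<ge> 1"
  proof -
    have "1 * 1 \<le> a1" unfolding a1_def using a0 by (intro mult_mono one_le_power) auto
    thus ?thesis by simp
  qed
  have a2: "a2 \<ge> 1"
  proof -
    have "1 * (1 * (1 * 1)) \<le> 2 * (2 ^ N * ((real N + 1) * (real d + 1)))"
      by (intro mult_mono mult_nonneg_nonneg) auto
    thus ?thesis by (simp add: a2_def mult_ac)
  qed
  have ln2: "ln (2::real) > 0" by simp
  have K1: "K1 > 0" using a1 ln2 unfolding K1_def by (intro divide_pos_pos add_nonneg_pos add_nonneg_nonneg divide_nonneg_pos) auto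
  have K2: "K2 > 0" using a2 ln2 unfolding K2_def by (intro divide_pos_pos add_nonneg_pos add_nonneg_nonneg divide_nonneg_pos) auto
  obtain C3 where C3: "C3 > 0" "\<And>B L. B \<ge> 1 \<Longrightarrow> L \<ge> ln 2 \<Longrightarrow> ln B \<le> L \<Longrightarrow>
    \<exists>P :: nat set. finite P \<and> card P = nat \<lceil>K1 * L\<rceil> \<and> (\<forall>p\<in>P. prime p \<and> 4 * B < real p \<and> real p \<le> C3 * B * L\<^sup>2)"
    by (rule primes_in_range[OF K1], rule that)
  define C where "C = (K1 + 1 / ln 2) * C3 * W + (K2 + 2 / ln 2)"
  have W0: "W \<ge> 0" by (simp add: W_def)
  have C0: "(K1 + 1 / ln 2) * C3 * W \<ge> 0"
    using K1 C3(1) W0 ln2 by (intro mult_nonneg_nonneg add_nonneg_nonneg divide_nonneg_nonneg) simp_all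
  have C0': "K2 + 2 / ln 2 > 0" using K2 ln2 by (intro add_pos_pos divide_pos_pos) simp_all
  show ?thesis
  proof (rule that[of C])
    show "C > 0" using C0 C0' by (simp add: C_def)
    fix F :: "int poly poly" and K B :: real and T :: "rat set"
      and G :: "bool \<Rightarrow> rat \<Rightarrow> int poly"
    assume K: "K \<ge> 2" and B: "B \<ge> 1" and F: "degree F \<le> N" "\<And>i. degree (coeff F i) \<le> d"
      and FK: "\<And>i k. real_of_int \<bar>coeff (coeff F i) k\<bar> \<le> K"
      and T: "\<And>t. t \<in> T \<Longrightarrow> real_of_int \<bar>fst (quotient_of t)\<bar> \<le> B \<and> real_of_int \<bar>snd (quotient_of t)\<bar> \<le> B"
      and lead: "\<And>t. t \<in> T \<Longrightarrow> poly (of_int_poly (lead_coeff F)) t \<noteq> 0"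
      and G: "\<And>t b. t \<in> T \<Longrightarrow> G b t dvd specP d F (fst (quotient_of t)) (snd (quotient_of t)) \<and>
          degree (G b t) > 0 \<and> content (G b t) = 1"
    define M where "M = K * B"
    define L where "L = ln K + ln B"
    have M: "M \<ge> 2" using K B mult_mono[of 2 K 1 B] by (simp add: M_def)
    have LM: "L = ln M" using K B by (simp add: L_def M_def ln_mult)
    have L: "L \<ge> ln 2" unfolding LM using M by simp
    have LB: "ln B \<le> L" using K by (simp add: L_def)
    obtain P :: "nat set" where P0: "finite P \<and> card P = nat \<lceil>K1 * L\<rceil> \<and>
        (\<forall>p\<in>P. prime p \<and> 4 * B < real p \<and> real p \<le> C3 * B * L\<^sup>2)"
      using C3(2)[OF B L LB] by (rule exE)
    have P: "finite P" "card P = nat \<lceil>K1 * L\<rceil>"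
      "\<And>p. p \<in> P \<Longrightarrow> prime p \<and> 4 * B < real p \<and> real p \<le> C3 * B * L\<^sup>2"
      using P0 by simp_all
    define X where "X = (real d + 1) * M ^ (d + 1)"
    define \<Phi> where "\<Phi> = fact (2 * N) * (2 ^ N * (real N + 1) * (real N ^ N * X)) ^ (2 * N)"
    have X1: "X \<ge> 1"
    proof -
      have "1 * 1 \<le> X" unfolding X_def using M by (intro mult_mono one_le_power) auto
      thus ?thesis by simp
    qed
    have \<Phi>: "\<Phi> = a0 * (M ^ (d + 1)) ^ (2 * N)"
      by (simp only: \<Phi>_def a0_def X_def power_mult_distrib mult_ac)
    have "M ^ k1 = M ^ (d + 1) * ((M ^ (d + 1)) ^ (2 * N)) ^ (2 * N)"
      by (simp only: k1_def power_add power_mult)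
    hence "X * \<Phi> ^ (2 * N) = a1 * M ^ k1"
      by (simp only: X_def \<Phi> a1_def power_mult_distrib mult_ac)
    also have "\<dots> < 2 ^ card P"
      unfolding P(2) LM by (rule less_two_power_ceiling[OF a1 M]) (simp add: K1_def)
    finally have Pbig: "X * \<Phi> ^ (2 * N) < 2 ^ card P" .
    define A where "A = nat \<lceil>K2 * L\<rceil> + 1"
    have A1: "A \<ge> 1" by (simp add: A_def)
    \<comment> \<open>Keys are taken modulo \<open>p ^ Suc n\<close>, the auxiliary polynomials
      modulo \<open>p ^ (2 * A)\<close>; this choice makes the moduli equal.\<close>
    define n where "n = 2 * A - 1"
    have n: "Suc n = 2 * A" using A1 by (simp add: n_def)
    define Y where "Y = 2 ^ N * (real N + 1) * X"
    have "2 * Y = a2 * M ^ (d + 1)" by (simp add: Y_def X_def a2_def)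
    also have "\<dots> < 2 ^ (A - 1)"
      unfolding A_def LM diff_add_inverse2 by (rule less_two_power_ceiling[OF a2 M]) (simp add: K2_def)
    finally have Y: "2 * Y < 2 ^ (A - 1)" .
    define x y where "x t = fst (quotient_of t)" and "y t = snd (quotient_of t)" for t :: rat
    have ypos: "y t > 0" for t by (simp add: y_def quotient_of_denom_pos')
    have t_eq: "of_int (x t) / of_int (y t) = t" for t
      unfolding x_def y_def by (rule sym, rule quotient_of_div) simp
    have coeffX: "real_of_int \<bar>coeff (specP d F (x t) (y t)) i\<bar> \<le> X" if t: "t \<in> T" for t i
    proof -
      have "real_of_int \<bar>coeff (specP d F (x t) (y t)) i\<bar> \<le> (real d + 1) * K * B ^ d"
        using T[OF t] FK unfolding coeff_specP by (intro homog_bound) (auto simp: x_def y_def)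
      also have "\<dots> = (real d + 1) * (K * B ^ d)" by simp
      also have "\<dots> \<le> (real d + 1) * (M * M ^ d)"
      proof -
        have "K * 1 \<le> M" "1 * B \<le> M" unfolding M_def using K B by (intro mult_mono; simp)+
        thus ?thesis using K B by (intro mult_left_mono mult_mono power_mono) auto
      qed
      finally show ?thesis by (simp add: X_def)
    qed
    have Pnz: "homog d (lead_coeff F) (x t) (y t) \<noteq> 0" if "t \<in> T" for t
    proof
      assume "homog d (lead_coeff F) (x t) (y t) = 0"
      hence "of_int (y t) ^ d * poly (of_int_poly (lead_coeff F)) (of_int (x t) / of_int (y t) :: rat) = 0"
        using homog_rat[OF F(2), of "y t" "degree F" "x t"] ypos[of t] by simp
      thus False using ypos[of t] lead[OF that] by (simp add: t_eq)
    qed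
    have ex: "\<exists>\<kappa>\<in>key_set N F P. has_key F n (x t) (y t) (G False t) (G True t) \<kappa>" if t: "t \<in> T" for t
    proof (rule key_exists[OF F Pnz[OF t] coeffX[OF t] X1 _ P(1)])
      show "H dvd specP d F (x t) (y t) \<and> degree H > 0 \<and> content H = 1" if "H \<in> {G False t, G True t}" for H
        using that G[OF t] by (auto simp: x_def y_def)
      \<comment> \<open>The denominator is positive and at most \<open>B\<close>, hence smaller than
        every prime in \<open>P\<close>.\<close>
      show "prime p \<and> \<not> int p dvd y t" if "p \<in> P" for p
      proof -
        have "real_of_int (y t) < real p" using P(3)[OF that] T[OF t] B ypos[of t] by (simp add: y_def)
        hence "y t < int p" by linarith
        thus ?thesis using P(3)[OF that] ypos[of t] by (auto dest: zdvd_imp_le)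
      qed
    qed (use Pbig in \<open>simp add: \<Phi>_def\<close>)
    have "\<forall>t\<in>T. \<exists>\<kappa>. \<kappa> \<in> key_set N F P \<and> has_key F n (x t) (y t) (G False t) (G True t) \<kappa>"
      using ex unfolding Bex_def by blast
    from bchoice[OF this] obtain key where "\<forall>t\<in>T. key t \<in> key_set N F P \<and>
        has_key F n (x t) (y t) (G False t) (G True t) (key t)" by (rule exE)
    hence key: "\<And>t. t \<in> T \<Longrightarrow> key t \<in> key_set N F P"
      "\<And>t. t \<in> T \<Longrightarrow> has_key F n (x t) (y t) (G False t) (G True t) (key t)" by simp_all
    have L0: "L > 0" using L ln2 by linarith
    have sub: "key ` T \<subseteq> key_set N F P" using key(1) by blast
    note ks = key_set_card[OF P(1) _ F(1), of "C3 * B * L\<^sup>2"]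
    have fin: "finite (key ` T)" using finite_subset[OF sub ks(1)] P(3) by blast
    have "real (card (key ` T)) \<le> real (card (key_set N F P))"
      using card_mono[OF ks(1) sub] P(3) by simp
    \<comment> \<open>\<open>O(L)\<close> primes, at most \<open>C3 * B * L^2\<close> residues for
      each of them, and at most \<open>W\<close> pairs of key lists over each residue.\<close>
    also have "\<dots> \<le> real (card P) * (C3 * B * L\<^sup>2) * W" unfolding W_def by (rule ks(2)) (use P(3) in blast)
    also have "\<dots> \<le> (K1 + 1 / ln 2) * L * (C3 * B * L\<^sup>2) * W"
    proof -
      have "real (card P) \<le> K1 * L + 1" unfolding P(2) using mult_pos_pos[OF K1 L0] by linarith
      also have "1 \<le> L / ln 2" using L ln2 by (simp add: field_simps)
      finally have "real (card P) \<le> (K1 + 1 / ln 2) * L" by (simp add: distrib_right)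
      thus ?thesis using C3(1) B W0 L0 by (intro mult_right_mono) auto
    qed
    also have "\<dots> = ((K1 + 1 / ln 2) * C3 * W) * (B * L ^ 3)" by (simp add: power2_eq_square power3_eq_cube mult_ac)
    also have "\<dots> \<le> C * (B * L ^ 3)" using C0' B L0 by (intro mult_right_mono) (auto simp: C_def)
    finally have card: "real (card (key ` T)) \<le> C * B * L ^ 3" by (simp add: mult.assoc)
    have AC: "real A \<le> C * L"
    proof -
      have "real A \<le> K2 * L + 2" unfolding A_def using mult_pos_pos[OF K2 L0] by linarith
      also have "2 \<le> 2 * (L / ln 2)" using L ln2 by (simp add: field_simps)
      finally have "real A \<le> (K2 + 2 / ln 2) * L" by (simp add: distrib_right)
      also have "\<dots> \<le> C * L" using C0 L0 by (intro mult_right_mono) (auto simp: C_def)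
      finally show ?thesis .
    qed
    have rel: "\<exists>P0 P1 :: int poly. (P0 \<noteq> 0 \<or> P1 \<noteq> 0) \<and> degree P0 < A \<and> degree P1 < A \<and>
           (\<forall>t\<in>T. key t = \<kappa> \<longrightarrow> of_int (lead_coeff (G b t)) * poly (of_int_poly P0) t +
              of_int (coeff (G b t) j) * poly (of_int_poly P1) t = (0 :: rat))" for \<kappa> and b :: bool and j
    proof (cases "\<kappa> \<in> key_set N F P")
      case False
      hence "\<forall>t\<in>T. key t \<noteq> \<kappa>" using key(1) by blast
      thus ?thesis using A1 by (intro exI[of _ 1] exI[of _ 0]) auto
    next
      case True
      obtain p \<tau> ks0 ks1 where \<kappa>: "\<kappa> = (p, \<tau>, ks0, ks1)" by (cases \<kappa>) auto
      have p: "prime p" "4 * B < real p" using True P(3) by (auto simp: \<kappa> key_set_def)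
      define ks where "ks = (if b then ks1 else ks0)"
      obtain Q where Q: "\<And>z qs. [z = \<tau>] (mod int p) \<Longrightarrow> list_all2 (factor_key (int p) (int p ^ (2 * A)) F z) qs ks \<Longrightarrow>
         pcong (int p ^ (2 * A)) (smult (lead_coeff (prod_list qs)) (evT z Q)) (prod_list qs)"
        using factor_keys_interpolation[of "int p" "int p ^ (2 * A)" n \<tau> F ks] p(1) n by auto
      obtain P0 P1 :: "int poly" where PP: "P0 \<noteq> 0 \<or> P1 \<noteq> 0" "degree P0 < A" "degree P1 < A"
        and rel: "\<And>x y z qs. [y * z = x] (mod int p ^ (2 * A)) \<Longrightarrow> [z = \<tau>] (mod int p) \<Longrightarrow>
         \<bar>real_of_int x\<bar> \<le> B \<Longrightarrow> \<bar>real_of_int y\<bar> \<le> B \<Longrightarrow>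
         list_all2 (factor_key (int p) (int p ^ (2 * A)) F z) qs ks \<Longrightarrow>
         (\<And>i. \<bar>real_of_int (coeff (prod_list qs) i)\<bar> \<le> Y) \<Longrightarrow>
         lead_coeff (prod_list qs) * homog (A - 1) P0 x y + coeff (prod_list qs) j * homog (A - 1) P1 x y = 0"
        using key_relation[OF p A1 Y B Q] by metis
      have "of_int (lead_coeff (G b t)) * poly (of_int_poly P0) t +
              of_int (coeff (G b t) j) * poly (of_int_poly P1) t = (0 :: rat)"
        if t: "t \<in> T" "key t = \<kappa>" for t
      proof -
        have "has_key F n (x t) (y t) (G False t) (G True t) (p, \<tau>, ks0, ks1)" using key(2)[OF t(1)] t(2) \<kappa> by simp
        then obtain z qs0 qs1 where z: "[y t * z = x t] (mod int p ^ (2 * A))" "[z = \<tau>] (mod int p)"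
          and qs01: "G False t = prod_list qs0" "list_all2 (factor_key (int p) (int p ^ (2 * A)) F z) qs0 ks0"
            "G True t = prod_list qs1" "list_all2 (factor_key (int p) (int p ^ (2 * A)) F z) qs1 ks1"
          unfolding has_key_def prod.case n by (elim exE conjE) (rule that)
        define qs where "qs = (if b then qs1 else qs0)"
        have qs: "G b t = prod_list qs" "list_all2 (factor_key (int p) (int p ^ (2 * A)) F z) qs ks"
          using qs01 by (simp_all add: qs_def ks_def)
        have "coeff (specP d F (x t) (y t)) (degree F) \<noteq> 0" using Pnz[OF t(1)] by simp
        hence Ps0: "specP d F (x t) (y t) \<noteq> 0" by (metis coeff_0)
        have dPs: "degree (specP d F (x t) (y t)) \<le> N"
          unfolding specP_def by (rule le_trans[OF degree_map_poly_le F(1)])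
        have "\<bar>real_of_int (coeff (prod_list qs) i)\<bar> \<le> Y" for i
          using factor_coeff_bound[OF Ps0 _ dPs coeffX[OF t(1)], of "G b t" i] G[OF t(1), of b]
          by (simp add: Y_def x_def y_def qs(1))
        hence "lead_coeff (prod_list qs) * homog (A - 1) P0 (x t) (y t) +
            coeff (prod_list qs) j * homog (A - 1) P1 (x t) (y t) = 0"
          using T[OF t(1)] by (intro rel[OF z _ _ qs(2)]) (auto simp: x_def y_def)
        hence "of_int (lead_coeff (G b t) * homog (A - 1) P0 (x t) (y t) +
            coeff (G b t) j * homog (A - 1) P1 (x t) (y t)) = (0 :: rat)" by (simp only: qs(1) of_int_0)
        hence "of_int (y t) ^ (A - 1) * (of_int (lead_coeff (G b t)) * poly (of_int_poly P0) t +
              of_int (coeff (G b t) j) * poly (of_int_poly P1) t) = (0 :: rat)"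
          using homog_rat[of P0 "A - 1" "y t" "x t"] homog_rat[of P1 "A - 1" "y t" "x t"] PP(2,3) ypos[of t]
          by (simp add: t_eq algebra_simps)
        thus ?thesis using ypos[of t] by simp
      qed
      thus ?thesis using PP by blast
    qed
    show "\<exists>key A. finite (key ` T) \<and> real (card (key ` T)) \<le> C * B * (ln K + ln B) ^ 3 \<and>
         A \<ge> 1 \<and> real A \<le> C * (ln K + ln B) \<and>
         (\<forall>\<kappa> (b :: bool) j. \<exists>P0 P1 :: int poly. (P0 \<noteq> 0 \<or> P1 \<noteq> 0) \<and> degree P0 < A \<and> degree P1 < A \<and>
           (\<forall>t\<in>T. (key t :: nat \<times> int \<times> (int poly \<times> nat) list \<times> (int poly \<times> nat) list) = \<kappa> \<longrightarrow>
              of_int (lead_coeff (G b t)) * poly (of_int_poly P0) t +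
              of_int (coeff (G b t) j) * poly (of_int_poly P1) t = (0 :: rat)))"
      using fin card A1 AC rel unfolding L_def by (intro exI[of _ key] exI[of _ A] conjI allI)
  qed
qed

section \<open>Algebra of multivariate polynomials up to the lemma of Gauss\<close>

section \<open>Homomorphisms of polynomials represented by finitely supported functions\<close>

abbreviation "pkeys \<equiv> Poly_Mapping.keys"
abbreviation "plookup \<equiv> Poly_Mapping.lookup"
abbreviation "psingle \<equiv> Poly_Mapping.single"

lemma pm_sum_singles: "p = (\<Sum>m\<in>pkeys p. psingle m (plookup p m))"
proof (rule poly_mapping_eqI)
  fix k
  have "plookup (\<Sum>m\<in>pkeys p. psingle m (plookup p m)) k = (\<Sum>m\<in>pkeys p. if m = k then plookup p m else 0)"
    by (simp add: lookup_sum lookup_single when_def)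
  also have "\<dots> = plookup p k" by (simp add: in_keys_iff)
  finally show "plookup p k = plookup (\<Sum>m\<in>pkeys p. psingle m (plookup p m)) k" ..
qed

definition pm_restrict :: "'m set \<Rightarrow> ('m \<Rightarrow>\<^sub>0 'a) \<Rightarrow> ('m \<Rightarrow>\<^sub>0 'a :: comm_monoid_add)" where
  "pm_restrict S p = (\<Sum>m\<in>pkeys p \<inter> S. psingle m (plookup p m))"

lemma lookup_pm_restrict: "plookup (pm_restrict S p) k = (if k \<in> S then plookup p k else 0)"
proof -
  have "plookup (pm_restrict S p) k = (\<Sum>m\<in>pkeys p \<inter> S. if m = k then plookup p m else 0)"
    by (simp add: pm_restrict_def lookup_sum lookup_single when_def)
  also have "\<dots> = (if k \<in> S then plookup p k else 0)" by (simp add: in_keys_iff)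
  finally show ?thesis .
qed

lemma keys_pm_restrict: "pkeys (pm_restrict S p) = pkeys p \<inter> S"
  by (auto simp: in_keys_iff lookup_pm_restrict split: if_splits)

lemma pm_restrict_split: "p = pm_restrict S p + pm_restrict (- S) p"
  by (rule poly_mapping_eqI) (simp add: lookup_add lookup_pm_restrict)

locale pm_hom =
  fixes \<phi> :: "'a :: comm_semiring_1 \<Rightarrow> 'c :: comm_semiring_1" and \<chi> :: "'m :: comm_monoid_add \<Rightarrow> 'c"
  assumes phi_0 [simp]: "\<phi> 0 = 0" and phi_1 [simp]: "\<phi> 1 = 1"
    and phi_add: "\<phi> (a + b) = \<phi> a + \<phi> b" and phi_mult: "\<phi> (a * b) = \<phi> a * \<phi> b"
    and chi_0 [simp]: "\<chi> 0 = 1" and chi_add: "\<chi> (m + n) = \<chi> m * \<chi> n"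
begin

definition ev :: "('m \<Rightarrow>\<^sub>0 'a) \<Rightarrow> 'c" where
  "ev p = (\<Sum>m\<in>pkeys p. \<phi> (plookup p m) * \<chi> m)"

lemma ev_superset: "finite A \<Longrightarrow> pkeys p \<subseteq> A \<Longrightarrow> ev p = (\<Sum>m\<in>A. \<phi> (plookup p m) * \<chi> m)"
  unfolding ev_def by (rule sum.mono_neutral_left) (auto simp: in_keys_iff)

lemma ev_0 [simp]: "ev 0 = 0"
  by (simp add: ev_def)

lemma ev_single [simp]: "ev (psingle m c) = \<phi> c * \<chi> m"
  by (subst ev_superset[of "{m}"]) (auto simp: lookup_single)

lemma ev_1 [simp]: "ev 1 = 1"
  using ev_single[of 0 1] by simp

lemma ev_add: "ev (p + q) = ev p + ev q"
proof -
  have "ev (p + q) = (\<Sum>m\<in>pkeys p \<union> pkeys q. \<phi> (plookup (p + q) m) * \<chi> m)"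
    by (rule ev_superset) (use keys_add[of p q] in auto)
  also have "\<dots> = ev p + ev q"
    by (subst (1 2) ev_superset[of "pkeys p \<union> pkeys q"])
       (auto simp: lookup_add phi_add distrib_right sum.distrib)
  finally show ?thesis .
qed

lemma ev_sum: "ev (sum f A) = (\<Sum>i\<in>A. ev (f i))"
  by (induction A rule: infinite_finite_induct) (simp_all add: ev_add)

lemma ev_mult: "ev (p * q) = ev p * ev q"
proof -
  have "p * q = (\<Sum>m\<in>pkeys p. \<Sum>n\<in>pkeys q. psingle (m + n) (plookup p m * plookup q n))"
    by (subst pm_sum_singles[of p], subst pm_sum_singles[of q])
       (simp only: sum_product mult_single)
  hence "ev (p * q) = (\<Sum>m\<in>pkeys p. \<Sum>n\<in>pkeys q. (\<phi> (plookup p m) * \<chi> m) * (\<phi> (plookup q n) * \<chi> n))"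
    by (simp add: ev_sum phi_mult chi_add mult_ac)
  thus ?thesis by (simp add: ev_def sum_product)
qed

end

section \<open>Leading and trailing parts of products\<close>

lemma keys_mult_sub: "k \<in> pkeys (p * q) \<Longrightarrow> \<exists>m\<in>pkeys p. \<exists>n\<in>pkeys q. k = m + n"
  using keys_mult[of p q] by blast

text \<open>The parts of \<open>p\<close> and \<open>q\<close> on which \<open>l\<close> takes its
  maxima \<open>a\<close> and \<open>c\<close> have a nonzero product, as there are no zero
  divisors. Its monomials have value \<open>a + c\<close>, which the other products of terms do not
  reach, so nothing cancels and \<open>a \<le> a + c \<le> b\<close>. With \<open>l\<close> the
  exponent of one variable this controls the variables and degrees of factors.\<close>

lemma degree_functional_factor:
  fixes p q :: "('m :: {ordered_cancel_comm_monoid_add, linorder}) \<Rightarrow>\<^sub>0 ('a :: idom)" and l :: "'m \<Rightarrow> nat"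
  assumes l: "\<And>m n. l (m + n) = l m + l n" and pq: "p * q \<noteq> 0"
    and bound: "\<And>k. k \<in> pkeys (p * q) \<Longrightarrow> l k \<le> b" and m: "m \<in> pkeys p"
  shows "l m \<le> b"
proof -
  have nz: "p \<noteq> 0" "q \<noteq> 0" using pq by auto
  define a c where "a = Max (l ` pkeys p)" and "c = Max (l ` pkeys q)"
  have ne: "pkeys p \<noteq> {}" "pkeys q \<noteq> {}" using nz by auto
  have la: "l k \<le> a" if "k \<in> pkeys p" for k unfolding a_def using that by (intro Max_ge) auto
  have lc: "l k \<le> c" if "k \<in> pkeys q" for k unfolding c_def using that by (intro Max_ge) auto
  have "a \<in> l ` pkeys p" "c \<in> l ` pkeys q" unfolding a_def c_def using ne by (auto intro!: Max_in)
  define A A' B B' where "A = pm_restrict {k. l k = a} p" and "A' = pm_restrict (- {k. l k = a}) p"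
    and "B = pm_restrict {k. l k = c} q" and "B' = pm_restrict (- {k. l k = c}) q"
  have split: "p = A + A'" "q = B + B'" unfolding A_def A'_def B_def B'_def by (rule pm_restrict_split)+
  have "A \<noteq> 0" using \<open>a \<in> l ` pkeys p\<close> keys_pm_restrict[of "{k. l k = a}" p] by (auto simp: A_def)
  moreover have "B \<noteq> 0" using \<open>c \<in> l ` pkeys q\<close> keys_pm_restrict[of "{k. l k = c}" q] by (auto simp: B_def)
  ultimately have "A * B \<noteq> 0" by simp
  then obtain k where k: "k \<in> pkeys (A * B)" by fastforce
  have lk: "l k = a + c"
    using keys_mult_sub[OF k] by (auto simp: A_def B_def keys_pm_restrict l)
  have A'l: "l j < a" if "j \<in> pkeys A'" for j
    using that la[of j] by (auto simp: A'_def keys_pm_restrict)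
  have B'l: "l j < c" if "j \<in> pkeys B'" for j
    using that lc[of j] by (auto simp: B'_def keys_pm_restrict)
  have Al: "l j = a" if "j \<in> pkeys A" for j using that by (auto simp: A_def keys_pm_restrict)
  have "k \<notin> pkeys (A * B')" using keys_mult_sub[of k A B'] lk Al B'l by (fastforce simp: l)
  moreover have "k \<notin> pkeys (A' * q)" using keys_mult_sub[of k A' q] lk A'l lc by (fastforce simp: l)
  moreover have "p * q = A * B + A * B' + A' * q"
  proof -
    have "p * q = A * q + A' * q" by (subst split(1)) (rule distrib_right)
    also have "A * q = A * B + A * B'" by (subst split(2)) (rule distrib_left)
    finally show ?thesis .
  qed
  ultimately have "plookup (p * q) k = plookup (A * B) k" by (simp add: lookup_add in_keys_iff)
  hence "k \<in> pkeys (p * q)" using k by (simp add: in_keys_iff)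
  from bound[OF this] lk la[OF m] show ?thesis by simp
qed

text \<open>In an ordered cancellative monoid no other pair of monomials of \<open>p\<close> and
  \<open>q\<close> has the same sum as the two least ones, so nothing else contributes to this
  coefficient.\<close>

lemma lookup_mult_least:
  fixes p q :: "('m :: {ordered_cancel_comm_monoid_add, linorder}) \<Rightarrow>\<^sub>0 ('a :: idom)"
  assumes "p \<noteq> 0" "q \<noteq> 0"
  shows "plookup (p * q) (Min (pkeys p) + Min (pkeys q)) = plookup p (Min (pkeys p)) * plookup q (Min (pkeys q))"
proof -
  define a c where "a = Min (pkeys p)" and "c = Min (pkeys q)"
  have ne: "pkeys p \<noteq> {}" "pkeys q \<noteq> {}" using assms by auto
  have la: "a \<le> k" if "k \<in> pkeys p" for k unfolding a_def using that by (intro Min_le) auto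
  have lc: "c \<le> k" if "k \<in> pkeys q" for k unfolding c_def using that by (intro Min_le) auto
  define A' B' where "A' = pm_restrict (- {a}) p" and "B' = pm_restrict (- {c}) q"
  have "pm_restrict {a} p = psingle a (plookup p a)" "pm_restrict {c} q = psingle c (plookup q c)"
    by (auto intro!: poly_mapping_eqI simp: lookup_pm_restrict lookup_single when_def)
  hence split: "p = psingle a (plookup p a) + A'" "q = psingle c (plookup q c) + B'"
    unfolding A'_def B'_def using pm_restrict_split[of p "{a}"] pm_restrict_split[of q "{c}"] by simp_all
  have A'l: "a < j" if "j \<in> pkeys A'" for j
    using that la[of j] by (auto simp: A'_def keys_pm_restrict)
  have B'l: "c < j" if "j \<in> pkeys B'" for j
    using that lc[of j] by (auto simp: B'_def keys_pm_restrict)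
  have 1: "a + c \<notin> pkeys (psingle a (plookup p a) * B')"
  proof
    assume "a + c \<in> pkeys (psingle a (plookup p a) * B')"
    then obtain m n where "m \<in> pkeys (psingle a (plookup p a))" "n \<in> pkeys B'" "a + c = m + n"
      using keys_mult_sub by blast
    thus False using B'l by (auto split: if_splits)
  qed
  have 2: "a + c \<notin> pkeys (A' * q)"
  proof
    assume "a + c \<in> pkeys (A' * q)"
    then obtain m n where "m \<in> pkeys A'" "n \<in> pkeys q" "a + c = m + n"
      using keys_mult_sub by blast
    thus False using A'l[of m] lc[of n] add_less_le_mono[of a m c n] by simp
  qed
  have "p * q = psingle (a + c) (plookup p a * plookup q c) + psingle a (plookup p a) * B' + A' * q"
  proof -
    have "p * q = psingle a (plookup p a) * q + A' * q" by (subst split(1)) (simp add: distrib_right)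
    also have "psingle a (plookup p a) * q = psingle a (plookup p a) * psingle c (plookup q c) + psingle a (plookup p a) * B'"
      by (subst (1) split(2)) (simp add: distrib_left)
    finally show ?thesis by (simp add: mult_single)
  qed
  thus ?thesis using 1 2 unfolding a_def[symmetric] c_def[symmetric] by (simp add: lookup_add in_keys_iff)
qed

section \<open>The lemma of Gauss\<close>

lemma lookup_scale: "plookup (psingle 0 c * p) k = c * plookup (p :: 'm :: {ordered_cancel_comm_monoid_add, linorder} \<Rightarrow>\<^sub>0 'a :: idom) k"
proof -
  have "psingle 0 c * p = (\<Sum>m\<in>pkeys p. psingle m (c * plookup p m))"
    by (subst pm_sum_singles[of p]) (simp add: sum_distrib_left mult_single)
  hence "plookup (psingle 0 c * p) k = (\<Sum>m\<in>pkeys p. if m = k then c * plookup p m else 0)"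
    by (simp add: lookup_sum lookup_single when_def)
  also have "\<dots> = c * plookup p k" by (simp add: in_keys_iff)
  finally show ?thesis .
qed

lemma keys_scale: "c \<noteq> 0 \<Longrightarrow> pkeys (psingle 0 c * p) = pkeys (p :: 'm :: {ordered_cancel_comm_monoid_add, linorder} \<Rightarrow>\<^sub>0 'a :: idom)"
  by (auto simp: in_keys_iff lookup_scale)

lemma scale_decompose:
  fixes p :: "('m :: {ordered_cancel_comm_monoid_add, linorder}) \<Rightarrow>\<^sub>0 ('a :: idom)"
  assumes "\<And>k. c dvd plookup p k"
  obtains p' where "p = psingle 0 c * p'"
proof -
  obtain h where h: "\<And>k. plookup p k = c * h k" using assms unfolding dvd_def by metis
  have "p = psingle 0 c * (\<Sum>m\<in>pkeys p. psingle m (h m))"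
    by (subst pm_sum_singles[of p]) (simp add: sum_distrib_left mult_single h)
  thus ?thesis by (rule that)
qed

text \<open>Drop from \<open>P\<close> and \<open>Q\<close> the terms whose coefficients are
  divisible by \<open>c\<close>. If something is left of both, the least coefficient of the product
  of what is left is a product of two elements that the prime \<open>c\<close> does not divide; yet
  it agrees modulo \<open>c\<close> with a coefficient of \<open>P * Q\<close>.\<close>

lemma prime_dvd_product_coeffs:
  fixes P Q :: "('m :: {ordered_cancel_comm_monoid_add, linorder}) \<Rightarrow>\<^sub>0 ('a :: idom)"
  assumes c: "prime_elem c" and PQ: "\<And>k. c dvd plookup (P * Q) k"
  shows "(\<forall>k. c dvd plookup P k) \<or> (\<forall>k. c dvd plookup Q k)"
proof (rule ccontr)
  assume neg: "\<not> ?thesis"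
  define S where "S R = {k. \<not> c dvd plookup R k}" for R :: "'m \<Rightarrow>\<^sub>0 'a"
  define A where "A R = pm_restrict (S R) R" for R
  have "\<exists>R'. pm_restrict (- S R) R = psingle 0 c * R'" for R
    by (rule scale_decompose[of c "pm_restrict (- S R) R"]) (auto simp: lookup_pm_restrict S_def)
  then obtain A' where A': "\<And>R. pm_restrict (- S R) R = psingle 0 c * A' R" by metis
  have split: "R = A R + psingle 0 c * A' R" for R
    using pm_restrict_split[of R "S R"] by (simp add: A_def A')
  have nz: "A P \<noteq> 0" "A Q \<noteq> 0"
  proof -
    have "A R \<noteq> 0" if nd: "\<exists>k. \<not> c dvd plookup R k" for R
    proof -
      obtain k where k: "\<not> c dvd plookup R k" using nd by blast
      hence "plookup (A R) k \<noteq> 0" by (auto simp: A_def lookup_pm_restrict S_def)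
      thus ?thesis by auto
    qed
    thus "A P \<noteq> 0" "A Q \<noteq> 0" using neg by blast+
  qed
  have eq: "P * Q = A P * A Q + psingle 0 c * (A P * A' Q + A' P * Q)"
  proof -
    have "P * Q = A P * Q + psingle 0 c * A' P * Q" by (subst split[of P]) (simp add: distrib_right)
    also have "A P * Q = A P * A Q + A P * (psingle 0 c * A' Q)" by (subst split[of Q]) (simp add: distrib_left)
    finally show ?thesis by (simp add: algebra_simps)
  qed
  define k where "k = Min (pkeys (A P)) + Min (pkeys (A Q))"
  have "c dvd plookup (A P * A Q) k"
  proof -
    have "plookup (P * Q) k = plookup (A P * A Q) k + c * plookup (A P * A' Q + A' P * Q) k"
      by (subst eq) (simp only: lookup_add lookup_scale)
    thus ?thesis using PQ[of k] by (simp add: dvd_add_left_iff)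
  qed
  hence "c dvd plookup (A P) (Min (pkeys (A P))) * plookup (A Q) (Min (pkeys (A Q)))"
    unfolding k_def lookup_mult_least[OF nz] .
  hence "c dvd plookup (A P) (Min (pkeys (A P))) \<or> c dvd plookup (A Q) (Min (pkeys (A Q)))"
    using c by (simp add: prime_elem_dvd_mult_iff)
  moreover have "\<not> c dvd plookup (A R) (Min (pkeys (A R)))" if "A R \<noteq> 0" for R
  proof -
    have "Min (pkeys (A R)) \<in> pkeys (A R)" using that by (intro Min_in) auto
    thus ?thesis by (simp add: A_def keys_pm_restrict S_def lookup_pm_restrict)
  qed
  ultimately show False using nz by blast
qed

text \<open>Prime factors of \<open>c\<close> are cancelled one at a time, as each divides all
  coefficients of \<open>G\<close> or all of \<open>H\<close>. Cancelling preserves the sets of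
  monomials, by which it is later decided whether a factor is constant.\<close>

lemma Gauss_factorization:
  fixes F G H :: "('m :: {ordered_cancel_comm_monoid_add, linorder}) \<Rightarrow>\<^sub>0 rat poly"
  assumes "c \<noteq> 0" "psingle 0 c * F = G * H"
  shows "\<exists>G' H'. F = G' * H' \<and> pkeys G' = pkeys G \<and> pkeys H' = pkeys H"
  using assms
proof (induction "degree c" arbitrary: c G H rule: less_induct)
  case less
  show ?case
  proof (cases "degree c = 0")
    case True
    then obtain c0 where c0: "c = [:c0:]" by (elim degree_eq_zeroE)
    have "c0 \<noteq> 0" using less.prems(1) c0 by auto
    hence inv: "psingle 0 [:1 / c0:] * psingle 0 c = (1 :: 'm \<Rightarrow>\<^sub>0 rat poly)"
      by (simp add: mult_single c0)
    have "F = (psingle 0 [:1 / c0:] * psingle 0 c) * F" unfolding inv by simp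
    also have "\<dots> = psingle 0 [:1 / c0:] * (G * H)" unfolding mult.assoc less.prems(2) ..
    finally have "F = (psingle 0 [:1 / c0:] * G) * H" by (simp only: mult.assoc)
    moreover have "pkeys (psingle 0 [:1 / c0:] * G) = pkeys G" using \<open>c0 \<noteq> 0\<close> by (intro keys_scale) auto
    ultimately show ?thesis by blast
  next
    case False
    hence "\<not> is_unit c" using less.prems(1) by (auto simp: is_unit_iff_degree)
    then obtain \<pi> where \<pi>: "prime_elem \<pi>" "\<pi> dvd c"
      using prime_divisor_exists[of c] less.prems(1) prime_imp_prime_elem by blast
    obtain c' where c': "c = \<pi> * c'" using \<pi>(2) by (elim dvdE)
    have nz: "\<pi> \<noteq> 0" "c' \<noteq> 0" using less.prems(1) c' by auto
    have "degree \<pi> \<noteq> 0" using \<pi>(1) nz by (auto simp: prime_elem_def is_unit_iff_degree)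
    hence dc: "degree c' < degree c" using nz by (simp add: c' degree_mult_eq)
    have sc: "psingle 0 c = psingle 0 \<pi> * (psingle 0 c' :: 'm \<Rightarrow>\<^sub>0 rat poly)" by (simp add: c' mult_single)
    have p0: "psingle 0 \<pi> \<noteq> (0 :: 'm \<Rightarrow>\<^sub>0 rat poly)" using nz by (simp flip: keys_eq_empty)
    have "\<pi> dvd plookup (G * H) k" for k
      unfolding less.prems(2)[symmetric] lookup_scale c' by simp
    from prime_dvd_product_coeffs[OF \<pi>(1) this] show ?thesis
    proof
      assume "\<forall>k. \<pi> dvd plookup G k"
      then obtain G1 where G1: "G = psingle 0 \<pi> * G1" using scale_decompose by metis
      have "psingle 0 \<pi> * (psingle 0 c' * F) = psingle 0 c * F" unfolding sc mult.assoc ..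
      also have "\<dots> = G * H" by (rule less.prems(2))
      also have "\<dots> = psingle 0 \<pi> * G1 * H" by (rule arg_cong[OF G1])
      also have "\<dots> = psingle 0 \<pi> * (G1 * H)" by (rule mult.assoc)
      finally have "psingle 0 c' * F = G1 * H" unfolding mult_left_cancel[OF p0] .
      from less.hyps[OF dc nz(2) this] show ?thesis by (simp add: G1 keys_scale[OF nz(1)])
    next
      assume "\<forall>k. \<pi> dvd plookup H k"
      then obtain H1 where H1: "H = psingle 0 \<pi> * H1" using scale_decompose by metis
      have "psingle 0 \<pi> * (psingle 0 c' * F) = psingle 0 c * F" unfolding sc mult.assoc ..
      also have "\<dots> = G * H" by (rule less.prems(2))
      also have "\<dots> = G * (psingle 0 \<pi> * H1)" by (rule arg_cong[OF H1])
      also have "\<dots> = psingle 0 \<pi> * (G * H1)" by (rule mult.left_commute)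
      finally have "psingle 0 c' * F = G * H1" unfolding mult_left_cancel[OF p0] .
      from less.hyps[OF dc nz(2) this] show ?thesis by (simp add: H1 keys_scale[OF nz(1)])
    qed
  qed
qed

section \<open>The count for a single parameter\<close>

section \<open>Specialisation of one variable\<close>

type_synonym mon = "nat \<Rightarrow>\<^sub>0 nat"

text \<open>Nonconstancy is read off from monomials rather than from units, so that it can be
  followed through specialisations, scalings and renamings. Over a domain the zero polynomial does
  not split, in accordance with the specialisations that are counted.\<close>

definition splits :: "('m :: monoid_add \<Rightarrow>\<^sub>0 'a :: semiring_1) \<Rightarrow> bool" where
  "splits p \<longleftrightarrow> (\<exists>g h. p = g * h \<and> \<not> pkeys g \<subseteq> {0} \<and> \<not> pkeys h \<subseteq> {0})"

interpretation evalT: pm_hom "\<lambda>c :: rat poly. psingle (0 :: mon) (poly c t)" "\<lambda>m :: mon. psingle m (1 :: rat)"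
  for t :: rat
  by unfold_locales (simp_all add: single_add mult_single)

abbreviation "evalT \<equiv> evalT.ev"

lemma lookup_evalT [simp]: "plookup (evalT t F) m = poly (plookup F m) t"
proof -
  have "plookup (evalT t F) m = (\<Sum>k\<in>pkeys F. if k = m then poly (plookup F k) t else 0)"
    by (simp add: evalT.ev_def lookup_sum mult_single lookup_single when_def)
  also have "\<dots> = poly (plookup F m) t" by (simp add: in_keys_iff)
  finally show ?thesis .
qed

lemma single_0_mult: "psingle (0 :: 'm :: comm_monoid_add) (a * b :: 'a :: comm_semiring_1) = psingle 0 a * psingle 0 b"
  by (simp add: mult_single)

lemma keys_evalT: "pkeys (evalT t F) \<subseteq> pkeys F"
  by (auto simp: in_keys_iff)

lemma degree_lookup_mult:
  fixes X Y :: "mon \<Rightarrow>\<^sub>0 rat poly"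
  assumes "\<And>k. degree (plookup X k) \<le> a" "\<And>k. degree (plookup Y k) \<le> b"
  shows "degree (plookup (X * Y) k) \<le> a + b"
proof -
  have "X * Y = (\<Sum>m\<in>pkeys X. \<Sum>n\<in>pkeys Y. psingle (m + n) (plookup X m * plookup Y n))"
    by (subst (1) pm_sum_singles[of X], subst (1) pm_sum_singles[of Y]) (simp only: sum_product mult_single)
  hence eq: "plookup (X * Y) k = (\<Sum>m\<in>pkeys X. \<Sum>n\<in>pkeys Y. plookup (psingle (m + n) (plookup X m * plookup Y n)) k)"
    by (simp only: lookup_sum)
  have "degree (plookup (psingle (m + n) (plookup X m * plookup Y n)) k) \<le> a + b" for m n
  proof -
    have "degree (plookup X m * plookup Y n) \<le> a + b"
      using degree_mult_le[of "plookup X m" "plookup Y n"] assms(1)[of m] assms(2)[of n] by linarith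
    thus ?thesis by (simp add: lookup_single when_def)
  qed
  thus ?thesis unfolding eq by (intro degree_sum_le) auto
qed

text \<open>If the coefficients of both factors are rational functions of small degree on too many points,
  then they define a factorisation over the field of rational functions.\<close>

lemma class_bound:
  fixes F :: "mon \<Rightarrow>\<^sub>0 rat poly" and M :: "mon set" and TC :: "rat set"
    and g :: "bool \<Rightarrow> rat \<Rightarrow> mon \<Rightarrow>\<^sub>0 rat" and l :: "bool \<Rightarrow> rat \<Rightarrow> rat" and P0 P1 :: "bool \<Rightarrow> mon \<Rightarrow> rat poly"
  assumes nosplit: "\<And>G H. F = G * H \<Longrightarrow> pkeys G \<subseteq> M \<Longrightarrow> pkeys H \<subseteq> M \<Longrightarrow> pkeys G \<subseteq> {0} \<or> pkeys H \<subseteq> {0}"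
    and fin: "finite M" "finite TC"
    and deg: "degree a \<le> d" "\<And>k. degree (plookup F k) \<le> d"
    and g: "\<And>t. t \<in> TC \<Longrightarrow> evalT t F = g False t * g True t"
      "\<And>b t. t \<in> TC \<Longrightarrow> pkeys (g b t) \<subseteq> M \<and> \<not> pkeys (g b t) \<subseteq> {0}"
    and l: "\<And>b t. t \<in> TC \<Longrightarrow> l b t \<noteq> 0" "\<And>t. t \<in> TC \<Longrightarrow> l False t * l True t = poly a t"
    and P: "\<And>b m. m \<in> M \<Longrightarrow> (P0 b m \<noteq> 0 \<or> P1 b m \<noteq> 0) \<and> degree (P0 b m) \<le> A \<and> degree (P1 b m) \<le> A"
      "\<And>b m t. m \<in> M \<Longrightarrow> t \<in> TC \<Longrightarrow> l b t * poly (P0 b m) t + plookup (g b t) m * poly (P1 b m) t = 0"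
  shows "card TC \<le> d + 2 * (A + 2 * card M * A)"
proof (rule ccontr)
  assume "\<not> ?thesis"
  hence big: "card TC > d + 2 * (A + 2 * card M * A)" by simp
  have vanish: "p = 0" if "\<And>t. t \<in> TC \<Longrightarrow> poly p t = 0" "degree p < card TC" for p :: "rat poly"
  proof (rule ccontr)
    assume p: "p \<noteq> 0"
    have "card TC \<le> card {t. poly p t = 0}"
      using that(1) by (intro card_mono poly_roots_finite p) auto
    also have "\<dots> \<le> degree p" using card_poly_roots_bound[OF p] .
    finally show False using that(2) by simp
  qed
  \<comment> \<open>Were \<open>P1\<close> zero, \<open>P0\<close> would vanish on the whole class,
    because \<open>l\<close> has no zeros there, and would then be zero by its degree; but they are
    not both zero.\<close>
  have P1: "P1 b m \<noteq> 0" if m: "m \<in> M" for b m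
  proof
    assume z: "P1 b m = 0"
    have "P0 b m = 0"
    proof (rule vanish)
      show "poly (P0 b m) t = 0" if "t \<in> TC" for t using P(2)[OF m that, of b] l(1)[OF that, of b] z by simp
      have "degree (P0 b m) \<le> A" using P(1)[OF m, of b] by blast
      also have "A \<le> d + 2 * (A + 2 * card M * A)" by (simp add: algebra_simps)
      finally show "degree (P0 b m) < card TC" using big by (rule le_less_trans)
    qed
    with P(1)[OF m, of b] z show False by simp
  qed
  define I where "I = (UNIV :: bool set) \<times> M"
  have finI: "finite I" and cardI: "card I = 2 * card M" using fin by (auto simp: I_def card_cartesian_product)
  define q where "q i = P1 (fst i) (snd i)" for i
  \<comment> \<open>Where \<open>P1\<close> does not vanish, coefficient \<open>m\<close> of factor
    \<open>b\<close> divided by \<open>l b t\<close> equals \<open>- P0 / P1\<close>.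
    \<open>\<Omega>\<close> is a common denominator of all these fractions, \<open>R\<close> gives
    the cofactor of each denominator in it, and \<open>Gf b\<close> below is the numerator of the
    interpolated factor.\<close>
  define \<Omega> where "\<Omega> = (\<Prod>i\<in>I. q i)"
  define R where "R i = (\<Prod>j\<in>I - {i}. q j)" for i
  have \<Omega>R: "\<Omega> = q i * R i" if "i \<in> I" for i unfolding \<Omega>_def R_def by (rule prod.remove[OF finI that])
  have \<Omega>0: "\<Omega> \<noteq> 0" using finI P1 by (auto simp: \<Omega>_def I_def q_def)
  have degprod: "degree (\<Prod>i\<in>J. q i) \<le> 2 * card M * A" if "J \<subseteq> I" for J
  proof -
    have "degree (\<Prod>i\<in>J. q i) \<le> (\<Sum>i\<in>J. degree (q i))"
      using degree_prod_sum_le[of J q] finite_subset[OF that finI] by (simp add: o_def)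
    also have "\<dots> \<le> (\<Sum>i\<in>J. A)" by (rule sum_mono) (use P(1) that in \<open>auto simp: q_def I_def\<close>)
    also have "\<dots> = card J * A" by simp
    also have "\<dots> \<le> card I * A" using that finI by (intro mult_right_mono card_mono) auto
    finally show ?thesis by (simp add: cardI)
  qed
  define Gf where "Gf b = (\<Sum>m\<in>M. psingle m (- (P0 b m * R (b, m))))" for b
  have lGf: "plookup (Gf b) m = (if m \<in> M then - (P0 b m * R (b, m)) else 0)" for b m
  proof -
    have "plookup (Gf b) m = (\<Sum>k\<in>M. if k = m then - (P0 b k * R (b, k)) else 0)"
      by (simp add: Gf_def lookup_sum lookup_single when_def)
    thus ?thesis using fin by simp
  qed
  have dGf: "degree (plookup (Gf b) k) \<le> A + 2 * card M * A" for b k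
  proof (cases "k \<in> M")
    case True
    have "degree (R (b, k)) \<le> 2 * card M * A" unfolding R_def by (rule degprod) auto
    moreover have "degree (P0 b k) \<le> A" using P(1)[OF True] by blast
    ultimately show ?thesis using True degree_mult_le[of "P0 b k" "R (b, k)"] by (simp add: lGf)
  qed (simp add: lGf)
  have scaled: "psingle 0 (l b t) * evalT t (Gf b) = psingle 0 (poly \<Omega> t) * g b t" if t: "t \<in> TC" for b t
  proof (rule poly_mapping_eqI)
    fix m
    show "plookup (psingle 0 (l b t) * evalT t (Gf b)) m = plookup (psingle 0 (poly \<Omega> t) * g b t) m"
    proof (cases "m \<in> M")
      case True
      have "(b, m) \<in> I" using True by (simp add: I_def)
      hence \<Omega>t: "poly \<Omega> t = poly (P1 b m) t * poly (R (b, m)) t" by (subst \<Omega>R) (auto simp: q_def)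
      have "l b t * poly (P0 b m) t = - (plookup (g b t) m * poly (P1 b m) t)"
        using P(2)[OF True t, of b] by (simp add: eq_neg_iff_add_eq_0)
      hence "l b t * (- poly (P0 b m) t * poly (R (b, m)) t) = poly \<Omega> t * plookup (g b t) m"
        unfolding \<Omega>t by (simp add: mult.assoc[symmetric])
      thus ?thesis using True by (simp add: lookup_scale lGf)
    next
      case False
      hence "plookup (g b t) m = 0" using g(2)[OF t, of b] by (meson in_keys_iff subsetD)
      thus ?thesis using False by (simp add: lookup_scale lGf)
    qed
  qed
  \<comment> \<open>Dividing by \<open>\<Omega>^2\<close> would turn \<open>E = 0\<close> into a
    factorisation of \<open>F\<close> over the rational functions. Both terms of \<open>E\<close>
    agree at all points of the class, and their coefficients have degree below the number of
    points.\<close>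
  define E where "E = psingle 0 a * (Gf False * Gf True) - psingle 0 (\<Omega>\<^sup>2) * F"
  have Eroot: "evalT t (psingle 0 a * (Gf False * Gf True)) = evalT t (psingle 0 (\<Omega>\<^sup>2) * F)" if t: "t \<in> TC" for t
  proof -
    have "evalT t (psingle 0 a * (Gf False * Gf True)) = psingle 0 (poly a t) * (evalT t (Gf False) * evalT t (Gf True))"
      by (simp add: evalT.ev_mult)
    also have "\<dots> = (psingle 0 (l False t) * evalT t (Gf False)) * (psingle 0 (l True t) * evalT t (Gf True))"
      unfolding l(2)[OF t, symmetric] by (simp only: single_0_mult mult_ac)
    also have "\<dots> = psingle 0 (poly \<Omega> t * poly \<Omega> t) * (g False t * g True t)"
      unfolding scaled[OF t] by (simp only: single_0_mult mult_ac)
    also have "\<dots> = evalT t (psingle 0 (\<Omega>\<^sup>2) * F)"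
      unfolding g(1)[OF t, symmetric] by (simp add: evalT.ev_mult power2_eq_square)
    finally show ?thesis .
  qed
  have "E = 0"
  proof (rule poly_mapping_eqI)
    fix k
    have "plookup E k = 0"
    proof (rule vanish)
      show "poly (plookup E k) t = 0" if t: "t \<in> TC" for t
        using arg_cong[OF Eroot[OF t], of "\<lambda>p. plookup p k"] by (simp add: E_def lookup_minus)
      have "degree (plookup (Gf False * Gf True) k) \<le> (A + 2 * card M * A) + (A + 2 * card M * A)"
        by (rule degree_lookup_mult[OF dGf dGf])
      hence "degree (plookup (psingle 0 a * (Gf False * Gf True)) k) \<le> d + 2 * (A + 2 * card M * A)"
        using deg(1) degree_mult_le[of a "plookup (Gf False * Gf True) k"]
        unfolding lookup_scale by (simp add: algebra_simps)
      moreover have "degree (plookup (psingle 0 (\<Omega>\<^sup>2) * F) k) \<le> d + 2 * (A + 2 * card M * A)"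
      proof -
        have "degree (\<Omega>\<^sup>2) \<le> 2 * (2 * card M * A)"
          using degree_power_le[of \<Omega> 2] degprod[of I] by (simp add: \<Omega>_def)
        thus ?thesis using deg(2)[of k] degree_mult_le[of "\<Omega>\<^sup>2" "plookup F k"]
          unfolding lookup_scale by (simp add: algebra_simps)
      qed
      ultimately have "degree (plookup E k) \<le> d + 2 * (A + 2 * card M * A)"
        unfolding E_def lookup_minus by (rule degree_diff_le)
      thus "degree (plookup E k) < card TC" using big by simp
    qed
    thus "plookup E k = plookup 0 k" by simp
  qed
  hence eq: "psingle 0 (\<Omega>\<^sup>2) * F = (psingle 0 a * Gf False) * Gf True" by (simp add: E_def mult.assoc)
  have "TC \<noteq> {}" using big by auto
  then obtain t0 where t0: "t0 \<in> TC" by blast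
  have a0: "a \<noteq> 0"
  proof
    assume "a = 0"
    thus False using l(1)[OF t0, of False] l(1)[OF t0, of True] l(2)[OF t0] by simp
  qed
  have "\<Omega>\<^sup>2 \<noteq> 0" using \<Omega>0 by simp
  from Gauss_factorization[OF this eq] obtain G' H' where
    GH: "F = G' * H'" "pkeys G' = pkeys (Gf False)" "pkeys H' = pkeys (Gf True)"
    by (auto simp: keys_scale[OF a0])
  have kG: "pkeys (Gf b) \<subseteq> M" for b by (auto simp: in_keys_iff lGf split: if_splits)
  from nosplit[OF GH(1)] GH(2,3) kG obtain b where b: "pkeys (Gf b) \<subseteq> {0}" by blast
  \<comment> \<open>At a point where \<open>\<Omega>\<close> does not vanish,
    \<open>evalT t (Gf b)\<close> is a nonzero multiple of the nonconstant \<open>g b t\<close>, so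
    \<open>Gf b\<close> cannot be constant.\<close>
  have "degree \<Omega> < card TC" using degprod[of I] big by (simp add: \<Omega>_def)
  then obtain t where t: "t \<in> TC" "poly \<Omega> t \<noteq> 0" using vanish[of \<Omega>] \<Omega>0 by blast
  have "pkeys (g b t) = pkeys (evalT t (Gf b))"
    using arg_cong[OF scaled[OF t(1), of b], of pkeys]
    unfolding keys_scale[OF t(2)] keys_scale[OF l(1)[OF t(1)]] by (rule sym)
  thus False using g(2)[OF t(1), of b] b keys_evalT[of t "Gf b"] by blast
qed

section \<open>Counting reducible specialisations in one variable\<close>

lemma heights_finite:
  fixes B :: real
  assumes B: "B \<ge> 1"
  shows "finite {t. real_of_int (max \<bar>fst (quotient_of t)\<bar> \<bar>snd (quotient_of t)\<bar>) \<le> B}"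
    and "real (card {t. real_of_int (max \<bar>fst (quotient_of t)\<bar> \<bar>snd (quotient_of t)\<bar>) \<le> B}) \<le> 9 * B\<^sup>2"
proof -
  define S where "S = {t. real_of_int (max \<bar>fst (quotient_of t)\<bar> \<bar>snd (quotient_of t)\<bar>) \<le> B}"
  define n where "n = \<lfloor>B\<rfloor>"
  have n: "n \<ge> 1" "real_of_int n \<le> B" using B by (auto simp: n_def)
  have inj: "inj_on quotient_of S" by (rule inj_on_inverseI[of _ "\<lambda>(x, y). of_int x / of_int y"])
    (metis (mono_tags, lifting) case_prod_conv quotient_of_div surj_pair)
  have sub: "quotient_of ` S \<subseteq> {-n..n} \<times> {-n..n}"
  proof
    fix z assume "z \<in> quotient_of ` S"
    then obtain t where t: "z = quotient_of t" "t \<in> S" by blast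
    have "real_of_int \<bar>fst z\<bar> \<le> B" "real_of_int \<bar>snd z\<bar> \<le> B" using t by (auto simp: S_def)
    hence "\<bar>fst z\<bar> \<le> n" "\<bar>snd z\<bar> \<le> n" unfolding n_def by (simp_all only: le_floor_iff)
    thus "z \<in> {-n..n} \<times> {-n..n}" by (cases z) auto
  qed
  show "finite S" using finite_imageD[OF finite_subset[OF sub] inj] by simp
  have "card S = card (quotient_of ` S)" by (rule card_image[OF inj, symmetric])
  also have "\<dots> \<le> card ({-n..n} \<times> {-n..n})" by (rule card_mono[OF _ sub]) simp
  also have "\<dots> = nat (2 * n + 1) * nat (2 * n + 1)" by (simp add: card_cartesian_product)
  finally have "real (card S) \<le> real (nat (2 * n + 1)) * real (nat (2 * n + 1))" by (simp flip: of_nat_mult)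
  also have "\<dots> \<le> (3 * B) * (3 * B)" using n by (intro mult_mono) auto
  also have "\<dots> = 9 * B\<^sup>2" by (simp add: power2_eq_square)
  finally show "real (card S) \<le> 9 * B\<^sup>2" .
qed

definition mons :: "nat \<Rightarrow> nat \<Rightarrow> mon set" where
  "mons d R = {m. pkeys m \<subseteq> {..<R} \<and> (\<forall>i. plookup m i \<le> d)}"

lemma finite_mons: "finite (mons d R)"
proof (rule finite_imageD[of plookup])
  have "plookup ` mons d R \<subseteq> {f. \<forall>i. (i \<in> {..<R} \<longrightarrow> f i \<in> {..d}) \<and> (i \<notin> {..<R} \<longrightarrow> f i = 0)}"
    by (auto simp: mons_def in_keys_iff)
  thus "finite (plookup ` mons d R)" by (rule finite_subset) (rule finite_set_of_finite_funs; simp)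
  show "inj_on plookup (mons d R)" by (rule inj_onI) (simp only: poly_mapping_eq_iff)
qed

text \<open>Kronecker substitution: the exponents, at most \<open>d\<close>, become digits to the base \<open>d + 1\<close>.\<close>

definition kw :: "nat \<Rightarrow> nat \<Rightarrow> mon \<Rightarrow> nat" where
  "kw d R m = (\<Sum>i<R. plookup m i * (d + 1) ^ i)"

lemma kw_0 [simp]: "kw d R 0 = 0"
  by (simp add: kw_def)

lemma kw_add: "kw d R (m + n) = kw d R m + kw d R n"
  by (simp add: kw_def lookup_add distrib_right sum.distrib)

lemma digits_unique:
  fixes a b :: "nat \<Rightarrow> nat"
  assumes "\<And>i. a i \<le> d" "\<And>i. b i \<le> d" "(\<Sum>i<R. a i * (d + 1) ^ i) = (\<Sum>i<R. b i * (d + 1) ^ i)" "i < R"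
  shows "a i = b i"
  using assms
proof (induction R arbitrary: a b i)
  case (Suc R)
  have e: "(\<Sum>i<Suc R. c i * (d + 1) ^ i) = c 0 + (d + 1) * (\<Sum>i<R. c (Suc i) * (d + 1) ^ i)" for c :: "nat \<Rightarrow> nat"
    by (subst sum.lessThan_Suc_shift) (simp add: sum_distrib_left algebra_simps)
  define u where "u c = (\<Sum>i<R. c (Suc i) * (d + 1) ^ i)" for c :: "nat \<Rightarrow> nat"
  have eq: "a 0 + (d + 1) * u a = b 0 + (d + 1) * u b" using Suc.prems(3) unfolding e u_def .
  have lt: "a 0 < d + 1" "b 0 < d + 1" using Suc.prems(1,2)[of 0] by auto
  have "a 0 = (a 0 + (d + 1) * u a) mod (d + 1)" using lt by (simp only: mod_mult_self2 mod_less)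
  also have "\<dots> = b 0" unfolding eq using lt by (simp only: mod_mult_self2 mod_less)
  finally have 0: "a 0 = b 0" .
  have "(d + 1) * u a = (d + 1) * u b" using eq unfolding 0 by (simp only: add_left_cancel)
  hence "u a = u b" by (simp only: mult_cancel1) simp
  show ?case
  proof (cases i)
    case 0
    thus ?thesis using \<open>a 0 = b 0\<close> by simp
  next
    case (Suc j)
    have "a (Suc j) = b (Suc j)"
      by (rule Suc.IH[of "\<lambda>i. a (Suc i)" "\<lambda>i. b (Suc i)"]) (use Suc.prems \<open>u a = u b\<close> Suc in \<open>auto simp: u_def\<close>)
    thus ?thesis using Suc by simp
  qed
qed simp

lemma kw_inj: "m \<in> mons d R \<Longrightarrow> n \<in> mons d R \<Longrightarrow> kw d R m = kw d R n \<Longrightarrow> m = n"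
proof (rule poly_mapping_eqI)
  fix i assume m: "m \<in> mons d R" "n \<in> mons d R" "kw d R m = kw d R n"
  show "plookup m i = plookup n i"
  proof (cases "i < R")
    case True
    show ?thesis by (rule digits_unique[of _ d _ R]) (use m True in \<open>auto simp: mons_def kw_def\<close>)
  next
    case False
    hence "i \<notin> pkeys m" "i \<notin> pkeys n" using m by (auto simp: mons_def)
    thus ?thesis by (simp add: in_keys_iff)
  qed
qed

lemma kw_bound: "m \<in> mons d R \<Longrightarrow> kw d R m \<le> (\<Sum>i<R. d * (d + 1) ^ i)"
  unfolding kw_def by (intro sum_mono mult_right_mono) (auto simp: mons_def)

interpretation kron: pm_hom "\<lambda>c :: rat. [:c:]" "\<lambda>m. monom 1 (kw d R m)" for d R
  by unfold_locales (simp_all add: kw_add mult_monom)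

abbreviation "kron d R \<equiv> kron.ev d R"

lemma coeff_kron: "coeff (kron d R p) j = (\<Sum>m\<in>pkeys p. if kw d R m = j then plookup p m else 0)"
  unfolding kron.ev_def by (simp add: coeff_sum if_distrib cong: if_cong)

lemma coeff_kron_kw:
  assumes "pkeys p \<subseteq> mons d R" "m \<in> mons d R"
  shows "coeff (kron d R p) (kw d R m) = plookup p m"
proof -
  have "coeff (kron d R p) (kw d R m) = (\<Sum>k\<in>pkeys p. if k = m then plookup p k else 0)"
    unfolding coeff_kron by (rule sum.cong) (use assms kw_inj in auto)
  thus ?thesis by (simp add: in_keys_iff)
qed

lemma degree_kron_pos:
  assumes "pkeys p \<subseteq> mons d R" "\<not> pkeys p \<subseteq> {0}"
  shows "degree (kron d R p) > 0"
proof -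
  obtain m where m: "m \<in> pkeys p" "m \<noteq> 0" using assms(2) by blast
  have "m \<in> mons d R" "0 \<in> mons d R" using m assms(1) by (auto simp: mons_def)
  hence "kw d R m \<noteq> 0" using kw_inj[of m d R 0] m(2) by auto
  moreover have "coeff (kron d R p) (kw d R m) \<noteq> 0"
    using coeff_kron_kw[OF assms(1) \<open>m \<in> mons d R\<close>] m(1) by (simp add: in_keys_iff)
  hence "kw d R m \<le> degree (kron d R p)" by (rule le_degree)
  ultimately show ?thesis by simp
qed

lemma lookup_pm_map: "f 0 = 0 \<Longrightarrow> plookup (Poly_Mapping.map f p) k = f (plookup p k)"
  by (simp add: map.rep_eq when_def)

text \<open>Exponents of each variable add up, so those in a factor stay below the ones in the
  product. Kronecker substitution is therefore injective on the monomials of the factors as well,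
  and their coefficients can be read off from their images.\<close>

lemma factor_keys_bound:
  fixes g h :: "mon \<Rightarrow>\<^sub>0 rat"
  assumes gh: "g * h \<noteq> 0" "pkeys (g * h) \<subseteq> mons d R \<inter> {m. pkeys m \<subseteq> V}"
  shows "pkeys g \<subseteq> mons d R \<inter> {m. pkeys m \<subseteq> V}"
proof
  fix m assume m: "m \<in> pkeys g"
  have le: "plookup m i \<le> b" if "\<And>k. k \<in> pkeys (g * h) \<Longrightarrow> plookup k i \<le> b" for i b
    by (rule degree_functional_factor[OF _ gh(1) that m]) (rule lookup_add)
  have 1: "plookup m i \<le> d" for i by (rule le) (use gh(2) in \<open>auto simp: mons_def\<close>)
  have z: "plookup m i \<le> 0" if "\<not> (i < R \<and> i \<in> V)" for i
  proof (rule le)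
    fix k assume "k \<in> pkeys (g * h)"
    hence "pkeys k \<subseteq> {..<R} \<inter> V" using gh(2) by (auto simp: mons_def)
    hence "i \<notin> pkeys k" using that by blast
    thus "plookup k i \<le> 0" by (simp add: in_keys_iff)
  qed
  have "i < R \<and> i \<in> V" if "i \<in> pkeys m" for i
  proof (rule ccontr)
    assume "\<not> (i < R \<and> i \<in> V)"
    hence "plookup m i \<le> 0" by (rule z)
    thus False using that by (simp add: in_keys_iff)
  qed
  thus "m \<in> mons d R \<inter> {m. pkeys m \<subseteq> V}" using 1 by (auto simp: mons_def)
qed

definition kronT :: "nat \<Rightarrow> nat \<Rightarrow> (mon \<Rightarrow>\<^sub>0 int poly) \<Rightarrow> int poly poly" where
  "kronT d R F = (\<Sum>m\<in>pkeys F. monom (plookup F m) (kw d R m))"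

abbreviation rat_coeffs :: "(mon \<Rightarrow>\<^sub>0 int poly) \<Rightarrow> mon \<Rightarrow>\<^sub>0 rat poly" where
  "rat_coeffs F \<equiv> Poly_Mapping.map of_int_poly F"

lemma coeff_kronT_kw:
  assumes "pkeys F \<subseteq> mons d R" "m \<in> pkeys F"
  shows "coeff (kronT d R F) (kw d R m) = plookup F m"
proof -
  have "coeff (kronT d R F) (kw d R m) = (\<Sum>k\<in>pkeys F. if k = m then plookup F k else 0)"
    unfolding kronT_def coeff_sum coeff_monom
  proof (rule sum.cong)
    fix k assume "k \<in> pkeys F"
    thus "(if kw d R k = kw d R m then plookup F k else 0) = (if k = m then plookup F k else 0)"
      using kw_inj[of k d R m] assms by auto
  qed simp
  thus ?thesis using assms(2) by simp
qed

lemma coeff_kronT_0: "(\<And>m. m \<in> pkeys F \<Longrightarrow> kw d R m \<noteq> j) \<Longrightarrow> coeff (kronT d R F) j = 0"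
  by (auto simp: kronT_def coeff_sum intro!: sum.neutral)

lemma keys_rat_coeffs: "pkeys (evalT t (rat_coeffs F)) \<subseteq> pkeys F"
  using keys_evalT[of t "rat_coeffs F"] by (auto simp: in_keys_iff lookup_pm_map)

lemma specP_kronT:
  assumes F: "pkeys F \<subseteq> mons d R" and deg: "\<And>m. degree (plookup F m) \<le> d" and y: "y \<noteq> 0"
  shows "of_int_poly (specP d (kronT d R F) x y) =
    smult (of_int y ^ d) (kron d R (evalT (of_int x / of_int y) (rat_coeffs F)))"
proof (rule poly_eqI)
  fix j
  define t :: rat where "t = of_int x / of_int y"
  have sub: "pkeys (evalT t (rat_coeffs F)) \<subseteq> mons d R" using keys_rat_coeffs F by blast
  have "of_int (homog d (coeff (kronT d R F) j) x y) = of_int y ^ d * coeff (kron d R (evalT t (rat_coeffs F))) j"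
  proof (cases "\<exists>m\<in>pkeys F. kw d R m = j")
    case True
    then obtain m where m: "m \<in> pkeys F" "kw d R m = j" by blast
    have "coeff (kron d R (evalT t (rat_coeffs F))) j = poly (of_int_poly (plookup F m)) t"
      using coeff_kron_kw[OF sub, of m] F m by (auto simp: lookup_pm_map)
    thus ?thesis using coeff_kronT_kw[OF F m(1)] m(2) homog_rat[OF deg y] by (simp add: t_def)
  next
    case False
    have "coeff (kron d R (evalT t (rat_coeffs F))) j = 0"
      unfolding coeff_kron using False keys_rat_coeffs[of t F] by (intro sum.neutral) auto
    moreover have "coeff (kronT d R F) j = 0" by (rule coeff_kronT_0) (use False in auto)
    ultimately show ?thesis by simp
  qed
  thus "coeff (of_int_poly (specP d (kronT d R F) x y)) j =
     coeff (smult (of_int y ^ d) (kron d R (evalT (of_int x / of_int y) (rat_coeffs F)))) j"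
    by (simp add: t_def)
qed

text \<open>Apart from at most \<open>d\<close> zeros of a leading coefficient, the points with a
  splitting lie in \<open>O(B L^3)\<close> classes, and more than \<open>O(L)\<close> points in one
  class would interpolate to a forbidden factorisation. The set \<open>V\<close> keeps the forbidden
  factors within the variables of \<open>F\<close>, so that the variable hidden in the coefficients
  can be made a new one when the theorem is applied.\<close>

theorem one_variable_bound:
  fixes d R :: nat
  obtains C :: real where "C > 0"
    "\<And>(F :: mon \<Rightarrow>\<^sub>0 int poly) V K B.
      K \<ge> 2 \<Longrightarrow> B \<ge> 1 \<Longrightarrow> pkeys F \<subseteq> mons d R \<inter> {m. pkeys m \<subseteq> V} \<Longrightarrow>
      (\<And>m. degree (plookup F m) \<le> d) \<Longrightarrow> (\<And>m k. real_of_int \<bar>coeff (plookup F m) k\<bar> \<le> K) \<Longrightarrow>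
      (\<And>G H. rat_coeffs F = G * H \<Longrightarrow> pkeys G \<subseteq> {m. pkeys m \<subseteq> V} \<Longrightarrow> pkeys H \<subseteq> {m. pkeys m \<subseteq> V} \<Longrightarrow>
         pkeys G \<subseteq> {0} \<or> pkeys H \<subseteq> {0}) \<Longrightarrow>
      real (card {t. real_of_int (max \<bar>fst (quotient_of t)\<bar> \<bar>snd (quotient_of t)\<bar>) \<le> B \<and> splits (evalT t (rat_coeffs F))})
        \<le> C * B * (ln K + ln B) ^ 5"
proof -
  define N where "N = (\<Sum>i<R. d * (d + 1) ^ i)"
  define Mc where "Mc = card (mons d R)"
  obtain C1 where C1: "C1 > 0" and cls: "\<And>(F :: int poly poly) (K :: real) B (T :: rat set) (G :: bool \<Rightarrow> rat \<Rightarrow> int poly).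
      K \<ge> 2 \<Longrightarrow> B \<ge> 1 \<Longrightarrow> degree F \<le> N \<Longrightarrow> (\<And>i. degree (coeff F i) \<le> d) \<Longrightarrow>
      (\<And>i k. real_of_int \<bar>coeff (coeff F i) k\<bar> \<le> K) \<Longrightarrow>
      (\<And>t. t \<in> T \<Longrightarrow> real_of_int \<bar>fst (quotient_of t)\<bar> \<le> B \<and> real_of_int \<bar>snd (quotient_of t)\<bar> \<le> B) \<Longrightarrow>
      (\<And>t. t \<in> T \<Longrightarrow> poly (of_int_poly (lead_coeff F)) t \<noteq> 0) \<Longrightarrow>
      (\<And>t b. t \<in> T \<Longrightarrow> G b t dvd specP d F (fst (quotient_of t)) (snd (quotient_of t)) \<and>
          degree (G b t) > 0 \<and> content (G b t) = 1) \<Longrightarrow>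
      \<exists>key A. finite (key ` T) \<and> real (card (key ` T)) \<le> C1 * B * (ln K + ln B) ^ 3 \<and>
         A \<ge> 1 \<and> real A \<le> C1 * (ln K + ln B) \<and>
         (\<forall>\<kappa> (b :: bool) j. \<exists>P0 P1 :: int poly. (P0 \<noteq> 0 \<or> P1 \<noteq> 0) \<and> degree P0 < A \<and> degree P1 < A \<and>
           (\<forall>t\<in>T. (key t :: nat \<times> int \<times> (int poly \<times> nat) list \<times> (int poly \<times> nat) list) = \<kappa> \<longrightarrow>
              of_int (lead_coeff (G b t)) * poly (of_int_poly P0) t +
              of_int (coeff (G b t) j) * poly (of_int_poly P1) t = (0 :: rat)))"
    apply (rule rational_point_classes[of N d])
    subgoal premises prems for C by (rule prems(1)[OF prems(2)], rule prems(3))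
    done
  have ln2: "ln (2::real) > 0" by simp
  define E where "E = real (d + 2 + 4 * Mc)"
  \<comment> \<open>The first summand accounts for the zeros of the leading coefficient, by
    \<open>B * L ^ 5 \<ge> ln 2 ^ 5\<close>, the second for the classes.\<close>
  define C where "C = real d / ln 2 ^ 5 + C1 * C1 * E / ln 2"
  have CE: "C1 * C1 * E / ln 2 > 0" using C1 ln2 by (simp add: E_def)
  show ?thesis
  proof (rule that[of C])
    show "C > 0" unfolding C_def using CE by (intro add_nonneg_pos) auto
    fix F :: "mon \<Rightarrow>\<^sub>0 int poly" and V and K B :: real
    assume K: "K \<ge> 2" and B: "B \<ge> 1" and F: "pkeys F \<subseteq> mons d R \<inter> {m. pkeys m \<subseteq> V}"
      and deg: "\<And>m. degree (plookup F m) \<le> d" and FK: "\<And>m k. real_of_int \<bar>coeff (plookup F m) k\<bar> \<le> K"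
      and nosplit: "\<And>G H. rat_coeffs F = G * H \<Longrightarrow> pkeys G \<subseteq> {m. pkeys m \<subseteq> V} \<Longrightarrow> pkeys H \<subseteq> {m. pkeys m \<subseteq> V} \<Longrightarrow>
         pkeys G \<subseteq> {0} \<or> pkeys H \<subseteq> {0}"
    define L where "L = ln K + ln B"
    have "ln 2 \<le> ln K" using K by simp
    moreover have "0 \<le> ln B" using B by simp
    ultimately have L: "L \<ge> ln 2" unfolding L_def by linarith
    have L0: "L > 0" using L ln2 by linarith
    define T0 where "T0 = {t. real_of_int (max \<bar>fst (quotient_of t)\<bar> \<bar>snd (quotient_of t)\<bar>) \<le> B \<and> splits (evalT t (rat_coeffs F))}"
    have finT0: "finite T0" by (rule finite_subset[OF _ heights_finite(1)[OF B]]) (auto simp: T0_def)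
    define M where "M = mons d R \<inter> {m. pkeys m \<subseteq> V}"
    have finM: "finite M" "card M \<le> Mc" unfolding M_def Mc_def using finite_mons by (auto intro: card_mono)
    have keysE: "pkeys (evalT t (rat_coeffs F)) \<subseteq> M" for t using keys_rat_coeffs F unfolding M_def by blast
    have Fm: "pkeys F \<subseteq> mons d R" using F by blast
    show "real (card T0) \<le> C * B * (ln K + ln B) ^ 5"
    proof (cases "T0 = {}")
      case True
      thus ?thesis using B L0 C_def CE by (simp add: L_def[symmetric])
    next
      case False
      have "\<exists>g h. evalT t (rat_coeffs F) = g * h \<and> pkeys g \<subseteq> M \<and> pkeys h \<subseteq> M \<and>
          \<not> pkeys g \<subseteq> {0} \<and> \<not> pkeys h \<subseteq> {0}" if t: "t \<in> T0" for t
      proof -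
        obtain g h where gh: "evalT t (rat_coeffs F) = g * h" "\<not> pkeys g \<subseteq> {0}" "\<not> pkeys h \<subseteq> {0}"
          using t unfolding T0_def splits_def by blast
        have "g \<noteq> 0" "h \<noteq> 0" using gh by auto
        hence nz: "g * h \<noteq> 0" "h * g \<noteq> 0" by auto
        have "pkeys g \<subseteq> M" unfolding M_def
          by (rule factor_keys_bound[OF nz(1)]) (use keysE[of t] gh(1) in \<open>simp add: M_def\<close>)
        moreover have "pkeys h \<subseteq> M" unfolding M_def
          by (rule factor_keys_bound[OF nz(2)]) (use keysE[of t] gh(1) in \<open>simp add: M_def mult.commute\<close>)
        ultimately show ?thesis using gh by blast
      qed
      hence "\<forall>t\<in>T0. \<exists>gh. evalT t (rat_coeffs F) = fst gh * snd gh \<and> pkeys (fst gh) \<subseteq> M \<and> pkeys (snd gh) \<subseteq> M \<and>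
          \<not> pkeys (fst gh) \<subseteq> {0} \<and> \<not> pkeys (snd gh) \<subseteq> {0}" by (simp add: split_paired_Ex)
      from bchoice[OF this] obtain gh where gh: "\<forall>t\<in>T0. evalT t (rat_coeffs F) = fst (gh t) * snd (gh t) \<and>
          pkeys (fst (gh t)) \<subseteq> M \<and> pkeys (snd (gh t)) \<subseteq> M \<and>
          \<not> pkeys (fst (gh t)) \<subseteq> {0} \<and> \<not> pkeys (snd (gh t)) \<subseteq> {0}" by (rule exE)
      define g where "g b t = (if b then snd (gh t) else fst (gh t))" for b t
      have g: "evalT t (rat_coeffs F) = g False t * g True t" if "t \<in> T0" for t
        using gh that by (simp add: g_def)
      have gk: "pkeys (g b t) \<subseteq> M \<and> \<not> pkeys (g b t) \<subseteq> {0}" if "t \<in> T0" for b t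
        using gh that by (simp add: g_def)
      have F0: "pkeys F \<noteq> {}"
      proof
        assume "pkeys F = {}"
        obtain t where t: "t \<in> T0" using False by blast
        have "pkeys (evalT t (rat_coeffs F)) = {}" using keys_rat_coeffs[of t F] \<open>pkeys F = {}\<close> by blast
        hence "evalT t (rat_coeffs F) = 0" by simp
        hence "g False t = 0 \<or> g True t = 0" using g[OF t] by simp
        thus False using gk[OF t, of False] gk[OF t, of True] by auto
      qed
      define n where "n = Max (kw d R ` pkeys F)"
      have "n \<in> kw d R ` pkeys F" unfolding n_def using F0 by (intro Max_in) auto
      \<comment> \<open>The monomial of largest weight. Its coefficient \<open>a\<close> is the
        leading coefficient of the Kronecker image, whose degree drops in a fibre only at the zeros
        of \<open>a\<close>.\<close>
      then obtain \<mu> where \<mu>: "\<mu> \<in> pkeys F" "n = kw d R \<mu>" by blast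
      have kn: "kw d R m \<le> n" if "m \<in> pkeys F" for m unfolding n_def using that by (intro Max_ge) auto
      define FF where "FF = kronT d R F"
      define a where "a = plookup F \<mu>"
      have a0: "a \<noteq> 0" using \<mu>(1) by (simp add: a_def in_keys_iff)
      have top: "coeff FF n = a" using coeff_kronT_kw[OF Fm \<mu>(1)] by (simp add: FF_def a_def \<mu>(2))
      have "coeff FF j = 0" if "j > n" for j unfolding FF_def by (rule coeff_kronT_0) (use kn that in force)
      hence dFF: "degree FF = n" using top a0 by (intro antisym degree_le le_degree) auto
      have nN: "n \<le> N" unfolding \<mu>(2) N_def by (rule kw_bound) (use \<mu>(1) Fm in blast)
      have cFF: "coeff FF j = 0 \<or> (\<exists>m\<in>pkeys F. coeff FF j = plookup F m)" for j
      proof (cases "\<exists>m\<in>pkeys F. kw d R m = j")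
        case True
        thus ?thesis using coeff_kronT_kw[OF Fm] unfolding FF_def by blast
      next
        case False
        hence "coeff FF j = 0" unfolding FF_def by (intro coeff_kronT_0) auto
        thus ?thesis ..
      qed
      have degFF: "degree (coeff FF j) \<le> d" for j using cFF[of j] deg by auto
      have FFK: "real_of_int \<bar>coeff (coeff FF j) k\<bar> \<le> K" for j k using cFF[of j] FK[of _ k] K by auto
      define ar :: "rat poly" where "ar = of_int_poly a"
      have ar0: "ar \<noteq> 0" using a0 by (simp add: ar_def)
      define T1 where "T1 = {t \<in> T0. poly ar t \<noteq> 0}"
      have T1: "t \<in> T0" "poly ar t \<noteq> 0" if "t \<in> T1" for t using that by (auto simp: T1_def)
      have "card (T0 - T1) \<le> card {t. poly ar t = 0}"
        by (rule card_mono[OF poly_roots_finite[OF ar0]]) (auto simp: T1_def)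
      also have "\<dots> \<le> degree ar" by (rule card_poly_roots_bound[OF ar0])
      also have "\<dots> \<le> d" using deg[of \<mu>] by (simp add: ar_def a_def)
      finally have cT0: "card (T0 - T1) \<le> d" .
      define l where "l b t = lead_coeff (kron d R (g b t))" for b t
      have gm: "pkeys (g b t) \<subseteq> mons d R" if "t \<in> T0" for b t using gk[OF that, of b] by (auto simp: M_def)
      have dpos: "degree (kron d R (g b t)) > 0" if "t \<in> T0" for b t
        using degree_kron_pos[OF gm[OF that]] gk[OF that, of b] by blast
      have kprod: "kron d R (evalT t (rat_coeffs F)) = kron d R (g False t) * kron d R (g True t)" if "t \<in> T0" for t
        unfolding g[OF that] by (rule kron.ev_mult)
      have l0: "l b t \<noteq> 0" if "t \<in> T0" for b t using dpos[OF that, of b] by (auto simp: l_def)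
      have lprod: "l False t * l True t = poly ar t" if t: "t \<in> T1" for t
      proof -
        have sub: "pkeys (evalT t (rat_coeffs F)) \<subseteq> mons d R" using keysE[of t] by (auto simp: M_def)
        have c: "coeff (kron d R (evalT t (rat_coeffs F))) n = poly ar t"
          unfolding \<mu>(2) using coeff_kron_kw[OF sub, of \<mu>] \<mu>(1) Fm by (auto simp: lookup_pm_map ar_def a_def)
        have "coeff (kron d R (evalT t (rat_coeffs F))) j = 0" if "j > n" for j
          unfolding coeff_kron using keys_rat_coeffs[of t F] kn that by (intro sum.neutral) force
        hence "degree (kron d R (evalT t (rat_coeffs F))) = n"
          using c T1(2)[OF t] by (intro antisym degree_le le_degree) auto
        hence "lead_coeff (kron d R (evalT t (rat_coeffs F))) = poly ar t" using c by simp
        thus ?thesis unfolding kprod[OF T1(1)[OF t]] lead_coeff_mult l_def .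
      qed
      \<comment> \<open>The classes are formed with primitive integer polynomials. The factor
        \<open>c b t\<close> relates \<open>G b t\<close> to the rational factor; the relations
        found are homogeneous in the coefficients, so they pass to \<open>g b t\<close> and
        \<open>l b t\<close> by scaling.\<close>
      define G where "G b t = snd (rat_to_normalized_int_poly (kron d R (g b t)))" for b t
      define c where "c b t = fst (rat_to_normalized_int_poly (kron d R (g b t)))" for b t
      have rn: "rat_to_normalized_int_poly (kron d R (g b t)) = (c b t, G b t)" for b t by (simp add: c_def G_def)
      have Gc: "kron d R (g b t) = smult (c b t) (of_int_poly (G b t))" "c b t > 0" for b t
        using rat_to_normalized_int_poly(1,2)[OF rn] by auto
      have Gprop: "G b t dvd specP d FF (fst (quotient_of t)) (snd (quotient_of t)) \<and> degree (G b t) > 0 \<and> content (G b t) = 1"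
        if t: "t \<in> T1" for b t
      proof -
        have t0: "t \<in> T0" by (rule T1(1)[OF t])
        define x y where "x = fst (quotient_of t)" and "y = snd (quotient_of t)"
        have y: "y > 0" by (simp add: y_def quotient_of_denom_pos')
        have txy: "of_int x / of_int y = t" unfolding x_def y_def by (rule sym, rule quotient_of_div) simp
        have "of_int_poly (specP d FF x y) = smult (of_int y ^ d) (kron d R (evalT t (rat_coeffs F)))"
          unfolding FF_def using specP_kronT[OF Fm deg, of y x] y txy by simp
        also have "\<dots> = kron d R (g b t) * smult (of_int y ^ d) (kron d R (g (\<not> b) t))"
          unfolding kprod[OF t0] by (cases b) (simp_all add: mult.commute)
        finally obtain r where "specP d FF x y = G b t * smult (content (specP d FF x y)) r"
          using rat_to_int_factor_explicit[OF _ rn[of b t]] by blast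
        hence "G b t dvd specP d FF x y" by (rule dvdI)
        moreover have "degree (G b t) > 0" using rat_to_normalized_int_poly(4)[OF rn] dpos[OF t0] by simp
        moreover have "kron d R (g b t) \<noteq> 0" using dpos[OF t0, of b] by auto
        hence "content (G b t) = 1" by (rule rat_to_normalized_int_poly(3)[OF rn])
        ultimately show ?thesis by (simp add: x_def y_def)
      qed
      have "\<exists>key A. finite (key ` T1) \<and> real (card (key ` T1)) \<le> C1 * B * (ln K + ln B) ^ 3 \<and>
         A \<ge> 1 \<and> real A \<le> C1 * (ln K + ln B) \<and>
         (\<forall>\<kappa> (b :: bool) j. \<exists>P0 P1 :: int poly. (P0 \<noteq> 0 \<or> P1 \<noteq> 0) \<and> degree P0 < A \<and> degree P1 < A \<and>
           (\<forall>t\<in>T1. (key t :: nat \<times> int \<times> (int poly \<times> nat) list \<times> (int poly \<times> nat) list) = \<kappa> \<longrightarrow>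
              of_int (lead_coeff (G b t)) * poly (of_int_poly P0) t +
              of_int (coeff (G b t) j) * poly (of_int_poly P1) t = (0 :: rat)))"
      proof (rule cls[OF K B _ degFF FFK _ _ Gprop])
        show "degree FF \<le> N" using dFF nN by simp
        show "real_of_int \<bar>fst (quotient_of t)\<bar> \<le> B \<and> real_of_int \<bar>snd (quotient_of t)\<bar> \<le> B" if "t \<in> T1" for t
          using T1(1)[OF that] by (auto simp: T0_def)
        show "poly (of_int_poly (lead_coeff FF)) t \<noteq> 0" if "t \<in> T1" for t
          using T1(2)[OF that] by (simp add: dFF top ar_def)
      qed
      then obtain key :: "rat \<Rightarrow> nat \<times> int \<times> (int poly \<times> nat) list \<times> (int poly \<times> nat) list" and A where
        key: "finite (key ` T1)" "real (card (key ` T1)) \<le> C1 * B * L ^ 3"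
        and A: "A \<ge> 1" "real A \<le> C1 * L"
        and rel: "\<forall>\<kappa> b j. \<exists>P0 P1 :: int poly. (P0 \<noteq> 0 \<or> P1 \<noteq> 0) \<and> degree P0 < A \<and> degree P1 < A \<and>
           (\<forall>t\<in>T1. key t = \<kappa> \<longrightarrow>
              of_int (lead_coeff (G b t)) * poly (of_int_poly P0) t +
              of_int (coeff (G b t) j) * poly (of_int_poly P1) t = (0 :: rat))"
        unfolding L_def[symmetric] by (elim exE conjE) (rule that, assumption+)
      have finT1: "finite T1" using finT0 by (simp add: T1_def)
      have fibre: "card {t \<in> T1. key t = \<kappa>} \<le> (d + 2 + 4 * Mc) * A" for \<kappa>
      proof -
        obtain Q0 Q1 :: "bool \<Rightarrow> nat \<Rightarrow> int poly" where Q: "\<And>b j. (Q0 b j \<noteq> 0 \<or> Q1 b j \<noteq> 0) \<and> degree (Q0 b j) < A \<and> degree (Q1 b j) < A \<and>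
           (\<forall>t\<in>T1. key t = \<kappa> \<longrightarrow>
              of_int (lead_coeff (G b t)) * poly (of_int_poly (Q0 b j)) t +
              of_int (coeff (G b t) j) * poly (of_int_poly (Q1 b j)) t = (0 :: rat))"
          using rel[rule_format, of \<kappa>] by metis
        have "card {t \<in> T1. key t = \<kappa>} \<le> d + 2 * (A + 2 * card M * A)"
        proof (rule class_bound[where F = "rat_coeffs F" and M = M and a = ar and g = g and l = l
              and ?P0.0 = "\<lambda>b m. of_int_poly (Q0 b (kw d R m))" and ?P1.0 = "\<lambda>b m. of_int_poly (Q1 b (kw d R m))"])
          show "pkeys G \<subseteq> {0} \<or> pkeys H \<subseteq> {0}" if "rat_coeffs F = G * H" "pkeys G \<subseteq> M" "pkeys H \<subseteq> M" for G H
            by (rule nosplit[OF that(1)]) (use that in \<open>auto simp: M_def\<close>)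
          show "degree ar \<le> d" using deg[of \<mu>] by (simp add: ar_def a_def)
          show "degree (plookup (rat_coeffs F) k) \<le> d" for k using deg[of k] by (simp add: lookup_pm_map)
          fix b m t
          show "(of_int_poly (Q0 b (kw d R m)) \<noteq> (0 :: rat poly) \<or> of_int_poly (Q1 b (kw d R m)) \<noteq> (0 :: rat poly)) \<and>
             degree (of_int_poly (Q0 b (kw d R m)) :: rat poly) \<le> A \<and> degree (of_int_poly (Q1 b (kw d R m)) :: rat poly) \<le> A"
            using Q[of b "kw d R m"] by auto
          assume m: "m \<in> M" and t: "t \<in> {t \<in> T1. key t = \<kappa>}"
          have t0: "t \<in> T0" using t T1(1) by simp
          have "of_int (lead_coeff (G b t)) * poly (of_int_poly (Q0 b (kw d R m))) t +
              of_int (coeff (G b t) (kw d R m)) * poly (of_int_poly (Q1 b (kw d R m))) t = (0 :: rat)"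
            by (rule Q[of b "kw d R m", THEN conjunct2, THEN conjunct2, THEN conjunct2, rule_format]) (use t in auto)
          hence "c b t * (of_int (lead_coeff (G b t)) * poly (of_int_poly (Q0 b (kw d R m))) t +
              of_int (coeff (G b t) (kw d R m)) * poly (of_int_poly (Q1 b (kw d R m))) t) = (0 :: rat)" by simp
          moreover have "l b t = c b t * of_int (lead_coeff (G b t))" using Gc[of b t] by (simp add: l_def)
          moreover have "plookup (g b t) m = c b t * of_int (coeff (G b t) (kw d R m))"
            using coeff_kron_kw[OF gm[OF t0], of m b] m Gc(1)[of b t] by (simp add: M_def)
          ultimately show "l b t * poly (of_int_poly (Q0 b (kw d R m))) t +
              plookup (g b t) m * poly (of_int_poly (Q1 b (kw d R m))) t = 0"
            by (simp add: distrib_left mult.assoc)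
        qed (use finM finT1 g gk l0 lprod T1 in auto)
        also have "\<dots> \<le> d * A + 2 * (A + 2 * Mc * A)"
          using A(1) finM(2) by (intro add_mono mult_le_mono) auto
        also have "\<dots> = (d + 2 + 4 * Mc) * A" by (simp add: algebra_simps)
        finally show ?thesis .
      qed
      have "card T1 = (\<Sum>\<kappa>\<in>key ` T1. card {t \<in> T1. key t = \<kappa>})"
        using sum.image_gen[OF finT1, of "\<lambda>_. 1 :: nat" key] by simp
      also have "\<dots> \<le> (\<Sum>\<kappa>\<in>key ` T1. (d + 2 + 4 * Mc) * A)" by (rule sum_mono[OF fibre])
      finally have "card T1 \<le> card (key ` T1) * ((d + 2 + 4 * Mc) * A)" by simp
      hence "real (card T1) \<le> real (card (key ` T1) * ((d + 2 + 4 * Mc) * A))" by (simp only: of_nat_le_iff)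
      also have "\<dots> = real (card (key ` T1)) * (E * real A)" by (simp only: E_def of_nat_mult)
      also have "\<dots> \<le> (C1 * B * L ^ 3) * (E * (C1 * L))"
        using key(2) A(2) B L0 C1 by (intro mult_mono mult_nonneg_nonneg) (auto simp: E_def)
      also have "\<dots> = C1 * C1 * E * B * L ^ 4" by (simp add: power4_eq_xxxx power3_eq_cube mult_ac)
      \<comment> \<open>The factor \<open>L / ln 2 \<ge> 1\<close> is inserted to reach the fifth
        power.\<close>
      also have "\<dots> \<le> C1 * C1 * E * B * (L ^ 4 * (L / ln 2))"
      proof -
        have "L ^ 4 * 1 \<le> L ^ 4 * (L / ln 2)" using L L0 ln2 by (intro mult_left_mono) (simp_all add: field_simps)
        thus ?thesis using C1 B by (intro mult_left_mono) (auto simp: E_def)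
      qed
      also have "\<dots> = C1 * C1 * E / ln 2 * (B * L ^ 5)" by (simp add: eval_nat_numeral mult_ac)
      finally have cT1: "real (card T1) \<le> C1 * C1 * E / ln 2 * (B * L ^ 5)" .
      have "card T0 = card (T0 - T1) + card T1"
        using card_Diff_subset[of T1 T0] finT0 finT1 card_mono[of T0 T1] by (auto simp: T1_def)
      hence "real (card T0) \<le> real d + C1 * C1 * E / ln 2 * (B * L ^ 5)" using cT0 cT1 by simp
      also have "real d \<le> real d / ln 2 ^ 5 * (B * L ^ 5)"
      proof -
        have "1 * ln 2 ^ 5 \<le> B * L ^ 5" using B L ln2 by (intro mult_mono power_mono) auto
        hence "real d * ln 2 ^ 5 \<le> real d * (B * L ^ 5)" by (intro mult_left_mono) auto
        thus ?thesis using ln2 by (simp add: pos_le_divide_eq)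
      qed
      finally have "real (card T0) \<le> C * (B * L ^ 5)" by (simp add: C_def distrib_right)
      thus ?thesis by (simp add: L_def mult.assoc)
    qed
  qed
qed

section \<open>Reduction of several parameters to one\<close>

section \<open>Substitutions and the chain of specialisations\<close>

definition push :: "('v \<Rightarrow> 'w) \<Rightarrow> ('v \<Rightarrow>\<^sub>0 nat) \<Rightarrow> 'w \<Rightarrow>\<^sub>0 nat" where
  "push g n = (\<Sum>k\<in>pkeys n. psingle (g k) (plookup n k))"

lemma push_superset: "finite A \<Longrightarrow> pkeys n \<subseteq> A \<Longrightarrow> push g n = (\<Sum>k\<in>A. psingle (g k) (plookup n k))"
  unfolding push_def by (rule sum.mono_neutral_left) (auto simp: in_keys_iff)

lemma push_0 [simp]: "push g 0 = 0"
  by (simp add: push_def)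

lemma push_single [simp]: "push g (psingle k a) = psingle (g k) a"
  by (subst push_superset[of "{k}"]) auto

lemma push_add: "push g (m + n) = push g m + push g n"
proof -
  have "push g (m + n) = (\<Sum>k\<in>pkeys m \<union> pkeys n. psingle (g k) (plookup (m + n) k))"
    by (rule push_superset) (use keys_add[of m n] in auto)
  also have "\<dots> = push g m + push g n"
    by (subst (1 2) push_superset[of "pkeys m \<union> pkeys n"]) (auto simp: lookup_add single_add sum.distrib)
  finally show ?thesis .
qed

lemma push_sum: "push g (sum f A) = (\<Sum>i\<in>A. push g (f i))"
  by (induction A rule: infinite_finite_induct) (simp_all add: push_add)

lemma push_push_id: "(\<And>k. k \<in> pkeys n \<Longrightarrow> g (h k) = k) \<Longrightarrow> push g (push h n) = n"
  by (simp add: push_def[of h] push_sum) (rule pm_sum_singles[symmetric])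

lemma lookup_push: "plookup (push g n) k = (\<Sum>v\<in>pkeys n. if g v = k then plookup n v else 0)"
  by (simp add: push_def lookup_sum lookup_single when_def)

lemma keys_push: "pkeys (push g n) \<subseteq> g ` pkeys n"
proof
  fix k assume "k \<in> pkeys (push g n)"
  hence "(\<Sum>v\<in>pkeys n. if g v = k then plookup n v else 0) \<noteq> 0" unfolding in_keys_iff lookup_push .
  then obtain v where "v \<in> pkeys n" "(if g v = k then plookup n v else 0) \<noteq> 0"
    by (rule sum.not_neutral_contains_not_neutral)
  thus "k \<in> g ` pkeys n" by (auto split: if_splits)
qed

text \<open>Degrees in each variable add, and all of them are zero for the product 1.\<close>

lemma unit_keys:
  fixes g u :: "mon \<Rightarrow>\<^sub>0 rat"
  assumes gu: "g * u = 1"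
  shows "pkeys g \<subseteq> {0}"
proof
  fix m assume m: "m \<in> pkeys g"
  have "plookup m i \<le> 0" for i
    by (rule degree_functional_factor[OF _ _ _ m, where q = u]) (auto simp: gu lookup_add)
  thus "m \<in> {0}" by (auto intro: poly_mapping_eqI)
qed

lemma splits_scale:
  fixes p :: "mon \<Rightarrow>\<^sub>0 rat"
  assumes D: "D \<noteq> 0"
  shows "splits (psingle 0 D * p) \<longleftrightarrow> splits p"
proof -
  have *: "splits (psingle 0 D * p)" if sp: "splits p" "D \<noteq> 0" for p :: "mon \<Rightarrow>\<^sub>0 rat" and D
  proof -
    obtain g h where gh: "p = g * h" "\<not> pkeys g \<subseteq> {0}" "\<not> pkeys h \<subseteq> {0}" using sp(1) by (auto simp: splits_def)
    have "psingle 0 D * p = (psingle 0 D * g) * h" by (simp add: gh(1) mult.assoc)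
    moreover have "\<not> pkeys (psingle 0 D * g) \<subseteq> {0}" using gh(2) keys_scale[OF sp(2), of g] by simp
    ultimately show ?thesis using gh(3) unfolding splits_def by blast
  qed
  have inv: "psingle 0 (1 / D) * (psingle 0 D * p) = p" using D by (simp add: mult.assoc[symmetric] mult_single)
  show ?thesis
  proof
    assume "splits (psingle 0 D * p)"
    from *[OF this, of "1 / D"] show "splits p" unfolding inv using D by simp
  qed (rule *[OF _ D])
qed

lemma splits_reducible:
  assumes "reducible_mp p"
  shows "splits p"
proof -
  have p: "\<not> pkeys p \<subseteq> {0}" "\<not> irreducible p" using assms by (auto simp: reducible_mp_def)
  have p0: "p \<noteq> 0" using p(1) by auto
  have "\<not> p dvd 1" using unit_keys[of p] p(1) by (metis dvdE)
  then obtain a b where ab: "p = a * b" "\<not> a dvd 1" "\<not> b dvd 1" using p(2) p0 by (auto simp: irreducible_def)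
  have nk: "\<not> pkeys a \<subseteq> {0}" if "\<not> a dvd 1" "a \<noteq> 0" for a :: "mon \<Rightarrow>\<^sub>0 rat"
  proof
    assume k: "pkeys a \<subseteq> {0}"
    have a: "a = psingle 0 (plookup a 0)"
    proof (rule poly_mapping_eqI)
      fix m show "plookup a m = plookup (psingle 0 (plookup a 0)) m"
        using k by (cases "m = 0") (auto simp: lookup_single when_def in_keys_iff)
    qed
    have "plookup a 0 \<noteq> 0" using a that(2) by (metis single_zero)
    hence "a * psingle 0 (1 / plookup a 0) = 1" by (subst a) (simp add: mult_single)
    thus False using that(1) by (metis dvdI)
  qed
  have "a \<noteq> 0" "b \<noteq> 0" using ab(1) p0 by auto
  thus ?thesis using nk ab unfolding splits_def by blast
qed

text \<open>The variables \<open>Y\<close> and \<open>T\<close> are numbered consecutively, the \<open>T\<close> after the \<open>Y\<close>.\<close>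

definition vnum :: "nat \<Rightarrow> nat + nat \<Rightarrow> nat" where
  "vnum r v = (case v of Inl i \<Rightarrow> r + i | Inr j \<Rightarrow> j)"

definition vname :: "nat \<Rightarrow> nat \<Rightarrow> nat + nat" where
  "vname r n = (if n < r then Inr n else Inl (n - r))"

lemma vnum_vname [simp]: "vnum r (vname r n) = n"
  by (simp add: vnum_def vname_def)

lemma vname_vnum: "v \<in> Inl ` A \<union> Inr ` {..<r} \<Longrightarrow> vname r (vnum r v) = v"
  by (auto simp: vnum_def vname_def)

interpretation name_vars: pm_hom "psingle 0 :: rat \<Rightarrow> rat tymp" "\<lambda>n. psingle (push (vname r) n) 1" for r
  by unfold_locales (simp_all add: single_add mult_single push_add)

interpretation number_vars: pm_hom "psingle 0 :: rat \<Rightarrow> rat mpoly" "\<lambda>n. psingle (push (vnum r) n) 1" for r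
  by unfold_locales (simp_all add: single_add mult_single push_add)

lemma number_name_vars: "number_vars.ev r (name_vars.ev r p) = p"
proof -
  have "number_vars.ev r (name_vars.ev r p) = (\<Sum>m\<in>pkeys p. psingle m (plookup p m))"
    by (simp add: name_vars.ev_def number_vars.ev_sum mult_single push_push_id)
  thus ?thesis by (simp flip: pm_sum_singles)
qed

text \<open>Factors of the renumbered polynomial are renamed back, which recovers \<open>p\<close>
  since its variables lie in the proper range. Renumbering undoes renaming for arbitrary
  polynomials, so a factor that becomes a unit was a unit, hence constant, before.\<close>

lemma irreducible_not_splits:
  fixes p :: "rat tymp"
  assumes p: "irreducible p" and k: "\<And>m. m \<in> pkeys p \<Longrightarrow> pkeys m \<subseteq> Inl ` A \<union> Inr ` {..<r}"
  shows "\<not> splits (number_vars.ev r p)"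
proof
  assume "splits (number_vars.ev r p)"
  then obtain g h where gh: "number_vars.ev r p = g * h" "\<not> pkeys g \<subseteq> {0}" "\<not> pkeys h \<subseteq> {0}"
    by (auto simp: splits_def)
  have "name_vars.ev r (number_vars.ev r p) = (\<Sum>m\<in>pkeys p. psingle m (plookup p m))"
    unfolding number_vars.ev_def name_vars.ev_sum
  proof (rule sum.cong)
    fix m assume "m \<in> pkeys p"
    hence "push (vname r) (push (vnum r) m) = m" using k by (intro push_push_id vname_vnum) blast
    thus "name_vars.ev r (psingle 0 (plookup p m) * psingle (push (vnum r) m) 1) = psingle m (plookup p m)"
      by (simp add: mult_single)
  qed simp
  also have "\<dots> = p" by (rule pm_sum_singles[symmetric])
  finally have "p = name_vars.ev r g * name_vars.ev r h" by (simp add: gh(1) name_vars.ev_mult)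
  hence "(name_vars.ev r g) dvd 1 \<or> (name_vars.ev r h) dvd 1" by (rule irreducibleD[OF p])
  moreover have "pkeys a \<subseteq> {0}" if unit: "(name_vars.ev r a) dvd 1" for a
  proof -
    obtain w where w: "1 = name_vars.ev r a * w" using unit by (elim dvdE)
    have "number_vars.ev r (name_vars.ev r a * w) = 1" unfolding w[symmetric] by (rule number_vars.ev_1)
    hence "a * number_vars.ev r w = 1" by (simp only: number_vars.ev_mult number_name_vars)
    thus ?thesis by (rule unit_keys)
  qed
  ultimately show False using gh by blast
qed

interpretation pm_const: comm_ring_hom "psingle 0 :: rat \<Rightarrow> mon \<Rightarrow>\<^sub>0 rat"
  by unfold_locales (simp_all add: single_add mult_single)

interpretation pm_const_poly: map_poly_comm_ring_hom "psingle 0 :: rat \<Rightarrow> mon \<Rightarrow>\<^sub>0 rat" ..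

text \<open>The variable of the coefficients becomes the one numbered \<open>v\<close>. Together
  with \<open>expand\<close> this reads a polynomial with polynomial coefficients as a single
  polynomial in one more variable.\<close>

definition poly_var :: "nat \<Rightarrow> rat poly \<Rightarrow> mon \<Rightarrow>\<^sub>0 rat" where
  "poly_var v c = poly (map_poly (psingle 0) c) (psingle (psingle v 1) 1)"

interpretation expand: pm_hom "poly_var v" "\<lambda>m. psingle m 1" for v
  by unfold_locales (simp_all add: poly_var_def pm_const_poly.hom_add pm_const_poly.hom_mult mult_single)

lemma single_var_power: "psingle (psingle v 1) 1 ^ k = (psingle (psingle v k) 1 :: mon \<Rightarrow>\<^sub>0 rat)"
  by (induction k) (simp_all add: mult_single single_add[symmetric])

lemma poly_var_monom: "poly_var v (monom c k) = psingle (psingle v k) c"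
proof -
  have "poly_var v (monom c k) = psingle 0 c * psingle (psingle v 1) 1 ^ k"
    by (simp add: poly_var_def map_poly_monom poly_monom)
  thus ?thesis by (simp only: single_var_power mult_single) simp
qed

lemma poly_var_sum: "poly_var v c = (\<Sum>k\<le>degree c. psingle (psingle v k) (coeff c k))"
proof -
  have add: "poly_var v (sum f S) = (\<Sum>i\<in>S. poly_var v (f i))" for f :: "nat \<Rightarrow> rat poly" and S
    by (induction S rule: infinite_finite_induct) (simp_all add: expand.phi_add)
  have "poly_var v (\<Sum>k\<le>degree c. monom (coeff c k) k) = (\<Sum>k\<le>degree c. psingle (psingle v k) (coeff c k))"
    by (simp add: add poly_var_monom)
  thus ?thesis by (simp only: poly_as_sum_of_monoms)
qed

text \<open>Since \<open>v\<close> does not occur in the monomials of \<open>G\<close>, a product of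
  a power of \<open>v\<close> and such a monomial determines both, and expanding causes no
  cancellation. The top power in the coefficient of \<open>m\<close> thus survives as a monomial
  containing \<open>m\<close>.\<close>

lemma expand_keys:
  assumes G: "pkeys G \<subseteq> {m. v \<notin> pkeys m}" and E: "pkeys (expand.ev v G) \<subseteq> {0}"
  shows "pkeys G \<subseteq> {0}"
proof
  fix m assume m: "m \<in> pkeys G"
  define k where "k = degree (plookup G m)"
  have c: "coeff (plookup G m) k \<noteq> 0" using m by (simp add: k_def in_keys_iff)
  have uniq: "n = m \<and> l = k" if n: "n \<in> pkeys G" and eq: "psingle v l + n = psingle v k + m" for n l
  proof -
    have v0: "plookup n v = 0" "plookup m v = 0" using G n m by (auto simp: in_keys_iff)
    have e: "plookup (psingle v l + n) i = plookup (psingle v k + m) i" for i using eq by simp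
    have "l = k" using e[of v] v0 by (simp add: lookup_add)
    thus ?thesis using eq by simp
  qed
  have "plookup (expand.ev v G) (psingle v k + m) =
      (\<Sum>n\<in>pkeys G. \<Sum>l\<le>degree (plookup G n). if psingle v l + n = psingle v k + m then coeff (plookup G n) l else 0)"
    by (simp add: expand.ev_def poly_var_sum sum_distrib_right mult_single lookup_sum lookup_single when_def)
  also have "\<dots> = (\<Sum>n\<in>pkeys G. if n = m then coeff (plookup G m) k else 0)"
  proof (rule sum.cong)
    fix n assume n: "n \<in> pkeys G"
    have iff: "psingle v l + n = psingle v k + m \<longleftrightarrow> l = k \<and> n = m" for l
      using uniq[OF n, of l] by (metis (no_types))
    show "(\<Sum>l\<le>degree (plookup G n). if psingle v l + n = psingle v k + m then coeff (plookup G n) l else 0) =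
        (if n = m then coeff (plookup G m) k else 0)"
      unfolding iff by (cases "n = m") (simp_all add: k_def)
  qed simp
  also have "\<dots> = coeff (plookup G m) k" using m by simp
  finally have "psingle v k + m \<in> pkeys (expand.ev v G)" using c by (simp add: in_keys_iff)
  hence "psingle v k + m = 0" using E by blast
  hence "plookup (psingle v k + m) i = 0" for i by simp
  hence "plookup m i = 0" for i by (simp add: lookup_add)
  thus "m \<in> {0}" by (auto intro: poly_mapping_eqI)
qed

text \<open>The monomial that remains when \<open>T\<^sub>i\<close> is specialised for all \<open>i \<ge> j\<close>.\<close>

definition rest :: "nat \<Rightarrow> nat \<Rightarrow> (nat + nat \<Rightarrow>\<^sub>0 nat) \<Rightarrow> mon" where
  "rest r j m = push (vnum r) (pm_restrict (range Inr \<union> Inl ` {..<j}) m)"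

lemma rest_Suc: "rest r (Suc j) m = psingle (r + j) (plookup m (Inl j)) + rest r j m"
proof -
  have "pm_restrict (range Inr \<union> Inl ` {..<Suc j}) m =
      psingle (Inl j) (plookup m (Inl j)) + pm_restrict (range Inr \<union> Inl ` {..<j}) m"
    by (rule poly_mapping_eqI) (auto simp: lookup_add lookup_pm_restrict lookup_single when_def less_Suc_eq)
  thus ?thesis by (simp add: rest_def push_add vnum_def)
qed

lemma rest_0: "rest r 0 m = Poly_Mapping.map_key Inr m"
proof (rule poly_mapping_eqI)
  fix n
  have "plookup (rest r 0 m) n = (\<Sum>v\<in>pkeys m \<inter> range Inr. if v = Inr n then plookup m (Inr n) else 0)"
    unfolding rest_def lookup_push by (rule sum.cong) (auto simp: keys_pm_restrict lookup_pm_restrict vnum_def)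
  also have "\<dots> = plookup m (Inr n)" by (auto simp: in_keys_iff)
  finally show "plookup (rest r 0 m) n = plookup (Poly_Mapping.map_key Inr m) n" by (simp add: map_key.rep_eq)
qed

lemma rest_full: "pkeys m \<subseteq> Inl ` {..<s} \<union> Inr ` A \<Longrightarrow> rest r s m = push (vnum r) m"
  unfolding rest_def by (rule arg_cong[of _ _ "push (vnum r)"])
    (rule poly_mapping_eqI, auto simp: lookup_pm_restrict in_keys_iff)

lemma rest_mons:
  assumes m: "pkeys m \<subseteq> Inl ` {..<s} \<union> Inr ` {..<r}" "sum (plookup m) (pkeys m) \<le> d" and j: "j \<le> s"
  shows "rest r j m \<in> mons d (r + s) \<inter> {n. pkeys n \<subseteq> {..<r + j}}"
proof -
  have "pkeys (rest r j m) \<subseteq> vnum r ` (pkeys m \<inter> (range Inr \<union> Inl ` {..<j}))"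
    unfolding rest_def using keys_push keys_pm_restrict by metis
  hence k: "pkeys (rest r j m) \<subseteq> {..<r + j}" using m(1) by (fastforce simp: vnum_def)
  have "plookup (rest r j m) i \<le> d" for i
  proof -
    have "plookup (rest r j m) i \<le> (\<Sum>v\<in>pkeys m \<inter> (range Inr \<union> Inl ` {..<j}). plookup m v)"
      unfolding rest_def lookup_push keys_pm_restrict by (rule sum_mono) (simp add: lookup_pm_restrict)
    also have "\<dots> \<le> sum (plookup m) (pkeys m)" by (rule sum_mono2) auto
    finally show ?thesis using m(2) by simp
  qed
  thus ?thesis using k j by (auto simp: mons_def)
qed

text \<open>Connects \<open>f\<close> itself, renumbered, at \<open>j = s\<close> with its full
  specialisation at \<open>j = 0\<close>.\<close>

definition partial_spec :: "int tymp \<Rightarrow> nat \<Rightarrow> nat \<Rightarrow> nat \<Rightarrow> (nat \<Rightarrow> rat) \<Rightarrow> rat mpoly" where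
  "partial_spec f r s j t = (\<Sum>m\<in>pkeys f. psingle (rest r j m)
     (of_int (plookup f m) * (\<Prod>i\<in>{j..<s}. t i ^ plookup m (Inl i))))"

lemma partial_spec_0:
  assumes "vars_within s r f"
  shows "partial_spec f r s 0 t = specialize f t"
  unfolding partial_spec_def specialize_def rest_0
proof (rule sum.cong)
  fix m assume "m \<in> pkeys f"
  hence k: "pkeys m \<subseteq> Inl ` {..<s} \<union> Inr ` {..<r}" using assms by (auto simp: vars_within_def)
  have "(\<Prod>i\<in>{0..<s}. t i ^ plookup m (Inl i)) = (\<Prod>i\<in>Inl -` pkeys m. t i ^ plookup m (Inl i))"
    by (rule prod.mono_neutral_right) (use k in \<open>auto simp: in_keys_iff\<close>)
  thus "psingle (Poly_Mapping.map_key Inr m) (of_int (plookup f m) * (\<Prod>i\<in>{0..<s}. t i ^ plookup m (Inl i))) =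
      psingle (Poly_Mapping.map_key Inr m) (of_int (plookup f m) * (\<Prod>i\<in>Inl -` pkeys m. t i ^ plookup m (Inl i)))"
    by simp
qed simp

lemma partial_spec_full:
  assumes "vars_within s r f"
  shows "partial_spec f r s s t = number_vars.ev r (Poly_Mapping.map of_int f)"
proof -
  have k: "pkeys (Poly_Mapping.map (of_int :: int \<Rightarrow> rat) f) = pkeys f" by (auto simp: in_keys_iff lookup_pm_map)
  show ?thesis
    unfolding partial_spec_def number_vars.ev_def k
  proof (rule sum.cong)
    fix m assume "m \<in> pkeys f"
    hence "rest r s m = push (vnum r) m" using assms by (intro rest_full) (auto simp: vars_within_def)
    thus "psingle (rest r s m) (of_int (plookup f m) * (\<Prod>i\<in>{s..<s}. t i ^ plookup m (Inl i))) =
        psingle 0 (plookup (Poly_Mapping.map of_int f) m) * psingle (push (vnum r) m) 1"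
      unfolding mult_single lookup_pm_map[of of_int, OF of_int_0] by simp
  qed simp
qed

text \<open>The variable \<open>T\<^sub>j\<close> is kept in the coefficients, and the denominators of \<open>t\<^sub>i\<close> for \<open>i > j\<close> are cleared.\<close>

definition cleared :: "int tymp \<Rightarrow> nat \<Rightarrow> nat \<Rightarrow> nat \<Rightarrow> (nat \<Rightarrow> rat) \<Rightarrow> (nat + nat \<Rightarrow>\<^sub>0 nat) \<Rightarrow> int" where
  "cleared f d s j t m = plookup f m * (\<Prod>i\<in>{Suc j..<s}.
     fst (quotient_of (t i)) ^ plookup m (Inl i) * snd (quotient_of (t i)) ^ (d - plookup m (Inl i)))"

definition slice :: "int tymp \<Rightarrow> nat \<Rightarrow> nat \<Rightarrow> nat \<Rightarrow> nat \<Rightarrow> (nat \<Rightarrow> rat) \<Rightarrow> mon \<Rightarrow>\<^sub>0 int poly" where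
  "slice f d r s j t = (\<Sum>m\<in>pkeys f. psingle (rest r j m) (monom (cleared f d s j t m) (plookup m (Inl j))))"

lemma lookup_slice: "plookup (slice f d r s j t) k =
    (\<Sum>m\<in>pkeys f. if rest r j m = k then monom (cleared f d s j t m) (plookup m (Inl j)) else 0)"
  by (simp add: slice_def lookup_sum lookup_single when_def)

lemma rat_coeffs_slice: "rat_coeffs (slice f d r s j t) =
    (\<Sum>m\<in>pkeys f. psingle (rest r j m) (monom (of_int (cleared f d s j t m)) (plookup m (Inl j))))"
proof (rule poly_mapping_eqI)
  fix k
  have "of_int_poly (plookup (slice f d r s j t) k) = (\<Sum>m\<in>pkeys f. of_int_poly
      (if rest r j m = k then monom (cleared f d s j t m) (plookup m (Inl j)) else 0) :: rat poly)"
    unfolding lookup_slice by (rule of_int_poly_hom.hom_sum)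
  also have "\<dots> = (\<Sum>m\<in>pkeys f. if rest r j m = k then monom (of_int (cleared f d s j t m)) (plookup m (Inl j)) else 0)"
    by (rule sum.cong) (simp_all add: map_poly_monom)
  finally show "plookup (rat_coeffs (slice f d r s j t)) k =
      plookup (\<Sum>m\<in>pkeys f. psingle (rest r j m) (monom (of_int (cleared f d s j t m)) (plookup m (Inl j)))) k"
    by (simp add: lookup_pm_map lookup_sum lookup_single when_def)
qed

lemma keys_slice: "pkeys (slice f d r s j t) \<subseteq> rest r j ` pkeys f"
proof
  fix k assume "k \<in> pkeys (slice f d r s j t)"
  hence "plookup (slice f d r s j t) k \<noteq> 0" by (simp add: in_keys_iff)
  then obtain m where "m \<in> pkeys f"
    "(if rest r j m = k then monom (cleared f d s j t m) (plookup m (Inl j)) else 0) \<noteq> 0"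
    unfolding lookup_slice by (rule sum.not_neutral_contains_not_neutral)
  thus "k \<in> rest r j ` pkeys f" by (auto split: if_splits)
qed

lemma slice_cong: "(\<And>i. i \<noteq> j \<Longrightarrow> t i = u i) \<Longrightarrow> slice f d r s j t = slice f d r s j u"
  by (simp add: slice_def cleared_def)

lemma of_int_cleared:
  assumes "\<And>i. plookup m (Inl i) \<le> d"
  shows "of_int (cleared f d s j t m) =
    (\<Prod>i\<in>{Suc j..<s}. of_int (snd (quotient_of (t i))) ^ d) *
      (of_int (plookup f m) * (\<Prod>i\<in>{Suc j..<s}. t i ^ plookup m (Inl i)) :: rat)"
proof -
  have "of_int (fst (quotient_of (t i))) ^ k * of_int (snd (quotient_of (t i))) ^ (d - k) =
      of_int (snd (quotient_of (t i))) ^ d * t i ^ k" if "k \<le> d" for i k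
  proof -
    define x y where "x = (of_int (fst (quotient_of (t i))) :: rat)" and "y = (of_int (snd (quotient_of (t i))) :: rat)"
    have y: "y \<noteq> 0" using quotient_of_denom_pos'[of "t i"] by (simp add: y_def)
    have ti: "t i = x / y" unfolding x_def y_def by (rule quotient_of_div) simp
    have "y ^ d = y ^ k * y ^ (d - k)" using that by (simp flip: power_add)
    hence "x ^ k * y ^ (d - k) = y ^ d * (x / y) ^ k" using y by (simp add: power_divide)
    thus ?thesis unfolding ti[symmetric] unfolding x_def y_def .
  qed
  thus ?thesis using assms by (simp add: cleared_def prod.distrib[symmetric] mult.left_commute)
qed

definition denoms :: "nat \<Rightarrow> nat \<Rightarrow> nat \<Rightarrow> (nat \<Rightarrow> rat) \<Rightarrow> rat" where
  "denoms d s j t = (\<Prod>i\<in>{Suc j..<s}. of_int (snd (quotient_of (t i))) ^ d)"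

lemma denoms_nonzero: "denoms d s j t \<noteq> 0"
proof -
  have "snd (quotient_of (t i)) \<noteq> 0" for i using quotient_of_denom_pos'[of "t i"] by simp
  thus ?thesis by (simp add: denoms_def)
qed

text \<open>With its coefficients evaluated at \<open>t j\<close>, a slice is the polynomial after
  the step at \<open>j\<close>; expanded instead, as in \<open>expand_slice\<close>, it is the
  polynomial before that step. Both hold up to the same nonzero scalar
  \<open>denoms d s j t\<close>, which does not affect splitting.\<close>

lemma evalT_slice:
  assumes "\<And>m i. m \<in> pkeys f \<Longrightarrow> plookup m (Inl i) \<le> d" and j: "j < s"
  shows "evalT (t j) (rat_coeffs (slice f d r s j t)) = psingle 0 (denoms d s j t) * partial_spec f r s j t"
  unfolding rat_coeffs_slice evalT.ev_sum partial_spec_def sum_distrib_left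
proof (rule sum.cong)
  fix m assume "m \<in> pkeys f"
  hence "of_int (cleared f d s j t m) * t j ^ plookup m (Inl j) = denoms d s j t *
      (of_int (plookup f m) * (\<Prod>i\<in>{j..<s}. t i ^ plookup m (Inl i)))"
    using of_int_cleared[of m d f s j t] assms by (simp add: denoms_def prod.atLeast_Suc_lessThan mult_ac)
  thus "evalT (t j) (psingle (rest r j m) (monom (of_int (cleared f d s j t m)) (plookup m (Inl j)))) =
      psingle 0 (denoms d s j t) * psingle (rest r j m)
        (of_int (plookup f m) * (\<Prod>i\<in>{j..<s}. t i ^ plookup m (Inl i)))"
    by (simp add: poly_monom mult_single)
qed simp

lemma expand_slice:
  assumes "\<And>m i. m \<in> pkeys f \<Longrightarrow> plookup m (Inl i) \<le> d"
  shows "expand.ev (r + j) (rat_coeffs (slice f d r s j t)) =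
    psingle 0 (denoms d s j t) * partial_spec f r s (Suc j) t"
  unfolding rat_coeffs_slice expand.ev_sum partial_spec_def sum_distrib_left
proof (rule sum.cong)
  fix m assume "m \<in> pkeys f"
  thus "expand.ev (r + j) (psingle (rest r j m) (monom (of_int (cleared f d s j t m)) (plookup m (Inl j)))) =
      psingle 0 (denoms d s j t) * psingle (rest r (Suc j) m)
        (of_int (plookup f m) * (\<Prod>i\<in>{Suc j..<s}. t i ^ plookup m (Inl i)))"
    using of_int_cleared[of m d f s j t] assms
    by (simp add: poly_var_monom mult_single rest_Suc denoms_def)
qed simp

section \<open>Counting\<close>

lemma vars_within_keys: "vars_within s r f \<Longrightarrow> m \<in> pkeys f \<Longrightarrow> pkeys m \<subseteq> Inl ` {..<s} \<union> Inr ` {..<r}"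
  by (auto simp: vars_within_def)

lemma monomial_degree: "m \<in> pkeys f \<Longrightarrow> sum (plookup m) (pkeys m) \<le> total_degree f"
  unfolding total_degree_def by (intro Max_ge) auto

lemma exponent_le_degree:
  assumes "m \<in> pkeys f"
  shows "plookup m v \<le> total_degree f"
proof (cases "v \<in> pkeys m")
  case True
  hence "plookup m v \<le> sum (plookup m) (pkeys m)" by (intro member_le_sum) auto
  thus ?thesis using monomial_degree[OF assms] by simp
qed (simp add: in_keys_iff)

lemma poly_norm_ge_2: "poly_norm f \<ge> 2"
  unfolding poly_norm_def by (intro Max_ge) auto

lemma coeff_le_poly_norm: "m \<in> pkeys f \<Longrightarrow> \<bar>plookup f m\<bar> \<le> poly_norm f"
  unfolding poly_norm_def by (intro Max_ge) auto

text \<open>Several monomials of \<open>f\<close> may fall together in a slice, so a bound for its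
  coefficients involves their number. Renumbering embeds them into a finite set that depends only on
  the degree and the number of variables.\<close>

lemma card_keys_le:
  assumes vars: "vars_within s r f"
  shows "card (pkeys f) \<le> card (mons (total_degree f) (r + s))"
proof (rule card_inj_on_le[of "push (vnum r)"])
  show "inj_on (push (vnum r)) (pkeys f)"
  proof (rule inj_on_inverseI[of _ "push (vname r)"])
    fix m assume "m \<in> pkeys f"
    thus "push (vname r) (push (vnum r) m) = m"
      using vars_within_keys[OF vars] by (intro push_push_id vname_vnum) blast
  qed
  show "push (vnum r) ` pkeys f \<subseteq> mons (total_degree f) (r + s)"
  proof
    fix n assume "n \<in> push (vnum r) ` pkeys f"
    then obtain m where m: "m \<in> pkeys f" "n = push (vnum r) m" by blast
    have "n = rest r s m" using rest_full[OF vars_within_keys[OF vars m(1)]] m(2) by simp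
    thus "n \<in> mons (total_degree f) (r + s)"
      using rest_mons[OF vars_within_keys[OF vars m(1)] monomial_degree[OF m(1)] order.refl] by simp
  qed
qed (rule finite_mons)

lemma cleared_bound:
  assumes m: "m \<in> pkeys f" and d: "d = total_degree f" and b: "b \<ge> 1"
    and t: "\<And>i. i < s \<Longrightarrow> real_of_int (height (t i)) \<le> b"
  shows "real_of_int \<bar>cleared f d s j t m\<bar> \<le> real_of_int (poly_norm f) * (b ^ d) ^ s"
proof -
  have fac: "real_of_int \<bar>fst (quotient_of (t i)) ^ plookup m (Inl i) * snd (quotient_of (t i)) ^ (d - plookup m (Inl i))\<bar> \<le> b ^ d"
    if i: "i < s" for i
  proof -
    have "real_of_int \<bar>fst (quotient_of (t i))\<bar> \<le> b" "real_of_int \<bar>snd (quotient_of (t i))\<bar> \<le> b"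
      using t[OF i] by (auto simp: height_def)
    hence "real_of_int \<bar>fst (quotient_of (t i))\<bar> ^ plookup m (Inl i) * real_of_int \<bar>snd (quotient_of (t i))\<bar> ^ (d - plookup m (Inl i))
      \<le> b ^ plookup m (Inl i) * b ^ (d - plookup m (Inl i))"
      using b by (intro mult_mono power_mono) auto
    also have "\<dots> = b ^ d" using exponent_le_degree[OF m] d by (simp flip: power_add)
    finally show ?thesis by (simp add: abs_mult power_abs)
  qed
  have "real_of_int \<bar>\<Prod>i\<in>{Suc j..<s}. fst (quotient_of (t i)) ^ plookup m (Inl i) * snd (quotient_of (t i)) ^ (d - plookup m (Inl i))\<bar>
     = (\<Prod>i\<in>{Suc j..<s}. real_of_int \<bar>fst (quotient_of (t i)) ^ plookup m (Inl i) * snd (quotient_of (t i)) ^ (d - plookup m (Inl i))\<bar>)"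
    by (simp add: abs_prod)
  also have "\<dots> \<le> (\<Prod>i\<in>{Suc j..<s}. b ^ d)" by (intro prod_mono conjI fac) auto
  also have "\<dots> \<le> (b ^ d) ^ s" using b by (simp add: power_increasing)
  finally have "real_of_int \<bar>\<Prod>i\<in>{Suc j..<s}. fst (quotient_of (t i)) ^ plookup m (Inl i) * snd (quotient_of (t i)) ^ (d - plookup m (Inl i))\<bar> \<le> (b ^ d) ^ s" .
  moreover have "real_of_int \<bar>plookup f m\<bar> \<le> real_of_int (poly_norm f)"
    using coeff_le_poly_norm[OF m] by (simp only: of_int_le_iff)
  ultimately have "real_of_int \<bar>plookup f m\<bar> * real_of_int \<bar>\<Prod>i\<in>{Suc j..<s}. fst (quotient_of (t i)) ^ plookup m (Inl i) * snd (quotient_of (t i)) ^ (d - plookup m (Inl i))\<bar>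
      \<le> real_of_int (poly_norm f) * (b ^ d) ^ s"
    by (intro mult_mono) auto
  thus ?thesis unfolding cleared_def abs_mult of_int_mult .
qed

lemma coeff_slice_bound:
  assumes vars: "vars_within s r f" and d: "d = total_degree f" and b: "b \<ge> 1"
    and t: "\<And>i. i < s \<Longrightarrow> real_of_int (height (t i)) \<le> b"
  shows "real_of_int \<bar>coeff (plookup (slice f d r s j t) k) l\<bar> \<le>
    real (card (mons d (r + s))) * (real_of_int (poly_norm f) * (b ^ d) ^ s)"
proof -
  have nn: "0 \<le> real_of_int (poly_norm f) * (b ^ d) ^ s" using poly_norm_ge_2[of f] b by simp
  have "coeff (plookup (slice f d r s j t) k) l =
      (\<Sum>m\<in>pkeys f. if rest r j m = k \<and> plookup m (Inl j) = l then cleared f d s j t m else 0)"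
    unfolding lookup_slice coeff_sum by (rule sum.cong) auto
  hence "real_of_int \<bar>coeff (plookup (slice f d r s j t) k) l\<bar> \<le>
      (\<Sum>m\<in>pkeys f. \<bar>real_of_int (if rest r j m = k \<and> plookup m (Inl j) = l then cleared f d s j t m else 0)\<bar>)"
    by (simp only: of_int_abs of_int_sum sum_abs)
  also have "\<dots> \<le> (\<Sum>m\<in>pkeys f. real_of_int (poly_norm f) * (b ^ d) ^ s)"
    by (rule sum_mono) (use cleared_bound[OF _ d b t] nn in auto)
  also have "\<dots> \<le> real (card (mons d (r + s))) * (real_of_int (poly_norm f) * (b ^ d) ^ s)"
    using card_keys_le[OF vars] nn d by (simp add: mult_right_mono)
  finally show ?thesis .
qed

lemma first_split:
  fixes P :: "nat \<Rightarrow> bool"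
  assumes "P 0" "\<not> P s"
  shows "\<exists>j < s. P j \<and> \<not> P (Suc j)"
  using assms by (induction s) (auto simp: less_Suc_eq)

lemma finite_box:
  fixes H :: "nat \<Rightarrow> rat set"
  assumes fin: "\<And>i. i < s \<Longrightarrow> finite (H i)"
  shows "finite {t. (\<forall>i\<ge>s. t i = 0) \<and> (\<forall>i < s. t i \<in> H i)}" (is "finite ?S")
proof (rule finite_imageD)
  show "finite ((\<lambda>t. restrict t {..<s}) ` ?S)"
    by (rule finite_subset[OF _ finite_PiE[of "{..<s}" H]]) (use fin in \<open>auto split: if_splits\<close>)
  show "inj_on (\<lambda>t. restrict t {..<s}) ?S"
  proof (rule inj_onI, rule ext)
    fix t u i assume tu: "t \<in> ?S" "u \<in> ?S" "restrict t {..<s} = restrict u {..<s}"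
    show "t i = u i"
    proof (cases "i < s")
      case True
      thus ?thesis using fun_cong[OF tu(3), of i] by simp
    qed (use tu in auto)
  qed
qed

lemma card_by_fibres:
  fixes S :: "(nat \<Rightarrow> rat) set" and b :: real
  assumes box: "S \<subseteq> {t. (\<forall>i\<ge>s. t i = 0) \<and> (\<forall>i < s. t i \<in> H i)}" and fin: "\<And>i. i < s \<Longrightarrow> finite (H i)"
    and j: "j < s" and b: "b \<ge> 0"
    and fibre: "\<And>u. u \<in> S \<Longrightarrow> real (card {t \<in> S. \<forall>i. i \<noteq> j \<longrightarrow> t i = u i}) \<le> b"
  shows "real (card S) \<le> (\<Prod>i\<in>{..<s} - {j}. real (card (H i))) * b"
proof -
  define \<rho> where "\<rho> t = restrict t ({..<s} - {j})" for t :: "nat \<Rightarrow> rat"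
  have \<rho>: "\<rho> t = \<rho> u \<longleftrightarrow> (\<forall>i. i \<noteq> j \<longrightarrow> t i = u i)" if "t \<in> S" "u \<in> S" for t u
  proof
    assume e: "\<rho> t = \<rho> u"
    show "\<forall>i. i \<noteq> j \<longrightarrow> t i = u i"
    proof (intro allI impI)
      fix i assume "i \<noteq> j"
      show "t i = u i"
      proof (cases "i < s")
        case True
        thus ?thesis using fun_cong[OF e, of i] \<open>i \<noteq> j\<close> by (simp add: \<rho>_def)
      next
        case False
        with subsetD[OF box that(1)] subsetD[OF box that(2)] show ?thesis by simp
      qed
    qed
  qed (auto simp: \<rho>_def)
  have "finite S" by (rule finite_subset[OF box finite_box[OF fin]])
  hence "real (card S) = (\<Sum>\<kappa>\<in>\<rho> ` S. real (card {t \<in> S. \<rho> t = \<kappa>}))"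
    using sum.image_gen[of S "\<lambda>_. 1 :: real" \<rho>] by simp
  also have "\<dots> \<le> (\<Sum>\<kappa>\<in>\<rho> ` S. b)"
  proof (rule sum_mono)
    fix \<kappa> assume "\<kappa> \<in> \<rho> ` S"
    then obtain u where u: "u \<in> S" "\<kappa> = \<rho> u" by blast
    have "{t \<in> S. \<rho> t = \<kappa>} = {t \<in> S. \<forall>i. i \<noteq> j \<longrightarrow> t i = u i}" using \<rho> u by blast
    thus "real (card {t \<in> S. \<rho> t = \<kappa>}) \<le> b" using fibre[OF u(1)] by simp
  qed
  also have "\<dots> = real (card (\<rho> ` S)) * b" by simp
  also have "\<dots> \<le> real (card (PiE ({..<s} - {j}) H)) * b"
  proof (intro mult_right_mono b, simp only: of_nat_le_iff, rule card_mono)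
    show "finite (PiE ({..<s} - {j}) H)" using fin by (intro finite_PiE) auto
    show "\<rho> ` S \<subseteq> PiE ({..<s} - {j}) H" using box by (auto simp: \<rho>_def split: if_splits)
  qed
  finally show ?thesis by (simp add: card_PiE)
qed

text \<open>A factorisation of the slice expands to one of the polynomial before the step at
  \<open>j\<close>. The factors stay nonconstant, because the new variable \<open>r + j\<close> does
  not occur in their monomials.\<close>

lemma nosplit_slice:
  assumes deg: "\<And>m i. m \<in> pkeys f \<Longrightarrow> plookup m (Inl i) \<le> d" and ns: "\<not> splits (partial_spec f r s (Suc j) t)"
    and GH: "rat_coeffs (slice f d r s j t) = G * H"
    and k: "pkeys G \<subseteq> {m. pkeys m \<subseteq> {..<r + j}}" "pkeys H \<subseteq> {m. pkeys m \<subseteq> {..<r + j}}"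
  shows "pkeys G \<subseteq> {0} \<or> pkeys H \<subseteq> {0}"
proof (rule ccontr)
  assume neg: "\<not> ?thesis"
  have "psingle 0 (denoms d s j t) * partial_spec f r s (Suc j) t = expand.ev (r + j) G * expand.ev (r + j) H"
    using expand_slice[OF deg, of f r j s t] unfolding GH expand.ev_mult by simp
  moreover have "\<not> pkeys (expand.ev (r + j) G) \<subseteq> {0}" "\<not> pkeys (expand.ev (r + j) H) \<subseteq> {0}"
    using expand_keys[of G "r + j"] expand_keys[of H "r + j"] k neg by force+
  ultimately have "splits (psingle 0 (denoms d s j t) * partial_spec f r s (Suc j) t)"
    unfolding splits_def by blast
  thus False using ns splits_scale[OF denoms_nonzero] by blast
qed

theorem theorem1p6:
  fixes r s d :: nat
  assumes "r \<ge> 1" and "s \<ge> 1"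
  shows "\<exists>C > 0. \<forall>(f :: int tymp) (B :: nat \<Rightarrow> real).
     vars_within s r f \<longrightarrow>
     irreducible (Poly_Mapping.map (of_int :: int \<Rightarrow> rat) f) \<longrightarrow>
     total_degree f = d \<longrightarrow>
     1 \<le> B 0 \<longrightarrow> (\<forall>i. i + 1 < s \<longrightarrow> B i \<le> B (i + 1)) \<longrightarrow>
     real (S_count f s B) \<le>
       C * (B 0 * (\<Prod>i \<in> {1..<s}. (B i)\<^sup>2) *
            (ln (real_of_int (poly_norm f)) + ln (B (s - 1))) ^ 5)"
proof -
  obtain C1 where C1: "C1 > 0" and one: "\<And>(F :: mon \<Rightarrow>\<^sub>0 int poly) V K B.
      K \<ge> 2 \<Longrightarrow> B \<ge> 1 \<Longrightarrow> pkeys F \<subseteq> mons d (r + s) \<inter> {m. pkeys m \<subseteq> V} \<Longrightarrow>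
      (\<And>m. degree (plookup F m) \<le> d) \<Longrightarrow> (\<And>m k. real_of_int \<bar>coeff (plookup F m) k\<bar> \<le> K) \<Longrightarrow>
      (\<And>G H. rat_coeffs F = G * H \<Longrightarrow> pkeys G \<subseteq> {m. pkeys m \<subseteq> V} \<Longrightarrow> pkeys H \<subseteq> {m. pkeys m \<subseteq> V} \<Longrightarrow>
         pkeys G \<subseteq> {0} \<or> pkeys H \<subseteq> {0}) \<Longrightarrow>
      real (card {t. real_of_int (max \<bar>fst (quotient_of t)\<bar> \<bar>snd (quotient_of t)\<bar>) \<le> B \<and> splits (evalT t (rat_coeffs F))})
        \<le> C1 * B * (ln K + ln B) ^ 5"
    apply (rule one_variable_bound[of d "r + s"])
    subgoal premises prems for C by (rule prems(1)[OF prems(2)], rule prems(3))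
    done
  define Mc where "Mc = real (card (mons d (r + s)))"
  have "0 \<in> mons d (r + s)" by (simp add: mons_def)
  hence "card (mons d (r + s)) > 0" using finite_mons by (auto simp: card_gt_0_iff)
  hence Mc: "Mc \<ge> 1" by (simp add: Mc_def)
  have ln2: "ln (2 :: real) > 0" by simp
  \<comment> \<open>Chosen for \<open>ln K + ln b \<le> c * L\<close>: the first summand pays for
    \<open>Mc\<close>, the 2 for \<open>poly_norm f\<close> and the separate \<open>ln b\<close>,
    and \<open>d * s\<close> for the powers of numerators and denominators in a slice.\<close>
  define c where "c = ln Mc / ln 2 + 2 + real (d * s)"
  have c: "c > 0" using Mc ln2 by (simp add: c_def add_pos_nonneg add_nonneg_pos)
  \<comment> \<open>The factor \<open>s\<close> stems from the possible steps \<open>j\<close>, and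
    \<open>9 ^ s\<close> from the number of rationals of bounded height in each coordinate.\<close>
  define C where "C = real s * (9 ^ s * (C1 * c ^ 5))"
  show ?thesis
  proof (intro exI[of _ C] conjI allI impI)
    show "C > 0" using C1 c assms by (simp add: C_def)
    fix f :: "int tymp" and B :: "nat \<Rightarrow> real"
    assume vars: "vars_within s r f" and irr: "irreducible (Poly_Mapping.map (of_int :: int \<Rightarrow> rat) f)"
      and df: "total_degree f = d" and B0: "1 \<le> B 0" and mono: "\<forall>i. i + 1 < s \<longrightarrow> B i \<le> B (i + 1)"
    have incr: "B i \<le> B k" if "i \<le> k" "k < s" for i k
      using that
    proof (induction k rule: dec_induct)
      case (step n)
      have "B i \<le> B n" using step by simp
      also have "B n \<le> B (Suc n)" using mono step.prems by simp
      finally show ?case .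
    qed simp
    have B1: "B i \<ge> 1" if "i < s" for i using incr[of 0 i] that B0 by simp
    define b where "b = B (s - 1)"
    have Bb: "B i \<le> b" if "i < s" for i unfolding b_def using that by (intro incr) auto
    have b1: "b \<ge> 1" unfolding b_def using assms by (intro B1) simp
    define N where "N = real_of_int (poly_norm f)"
    have N: "N \<ge> 2" using poly_norm_ge_2[of f] by (simp add: N_def)
    define L where "L = ln N + ln b"
    have lnN: "ln N \<ge> ln 2" using N by simp
    have lnb: "ln b \<ge> 0" using b1 by simp
    have L: "L \<ge> ln 2" "L > 0" "ln N \<le> L" "ln b \<le> L" using lnN lnb ln2 unfolding L_def by linarith+
    \<comment> \<open>Bounds the coefficients of every slice taken at a point of the box.\<close>
    define K where "K = Mc * (N * (b ^ d) ^ s)"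
    have bd: "(b ^ d) ^ s \<ge> 1" using b1 by (simp add: one_le_power)
    have K: "K \<ge> 2"
    proof -
      have "1 * (2 * 1) \<le> Mc * (N * (b ^ d) ^ s)" using Mc N bd by (intro mult_mono) auto
      thus ?thesis by (simp add: K_def)
    qed
    have KL: "ln K + ln b \<le> c * L"
    proof -
      have "ln K = ln Mc + (ln N + real (d * s) * ln b)"
        using Mc N b1 by (simp add: K_def ln_mult ln_realpow mult_ac)
      moreover have "ln Mc \<le> ln Mc / ln 2 * L"
      proof -
        have "ln Mc * ln 2 \<le> ln Mc * L" using Mc L by (intro mult_left_mono) auto
        thus ?thesis using ln2 by (simp add: pos_le_divide_eq)
      qed
      moreover have "real (d * s) * ln b \<le> real (d * s) * L" using L by (intro mult_left_mono) auto
      ultimately show ?thesis using L unfolding c_def by (simp add: distrib_right)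
    qed
    have deg: "plookup m (Inl i) \<le> d" if "m \<in> pkeys f" for m i using exponent_le_degree[OF that] df by simp
    define H where "H i = {t. real_of_int (height t) \<le> B i}" for i
    have finH: "finite (H i)" "real (card (H i)) \<le> 9 * (B i)\<^sup>2" if "i < s" for i
      using heights_finite[OF B1[OF that]] by (simp_all add: H_def height_def)
    define Box where "Box = {t. (\<forall>i\<ge>s. t i = (0 :: rat)) \<and> (\<forall>i < s. t i \<in> H i)}"
    \<comment> \<open>The tuples for which the step at \<open>j\<close> creates a splitting. Every
      tuple to be counted lies in some \<open>S j\<close>, as \<open>f\<close> does not split and
      its specialisation does.\<close>
    define S where "S j = {t \<in> Box. splits (partial_spec f r s j t) \<and> \<not> splits (partial_spec f r s (Suc j) t)}" for j
    define P where "P = (\<Prod>i\<in>{1..<s}. (B i)\<^sup>2)"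
    have fibre: "real (card {t \<in> S j. \<forall>i. i \<noteq> j \<longrightarrow> t i = u i}) \<le> C1 * B j * (c * L) ^ 5"
      if j: "j < s" and u: "u \<in> S j" for j u
    proof -
      \<comment> \<open>A slice does not involve coordinate \<open>j\<close> of the point, so one
        polynomial serves the whole fibre through \<open>u\<close>.\<close>
      define F where "F = slice f d r s j u"
      define X where "X = {x. real_of_int (height x) \<le> B j \<and> splits (evalT x (rat_coeffs F))}"
      have "X \<subseteq> H j" by (auto simp: X_def H_def)
      hence finX: "finite X" using finH(1)[OF j] finite_subset by blast
      have "card {t \<in> S j. \<forall>i. i \<noteq> j \<longrightarrow> t i = u i} \<le> card X"
      proof (rule card_inj_on_le[of "\<lambda>t. t j"])
        show "inj_on (\<lambda>t. t j) {t \<in> S j. \<forall>i. i \<noteq> j \<longrightarrow> t i = u i}"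
        proof (rule inj_onI, rule ext)
          fix t t' i assume "t \<in> {t \<in> S j. \<forall>i. i \<noteq> j \<longrightarrow> t i = u i}" "t' \<in> {t \<in> S j. \<forall>i. i \<noteq> j \<longrightarrow> t i = u i}" "t j = t' j"
          thus "t i = t' i" by (cases "i = j") auto
        qed
        show "(\<lambda>t. t j) ` {t \<in> S j. \<forall>i. i \<noteq> j \<longrightarrow> t i = u i} \<subseteq> X"
        proof
          fix x assume "x \<in> (\<lambda>t. t j) ` {t \<in> S j. \<forall>i. i \<noteq> j \<longrightarrow> t i = u i}"
          then obtain t where t: "t \<in> S j" "\<And>i. i \<noteq> j \<Longrightarrow> t i = u i" "x = t j" by blast
          have F: "F = slice f d r s j t" unfolding F_def by (rule slice_cong) (rule t(2)[symmetric])
          have "evalT (t j) (rat_coeffs (slice f d r s j t)) = psingle 0 (denoms d s j t) * partial_spec f r s j t"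
            by (rule evalT_slice[OF _ j]) (rule deg)
          hence "splits (evalT x (rat_coeffs F)) \<longleftrightarrow> splits (psingle 0 (denoms d s j t) * partial_spec f r s j t)"
            by (simp only: F t(3))
          hence "splits (evalT x (rat_coeffs F))"
            unfolding splits_scale[OF denoms_nonzero] using t(1) by (simp add: S_def)
          thus "x \<in> X" using t(1,3) j by (auto simp: X_def S_def Box_def H_def)
        qed
      qed (rule finX)
      also have "real (card X) \<le> C1 * B j * (ln K + ln (B j)) ^ 5"
        unfolding X_def height_def
      proof (rule one[OF K B1[OF j], of F "{..<r + j}"])
        show "pkeys F \<subseteq> mons d (r + s) \<inter> {m. pkeys m \<subseteq> {..<r + j}}"
        proof
          fix k assume "k \<in> pkeys F"
          then obtain m where m: "m \<in> pkeys f" "k = rest r j m" using keys_slice unfolding F_def by blast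
          have sj: "j \<le> s" using j by simp
          have md: "sum (plookup m) (pkeys m) \<le> d" using monomial_degree[OF m(1)] df by simp
          show "k \<in> mons d (r + s) \<inter> {m. pkeys m \<subseteq> {..<r + j}}"
            unfolding m(2) by (rule rest_mons[OF vars_within_keys[OF vars m(1)] md sj])
        qed
        show "degree (plookup F k) \<le> d" for k
          unfolding F_def lookup_slice
        proof (rule degree_sum_le)
          fix m assume "m \<in> pkeys f"
          thus "degree (if rest r j m = k then monom (cleared f d s j u m) (plookup m (Inl j)) else 0) \<le> d"
            using deg degree_monom_le[of "cleared f d s j u m" "plookup m (Inl j)"] by (auto intro: order.trans)
        qed simp
        have "real_of_int (height (u i)) \<le> b" if i: "i < s" for i
        proof -
          have "u i \<in> H i" using u i by (simp add: S_def Box_def)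
          hence "real_of_int (height (u i)) \<le> B i" by (simp add: H_def)
          thus ?thesis using Bb[OF i] by linarith
        qed
        thus "real_of_int \<bar>coeff (plookup F m) k\<bar> \<le> K" for m k
          unfolding F_def K_def Mc_def N_def by (intro coeff_slice_bound vars df[symmetric] b1)
        show "pkeys G \<subseteq> {0} \<or> pkeys H \<subseteq> {0}"
          if "rat_coeffs F = G * H" "pkeys G \<subseteq> {m. pkeys m \<subseteq> {..<r + j}}" "pkeys H \<subseteq> {m. pkeys m \<subseteq> {..<r + j}}" for G H
          by (rule nosplit_slice[OF deg _ that(1)[unfolded F_def] that(2,3)]) (use u in \<open>simp_all add: S_def\<close>)
      qed
      also have "\<dots> \<le> C1 * B j * (c * L) ^ 5"
      proof -
        have "ln (B j) \<le> ln b" using B1[OF j] Bb[OF j] by simp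
        hence "ln K + ln (B j) \<le> c * L" using KL by linarith
        moreover have "0 \<le> ln K + ln (B j)" using K B1[OF j] by simp
        ultimately show ?thesis using C1 B1[OF j] by (intro mult_left_mono power_mono) auto
      qed
      finally show ?thesis by simp
    qed
    \<comment> \<open>Monotonicity makes \<open>j = 0\<close> the worst case for the product in
      which one square is replaced by its base. Multiplying by \<open>B j\<close> completes the
      product of all squares, which can be compared for different \<open>j\<close>.\<close>
    have prodB: "(\<Prod>i\<in>{..<s} - {j}. (B i)\<^sup>2) * B j \<le> B 0 * P" if j: "j < s" for j
    proof -
      define Y where "Y = (\<Prod>i\<in>{..<s} - {j}. (B i)\<^sup>2) * B j"
      have Bj: "B j > 0" "B 0 \<le> B j" using B1[OF j] incr[of 0 j] j by auto
      have "Y * B j = (\<Prod>i < s. (B i)\<^sup>2)"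
        using j by (subst prod.remove[of _ j]) (auto simp: Y_def power2_eq_square mult_ac)
      also have "\<dots> = (B 0)\<^sup>2 * P"
      proof -
        have "{..<s} - {0} = {1..<s}" by auto
        thus ?thesis using assms by (subst prod.remove[of _ 0]) (auto simp: P_def)
      qed
      also have "\<dots> = B 0 * (B 0 * P)" by (simp add: power2_eq_square)
      also have "\<dots> \<le> B j * (B 0 * P)"
        using Bj B0 by (intro mult_right_mono mult_nonneg_nonneg) (auto simp: P_def intro!: prod_nonneg)
      finally have "Y * B j \<le> (B 0 * P) * B j" by (simp add: mult.commute)
      thus ?thesis using Bj(1) unfolding Y_def by (rule mult_right_le_imp_le)
    qed
    have cS: "real (card (S j)) \<le> 9 ^ s * (C1 * c ^ 5) * (B 0 * P * L ^ 5)" if j: "j < s" for j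
    proof -
      have nn: "C1 * B j * (c * L) ^ 5 \<ge> 0" using C1 B1[OF j] c L by simp
      have "real (card (S j)) \<le> (\<Prod>i\<in>{..<s} - {j}. real (card (H i))) * (C1 * B j * (c * L) ^ 5)"
        by (rule card_by_fibres[OF _ finH(1) j nn fibre[OF j]]) (auto simp: S_def Box_def)
      also have "\<dots> \<le> (\<Prod>i\<in>{..<s} - {j}. 9 * (B i)\<^sup>2) * (C1 * B j * (c * L) ^ 5)"
        using finH by (intro mult_right_mono nn prod_mono) auto
      also have "(\<Prod>i\<in>{..<s} - {j}. 9 * (B i)\<^sup>2) = 9 ^ (s - 1) * (\<Prod>i\<in>{..<s} - {j}. (B i)\<^sup>2)"
        using j by (simp add: prod.distrib)
      also have "\<dots> * (C1 * B j * (c * L) ^ 5) =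
          9 ^ (s - 1) * ((C1 * (c * L) ^ 5) * ((\<Prod>i\<in>{..<s} - {j}. (B i)\<^sup>2) * B j))" by (simp add: mult_ac)
      also have "\<dots> \<le> 9 ^ s * ((C1 * (c * L) ^ 5) * (B 0 * P))"
        using C1 c L B1 j
        by (intro mult_mono mult_left_mono prodB mult_nonneg_nonneg power_increasing prod_nonneg) (auto intro: order.trans[OF _ B1])
      also have "\<dots> = 9 ^ s * (C1 * c ^ 5) * (B 0 * P * L ^ 5)" by (simp add: power_mult_distrib mult_ac)
      finally show ?thesis .
    qed
    have "{t. (\<forall>i\<ge>s. t i = 0) \<and> (\<forall>i < s. real_of_int (height (t i)) \<le> B i) \<and> reducible_mp (specialize f t)} \<subseteq> (\<Union>j < s. S j)"
    proof
      fix t assume "t \<in> {t. (\<forall>i\<ge>s. t i = 0) \<and> (\<forall>i < s. real_of_int (height (t i)) \<le> B i) \<and> reducible_mp (specialize f t)}"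
      hence t: "t \<in> Box" "reducible_mp (specialize f t)" by (auto simp: Box_def H_def)
      have 0: "splits (partial_spec f r s 0 t)" unfolding partial_spec_0[OF vars] by (rule splits_reducible[OF t(2)])
      have "\<not> splits (number_vars.ev r (Poly_Mapping.map (of_int :: int \<Rightarrow> rat) f))"
      proof (rule irreducible_not_splits[OF irr])
        fix m assume "m \<in> pkeys (Poly_Mapping.map (of_int :: int \<Rightarrow> rat) f)"
        hence "m \<in> pkeys f" by (simp add: in_keys_iff lookup_pm_map)
        thus "pkeys m \<subseteq> Inl ` {..<s} \<union> Inr ` {..<r}" by (rule vars_within_keys[OF vars])
      qed
      hence 1: "\<not> splits (partial_spec f r s s t)" unfolding partial_spec_full[OF vars] .
      obtain j where "j < s" "splits (partial_spec f r s j t)" "\<not> splits (partial_spec f r s (Suc j) t)"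
        using first_split[of "\<lambda>j. splits (partial_spec f r s j t)", OF 0 1] by (elim exE conjE)
      thus "t \<in> (\<Union>j < s. S j)" using t(1) by (auto simp: S_def)
    qed
    moreover have "finite (S j)" if "j < s" for j
      by (rule finite_subset[of _ Box]) (use finite_box[OF finH(1)] in \<open>auto simp: S_def Box_def\<close>)
    ultimately have "S_count f s B \<le> card (\<Union>j < s. S j)" unfolding S_count_def by (intro card_mono) auto
    also have "\<dots> \<le> (\<Sum>j < s. card (S j))" by (rule card_UN_le) simp
    finally have "real (S_count f s B) \<le> (\<Sum>j < s. real (card (S j)))" by (simp flip: of_nat_sum)
    also have "\<dots> \<le> (\<Sum>j < s. 9 ^ s * (C1 * c ^ 5) * (B 0 * P * L ^ 5))" by (rule sum_mono) (simp add: cS)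
    also have "\<dots> = C * (B 0 * P * L ^ 5)" by (simp add: C_def)
    finally show "real (S_count f s B) \<le> C * (B 0 * (\<Prod>i \<in> {1..<s}. (B i)\<^sup>2) *
        (ln (real_of_int (poly_norm f)) + ln (B (s - 1))) ^ 5)"
      by (simp only: P_def L_def N_def b_def)
  qed
qed

end
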